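(* Let $N\subset M$ be a finite index, depth $2$ inclusion of II$_1$ factors with $\lambda^{-1}=[M:N]$ and Jones tower $N\subset M\subset M_1\subset M_2\subset\cdots$; let $B=M'\cap M_2$ carry the $C^*$-quantum groupoid structure described in the context and act on $M_1$ by $b\triangleright x=\lambda^{-1}E_{M_1}(bxe_2)$. Then $M_1^B=M$, i.e. $M$ is the fixed point subalgebra of $M_1$.
   Context: Quantum groupoid (weak Hopf algebra): a finite-dimensional space $H$ that is a unital algebra and a counital coalgebra $(\Delta,\varepsilon)$ (Sweedler notation) such that: $\Delta$ is a (not necessarily unital) algebra homomorphism with $(\Delta\otimes\mathrm{id})\Delta(1)=(\Delta(1)\otimes1)(1\otimes\Delta(1))=(1\otimes\Delta(1))(\Delta(1)\otimes1)$; $\varepsilon(fgh)=\varepsilon(fg_{(1)})\varepsilon(g_{(2)}h)=\varepsilon(fg_{(2)})\varepsilon(g_{(1)}h)$; and there is a linear antipode $S$ with $h_{(1)}S(h_{(2)})=\varepsilon_t(h):=\varepsilon(1_{(1)}h)1_{(2)}$, $S(h_{(1)})h_{(2)}=\varepsilon_s(h):=1_{(1)}\varepsilon(h1_{(2)})$, $S(h_{(1)})h_{(2)}S(h_{(3)})=S(h)$. A $C^*$-quantum groupoid is one over $\mathbb C$ that is a finite-dimensional $C^*$-algebra with $\Delta$ a $*$-homomorphism. For a $C^*$-quantum groupoid $H$ acting on a von Neumann algebra $P$, the fixed point subalgebra is $P^H=\{m\in P\mid x\triangleright m=\varepsilon_t(x)\triangleright m\ \ \forall x\in H\}$. Subfactor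 setting: $M_1=\langle M,e_1\rangle$, $M_2=\langle M_1,e_2\rangle$ with Jones projections $e_1\in N'\cap M_1$, $e_2\in M'\cap M_2$; depth $2$ means that $N'\cap M_2$ is the basic construction of $N'\cap M\subset N'\cap M_1$. $\tau$ is the normalized trace on $M_2$, $E_P$ the $\tau$-preserving conditional expectation onto $P$. Put $A=N'\cap M_1$, $B=M'\cap M_2$, $B_t=M'\cap M_1$, $B_s=M_1'\cap M_2$. $\mathrm{Tr}$ is the trace of the left regular representation of $B_t$, and $w\in Z(B_t)$ is the positive invertible element with $\tau(wz)=\mathrm{Tr}(z)$ for $z\in B_t$. The pairing $\langle a,b\rangle=\lambda^{-2}\tau(ae_2e_1wb)$ ($a\in A,b\in B$) is non-degenerate. $B$ is a $C^*$-quantum groupoid (with counital subalgebras $B_s,B_t$) via its algebra structure and: $\langle a_1\otimes a_2,\Delta(b)\rangle=\langle a_1a_2,b\rangle$; $\varepsilon(b)=\langle1,b\rangle$; $S(b)=S_B(wbw^{-1})$ where $S_B:B\to B$ is determined by $E_{M_1}(be_1e_2)=E_{M_1}(e_2e_1S_B(b))$; involution $b^\dag=S(w)^{-1}b^*S(w)$. *)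

theory Defs
  imports "HOL-Analysis.Analysis"
begin

section \<open>Complex vector spaces, algebras and Hilbert spaces\<close>

class complex_vector = ab_group_add +
  fixes scaleC :: "complex \<Rightarrow> 'a \<Rightarrow> 'a"  (infixr \<open>*\<^sub>C\<close> 75)
  assumes scaleC_add_right: "c *\<^sub>C (x + y) = c *\<^sub>C x + c *\<^sub>C y"
    and scaleC_add_left: "(c + d) *\<^sub>C x = c *\<^sub>C x + d *\<^sub>C x"
    and scaleC_scaleC: "c *\<^sub>C d *\<^sub>C x = (c * d) *\<^sub>C x"
    and scaleC_one: "1 *\<^sub>C x = x"

interpretation complex_vector: vector_space "scaleC :: complex \<Rightarrow> 'a \<Rightarrow> 'a::complex_vector"
  by unfold_locales (simp_all add: scaleC_add_right scaleC_add_left scaleC_scaleC scaleC_one)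

class complex_algebra = complex_vector + ring + monoid_mult +
  assumes scaleC_mult_left: "(c *\<^sub>C x) * y = c *\<^sub>C (x * y)"
    and scaleC_mult_right: "x * (c *\<^sub>C y) = c *\<^sub>C (x * y)"

text \<open>The inner product is linear in the second argument.\<close>

class chilbert_space = banach + complex_vector +
  fixes cinner :: "'a \<Rightarrow> 'a \<Rightarrow> complex"
  assumes scaleR_scaleC: "r *\<^sub>R x = complex_of_real r *\<^sub>C x"
    and cinner_commute: "cinner x y = cnj (cinner y x)"
    and cinner_add_right: "cinner x (y + z) = cinner x y + cinner x z"
    and cinner_scaleC_right: "cinner x (c *\<^sub>C y) = c * cinner x y"
    and cinner_self: "cinner x x = complex_of_real ((norm x)\<^sup>2)"

definition finite_dimensional :: "'a::complex_vector set \<Rightarrow> bool" where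
  "finite_dimensional V \<longleftrightarrow> (\<exists>F. finite F \<and> F \<subseteq> V \<and> V \<subseteq> complex_vector.span F)"

text \<open>The trace of an endomorphism \<open>f\<close> of a finite-dimensional subspace \<open>V\<close>; it does not
  depend on the basis that is chosen.\<close>

definition endo_trace :: "'a::complex_vector set \<Rightarrow> ('a \<Rightarrow> 'a) \<Rightarrow> complex" where
  "endo_trace V f =
    (let C = (SOME C. complex_vector.independent C \<and> complex_vector.span C = V)
     in \<Sum>v\<in>C. complex_vector.representation C (f v) v)"

definition two_sided_inverse :: "'a::monoid_mult \<Rightarrow> 'a" where
  "two_sided_inverse x = (THE y. x * y = 1 \<and> y * x = 1)"


section \<open>Quantum groupoids\<close>

text \<open>An element of \<open>V \<otimes> V\<close> is represented by a list of pairs, \<open>[(x\<^sub>1, y\<^sub>1), \<dots>, (x\<^sub>n, y\<^sub>n)]\<close> standing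
  for \<open>x\<^sub>1 \<otimes> y\<^sub>1 + \<dots> + x\<^sub>n \<otimes> y\<^sub>n\<close>, so that Sweedler notation becomes a sum over a list.  Two lists
  represent the same tensor iff no bilinear form separates them, and similarly for triple tensors
  and trilinear forms.  For a subspace \<open>H\<close> this is also equality in \<open>H \<otimes> H\<close>, because forms on \<open>H\<close>
  extend to the ambient space.\<close>

abbreviation cfunctional :: "('a::complex_vector \<Rightarrow> complex) \<Rightarrow> bool" where
  "cfunctional \<equiv> Vector_Spaces.linear (*\<^sub>C) (*)"

definition bilinear_form :: "('a::complex_vector \<Rightarrow> 'a \<Rightarrow> complex) \<Rightarrow> bool" where
  "bilinear_form \<beta> \<longleftrightarrow> (\<forall>y. cfunctional (\<lambda>x. \<beta> x y)) \<and> (\<forall>x. cfunctional (\<lambda>y. \<beta> x y))"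

definition trilinear_form :: "('a::complex_vector \<Rightarrow> 'a \<Rightarrow> 'a \<Rightarrow> complex) \<Rightarrow> bool" where
  "trilinear_form \<beta> \<longleftrightarrow>
    (\<forall>y z. cfunctional (\<lambda>x. \<beta> x y z)) \<and> (\<forall>x z. cfunctional (\<lambda>y. \<beta> x y z)) \<and>
    (\<forall>x y. cfunctional (\<lambda>z. \<beta> x y z))"

definition tensor_eq :: "('a::complex_vector \<times> 'a) list \<Rightarrow> ('a \<times> 'a) list \<Rightarrow> bool"
    (infix \<open>=\<^sub>\<otimes>\<close> 50) where
  "s =\<^sub>\<otimes> t \<longleftrightarrow>
    (\<forall>\<beta>. bilinear_form \<beta> \<longrightarrow> (\<Sum>(x, y)\<leftarrow>s. \<beta> x y) = (\<Sum>(x, y)\<leftarrow>t. \<beta> x y))"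

definition tensor3_eq :: "('a::complex_vector \<times> 'a \<times> 'a) list \<Rightarrow> ('a \<times> 'a \<times> 'a) list \<Rightarrow> bool"
    (infix \<open>=\<^sub>\<otimes>\<^sub>3\<close> 50) where
  "s =\<^sub>\<otimes>\<^sub>3 t \<longleftrightarrow>
    (\<forall>\<beta>. trilinear_form \<beta> \<longrightarrow> (\<Sum>(x, y, z)\<leftarrow>s. \<beta> x y z) = (\<Sum>(x, y, z)\<leftarrow>t. \<beta> x y z))"

definition linear_map_on :: "'a::complex_vector set \<Rightarrow> ('a \<Rightarrow> 'b::complex_vector) \<Rightarrow> bool" where
  "linear_map_on V f \<longleftrightarrow>
    (\<forall>x\<in>V. \<forall>y\<in>V. f (x + y) = f x + f y) \<and> (\<forall>c. \<forall>x\<in>V. f (c *\<^sub>C x) = c *\<^sub>C f x)"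

definition functional_on :: "'a::complex_vector set \<Rightarrow> ('a \<Rightarrow> complex) \<Rightarrow> bool" where
  "functional_on V f \<longleftrightarrow>
    (\<forall>x\<in>V. \<forall>y\<in>V. f (x + y) = f x + f y) \<and> (\<forall>c. \<forall>x\<in>V. f (c *\<^sub>C x) = c * f x)"

definition eps_t :: "('a::complex_algebra \<Rightarrow> ('a \<times> 'a) list) \<Rightarrow> ('a \<Rightarrow> complex) \<Rightarrow> 'a \<Rightarrow> 'a" where
  "eps_t \<Delta> \<epsilon> h = (\<Sum>(x, y)\<leftarrow>\<Delta> 1. \<epsilon> (x * h) *\<^sub>C y)"

definition eps_s :: "('a::complex_algebra \<Rightarrow> ('a \<times> 'a) list) \<Rightarrow> ('a \<Rightarrow> complex) \<Rightarrow> 'a \<Rightarrow> 'a" where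
  "eps_s \<Delta> \<epsilon> h = (\<Sum>(x, y)\<leftarrow>\<Delta> 1. \<epsilon> (h * y) *\<^sub>C x)"

definition unital_subalgebra :: "'a::complex_algebra set \<Rightarrow> bool" where
  "unital_subalgebra H \<longleftrightarrow>
    complex_vector.subspace H \<and> 1 \<in> H \<and> (\<forall>x\<in>H. \<forall>y\<in>H. x * y \<in> H)"

definition counital_coalgebra ::
    "'a::complex_algebra set \<Rightarrow> ('a \<Rightarrow> ('a \<times> 'a) list) \<Rightarrow> ('a \<Rightarrow> complex) \<Rightarrow> bool" where
  "counital_coalgebra H \<Delta> \<epsilon> \<longleftrightarrow>
    (\<forall>h\<in>H. set (\<Delta> h) \<subseteq> H \<times> H) \<and>
    (\<forall>g\<in>H. \<forall>h\<in>H. \<Delta> (g + h) =\<^sub>\<otimes> \<Delta> g @ \<Delta> h) \<and>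
    (\<forall>c. \<forall>h\<in>H. \<Delta> (c *\<^sub>C h) =\<^sub>\<otimes> [(c *\<^sub>C x, y). (x, y) \<leftarrow> \<Delta> h]) \<and>
    functional_on H \<epsilon> \<and>
    (\<forall>h\<in>H. [(x, y, z). (u, z) \<leftarrow> \<Delta> h, (x, y) \<leftarrow> \<Delta> u]
         =\<^sub>\<otimes>\<^sub>3 [(x, y, z). (x, u) \<leftarrow> \<Delta> h, (y, z) \<leftarrow> \<Delta> u]) \<and>
    (\<forall>h\<in>H. (\<Sum>(x, y)\<leftarrow>\<Delta> h. \<epsilon> x *\<^sub>C y) = h \<and> (\<Sum>(x, y)\<leftarrow>\<Delta> h. \<epsilon> y *\<^sub>C x) = h)"

definition quantum_groupoid ::
    "'a::complex_algebra set \<Rightarrow> ('a \<Rightarrow> ('a \<times> 'a) list) \<Rightarrow> ('a \<Rightarrow> complex) \<Rightarrow> ('a \<Rightarrow> 'a) \<Rightarrow> bool" where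
  "quantum_groupoid H \<Delta> \<epsilon> S \<longleftrightarrow>
    finite_dimensional H \<and> unital_subalgebra H \<and> counital_coalgebra H \<Delta> \<epsilon> \<and>
    (\<forall>g\<in>H. \<forall>h\<in>H. \<Delta> (g * h) =\<^sub>\<otimes> [(x * u, y * v). (x, y) \<leftarrow> \<Delta> g, (u, v) \<leftarrow> \<Delta> h]) \<and>
    [(x, y, z). (u, z) \<leftarrow> \<Delta> 1, (x, y) \<leftarrow> \<Delta> u]
      =\<^sub>\<otimes>\<^sub>3 [(x, y * u, v). (x, y) \<leftarrow> \<Delta> 1, (u, v) \<leftarrow> \<Delta> 1] \<and>
    [(x, y, z). (u, z) \<leftarrow> \<Delta> 1, (x, y) \<leftarrow> \<Delta> u]
      =\<^sub>\<otimes>\<^sub>3 [(x, u * y, v). (x, y) \<leftarrow> \<Delta> 1, (u, v) \<leftarrow> \<Delta> 1] \<and>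
    (\<forall>f\<in>H. \<forall>g\<in>H. \<forall>h\<in>H.
      \<epsilon> (f * g * h) = (\<Sum>(x, y)\<leftarrow>\<Delta> g. \<epsilon> (f * x) * \<epsilon> (y * h)) \<and>
      \<epsilon> (f * g * h) = (\<Sum>(x, y)\<leftarrow>\<Delta> g. \<epsilon> (f * y) * \<epsilon> (x * h))) \<and>
    S ` H \<subseteq> H \<and> linear_map_on H S \<and>
    (\<forall>h\<in>H. (\<Sum>(x, y)\<leftarrow>\<Delta> h. x * S y) = eps_t \<Delta> \<epsilon> h \<and>
            (\<Sum>(x, y)\<leftarrow>\<Delta> h. S x * y) = eps_s \<Delta> \<epsilon> h \<and>
            (\<Sum>(u, z)\<leftarrow>\<Delta> h. \<Sum>(x, y)\<leftarrow>\<Delta> u. S x * y * S z) = S h)"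

text \<open>No completeness requirement is needed for a C*-norm on a finite-dimensional algebra.\<close>

definition finite_dim_cstar_algebra :: "'a::complex_algebra set \<Rightarrow> ('a \<Rightarrow> 'a) \<Rightarrow> bool" where
  "finite_dim_cstar_algebra H star \<longleftrightarrow>
    finite_dimensional H \<and> unital_subalgebra H \<and>
    (\<forall>x\<in>H. star x \<in> H \<and> star (star x) = x) \<and>
    (\<forall>x\<in>H. \<forall>y\<in>H. star (x + y) = star x + star y \<and> star (x * y) = star y * star x) \<and>
    (\<forall>c. \<forall>x\<in>H. star (c *\<^sub>C x) = cnj c *\<^sub>C star x) \<and>
    (\<exists>\<nu> :: 'a \<Rightarrow> real.
      (\<forall>x\<in>H. \<nu> x \<ge> 0 \<and> (\<nu> x = 0 \<longrightarrow> x = 0) \<and> \<nu> (star x * x) = (\<nu> x)\<^sup>2) \<and>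
      (\<forall>c. \<forall>x\<in>H. \<nu> (c *\<^sub>C x) = cmod c * \<nu> x) \<and>
      (\<forall>x\<in>H. \<forall>y\<in>H. \<nu> (x + y) \<le> \<nu> x + \<nu> y \<and> \<nu> (x * y) \<le> \<nu> x * \<nu> y))"

definition cstar_quantum_groupoid ::
    "'a::complex_algebra set \<Rightarrow> ('a \<Rightarrow> ('a \<times> 'a) list) \<Rightarrow> ('a \<Rightarrow> complex) \<Rightarrow> ('a \<Rightarrow> 'a) \<Rightarrow>
      ('a \<Rightarrow> 'a) \<Rightarrow> bool" where
  "cstar_quantum_groupoid H \<Delta> \<epsilon> S star \<longleftrightarrow>
    quantum_groupoid H \<Delta> \<epsilon> S \<and> finite_dim_cstar_algebra H star \<and>
    (\<forall>h\<in>H. \<Delta> (star h) =\<^sub>\<otimes> [(star x, star y). (x, y) \<leftarrow> \<Delta> h])"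

definition fixed_point_subalgebra ::
    "'a::complex_algebra set \<Rightarrow> ('a \<Rightarrow> ('a \<times> 'a) list) \<Rightarrow> ('a \<Rightarrow> complex) \<Rightarrow>
      ('a \<Rightarrow> 'p \<Rightarrow> 'p) \<Rightarrow> 'p set \<Rightarrow> 'p set" where
  "fixed_point_subalgebra H \<Delta> \<epsilon> act P = {m \<in> P. \<forall>x\<in>H. act x m = act (eps_t \<Delta> \<epsilon> x) m}"


section \<open>Bounded operators on a complex Hilbert space\<close>

definition bounded_clinear :: "('a::chilbert_space \<Rightarrow> 'a) \<Rightarrow> bool" where
  "bounded_clinear f \<longleftrightarrow> bounded_linear f \<and> (\<forall>c x. f (c *\<^sub>C x) = c *\<^sub>C f x)"

typedef (overloaded) 'a bop = "{f :: 'a::chilbert_space \<Rightarrow> 'a. bounded_clinear f}"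
  morphisms bapp Bop
  by (rule exI[of _ "\<lambda>x. 0"]) (simp add: bounded_clinear_def)

setup_lifting type_definition_bop

lemma bounded_linear_scaleC: "bounded_linear (\<lambda>x::'a::chilbert_space. c *\<^sub>C x)"
proof (rule bounded_linear_intro)
  fix r and x y :: 'a
  show "c *\<^sub>C (x + y) = c *\<^sub>C x + c *\<^sub>C y"
    by (rule scaleC_add_right)
  show "c *\<^sub>C (r *\<^sub>R x) = r *\<^sub>R (c *\<^sub>C x)"
    by (simp add: scaleR_scaleC scaleC_scaleC mult.commute)
  have "complex_of_real ((norm (c *\<^sub>C x))\<^sup>2) = complex_of_real ((norm x * cmod c)\<^sup>2)"
  proof -
    have "cinner (c *\<^sub>C x) (c *\<^sub>C x) = c * cnj (cinner x (c *\<^sub>C x))"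
      by (metis cinner_commute cinner_scaleC_right)
    also have "\<dots> = (c * cnj c) * cnj (cinner x x)"
      by (simp add: cinner_scaleC_right)
    also have "\<dots> = complex_of_real ((norm x * cmod c)\<^sup>2)"
      by (simp add: cinner_self complex_norm_square power_mult_distrib mult.commute
          flip: of_real_power)
    finally show ?thesis by (simp add: cinner_self)
  qed
  then have "(norm (c *\<^sub>C x))\<^sup>2 = (norm x * cmod c)\<^sup>2"
    by (simp only: of_real_eq_iff)
  then show "norm (c *\<^sub>C x) \<le> norm x * cmod c"
    by (simp add: power2_eq_iff_nonneg)
qed

instantiation bop :: (chilbert_space) complex_algebra
begin

lift_definition zero_bop :: "'a bop" is "\<lambda>x. 0"
  by (simp add: bounded_clinear_def)

lift_definition one_bop :: "'a bop" is "\<lambda>x. x"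
  by (simp add: bounded_clinear_def)

lift_definition plus_bop :: "'a bop \<Rightarrow> 'a bop \<Rightarrow> 'a bop" is "\<lambda>S T x. S x + T x"
  by (simp add: bounded_clinear_def bounded_linear_add scaleC_add_right)

lift_definition minus_bop :: "'a bop \<Rightarrow> 'a bop \<Rightarrow> 'a bop" is "\<lambda>S T x. S x - T x"
  by (simp add: bounded_clinear_def bounded_linear_sub complex_vector.scale_right_diff_distrib)

lift_definition uminus_bop :: "'a bop \<Rightarrow> 'a bop" is "\<lambda>T x. - T x"
  by (simp add: bounded_clinear_def bounded_linear_minus)

lift_definition times_bop :: "'a bop \<Rightarrow> 'a bop \<Rightarrow> 'a bop" is "\<lambda>S T x. S (T x)"
  by (auto simp: bounded_clinear_def intro: bounded_linear_compose)

lift_definition scaleC_bop :: "complex \<Rightarrow> 'a bop \<Rightarrow> 'a bop" is "\<lambda>c T x. c *\<^sub>C T x"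
  by (auto simp: bounded_clinear_def scaleC_scaleC mult.commute
      intro: bounded_linear_compose[OF bounded_linear_scaleC])

instance
proof
  fix S T U :: "'a bop" and c d :: complex
  show "S + T + U = S + (T + U)" by transfer (simp add: add.assoc)
  show "S + T = T + S" by transfer (simp add: add.commute)
  show "0 + S = S" by transfer simp
  show "- S + S = 0" by transfer simp
  show "S - T = S + - T" by transfer simp
  show "S * T * U = S * (T * U)" by transfer simp
  show "(S + T) * U = S * U + T * U" by transfer simp
  show "S * (T + U) = S * T + S * U"
    by transfer (simp add: bounded_clinear_def bounded_linear.linear linear_add)
  show "1 * S = S" by transfer simp
  show "S * 1 = S" by transfer simp
  show "c *\<^sub>C (S + T) = c *\<^sub>C S + c *\<^sub>C T" by transfer (simp add: scaleC_add_right)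
  show "(c + d) *\<^sub>C S = c *\<^sub>C S + d *\<^sub>C S" by transfer (simp add: scaleC_add_left)
  show "c *\<^sub>C d *\<^sub>C S = (c * d) *\<^sub>C S" by transfer (simp add: scaleC_scaleC)
  show "1 *\<^sub>C S = S" by transfer (simp add: scaleC_one)
  show "(c *\<^sub>C S) * T = c *\<^sub>C (S * T)" by transfer simp
  show "S * (c *\<^sub>C T) = c *\<^sub>C (S * T)" by transfer (simp add: bounded_clinear_def)
qed

end

text \<open>Every bounded operator has exactly one adjoint, by the Riesz representation theorem.\<close>

definition adj :: "'a::chilbert_space bop \<Rightarrow> 'a bop" where
  "adj T = (THE S. \<forall>x y. cinner (bapp S x) y = cinner x (bapp T y))"

definition positive_op :: "'a::chilbert_space bop \<Rightarrow> bool" where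
  "positive_op T \<longleftrightarrow> (\<forall>x. cinner x (bapp T x) \<in> \<real>\<^sub>\<ge>\<^sub>0)"

definition projection_onto :: "'a::chilbert_space set \<Rightarrow> 'a bop \<Rightarrow> bool" where
  "projection_onto V p \<longleftrightarrow> (\<forall>x. bapp p x \<in> V \<and> (\<forall>v\<in>V. cinner v (x - bapp p x) = 0))"

definition orbit_closure :: "'a::chilbert_space bop set \<Rightarrow> 'a \<Rightarrow> 'a set" where
  "orbit_closure P \<xi> = closure ((\<lambda>x. bapp x \<xi>) ` P)"


section \<open>Von Neumann algebras and \<open>II\<^sub>1\<close> factors\<close>

definition commutant :: "'a::monoid_mult set \<Rightarrow> 'a set" where
  "commutant P = {x. \<forall>y\<in>P. x * y = y * x}"

definition rel_commutant :: "'a::monoid_mult set \<Rightarrow> 'a set \<Rightarrow> 'a set" where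
  "rel_commutant P Q = commutant P \<inter> Q"

definition von_neumann_algebra :: "'a::chilbert_space bop set \<Rightarrow> bool" where
  "von_neumann_algebra P \<longleftrightarrow> adj ` P \<subseteq> P \<and> commutant (commutant P) = P"

definition factor :: "'a::chilbert_space bop set \<Rightarrow> bool" where
  "factor P \<longleftrightarrow> von_neumann_algebra P \<and> rel_commutant P P = range (\<lambda>c. c *\<^sub>C 1)"

text \<open>Normality is ultraweak continuity.\<close>

definition normal_functional :: "'a::chilbert_space bop set \<Rightarrow> ('a bop \<Rightarrow> complex) \<Rightarrow> bool" where
  "normal_functional P \<phi> \<longleftrightarrow>
    (\<exists>\<xi> \<eta> :: nat \<Rightarrow> 'a.
      summable (\<lambda>n. (norm (\<xi> n))\<^sup>2) \<and> summable (\<lambda>n. (norm (\<eta> n))\<^sup>2) \<and>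
      (\<forall>x\<in>P. (\<lambda>n. cinner (\<xi> n) (bapp x (\<eta> n))) sums \<phi> x))"

definition normalized_trace :: "'a::chilbert_space bop set \<Rightarrow> ('a bop \<Rightarrow> complex) \<Rightarrow> bool" where
  "normalized_trace P \<tau> \<longleftrightarrow>
    functional_on P \<tau> \<and> \<tau> 1 = 1 \<and>
    (\<forall>x\<in>P. \<forall>y\<in>P. \<tau> (x * y) = \<tau> (y * x)) \<and>
    (\<forall>x\<in>P. \<tau> (adj x * x) \<in> \<real>\<^sub>\<ge>\<^sub>0 \<and> (\<tau> (adj x * x) = 0 \<longrightarrow> x = 0)) \<and>
    normal_functional P \<tau>"

definition II1_factor :: "'a::chilbert_space bop set \<Rightarrow> bool" where
  "II1_factor P \<longleftrightarrow> factor P \<and> \<not> finite_dimensional P \<and> (\<exists>\<tau>. normalized_trace P \<tau>)"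

definition conditional_expectation ::
    "('a::chilbert_space bop \<Rightarrow> complex) \<Rightarrow> 'a bop set \<Rightarrow> 'a bop set \<Rightarrow> ('a bop \<Rightarrow> 'a bop) \<Rightarrow> bool" where
  "conditional_expectation \<tau> Q P E \<longleftrightarrow>
    E ` Q \<subseteq> P \<and> linear_map_on Q E \<and> (\<forall>x\<in>P. E x = x) \<and>
    (\<forall>x\<in>Q. positive_op (E (adj x * x))) \<and>
    (\<forall>p\<in>P. \<forall>x\<in>Q. \<forall>q\<in>P. E (p * x * q) = p * E x * q) \<and>
    (\<forall>x\<in>Q. \<tau> (E x) = \<tau> x)"


section \<open>Basic construction and Jones index\<close>

definition star_hom_on ::
    "'a::chilbert_space bop set \<Rightarrow> ('a bop \<Rightarrow> 'b::chilbert_space bop) \<Rightarrow> bool" where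
  "star_hom_on P \<pi> \<longleftrightarrow>
    linear_map_on P \<pi> \<and> \<pi> 1 = 1 \<and> (\<forall>x\<in>P. \<forall>y\<in>P. \<pi> (x * y) = \<pi> x * \<pi> y) \<and>
    (\<forall>x\<in>P. \<pi> (adj x) = adj (\<pi> x))"

text \<open>\<open>\<pi>\<close> is the left regular representation of \<open>M\<close> on \<open>L\<^sup>2(M, \<tau>)\<close>, which is the whole space \<open>'k\<close>,
  and \<open>\<Omega>\<close> is the image of the unit of \<open>M\<close> in it.\<close>

definition standard_rep ::
    "('h::chilbert_space bop \<Rightarrow> complex) \<Rightarrow> 'h bop set \<Rightarrow> ('h bop \<Rightarrow> 'k::chilbert_space bop) \<Rightarrow> 'k \<Rightarrow>
      bool" where
  "standard_rep \<tau> M \<pi> \<Omega> \<longleftrightarrow>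
    star_hom_on M \<pi> \<and> (\<forall>x\<in>M. cinner \<Omega> (bapp (\<pi> x) \<Omega>) = \<tau> x) \<and>
    orbit_closure (\<pi> ` M) \<Omega> = UNIV"

text \<open>\<open>R\<close> is the basic construction \<open>\<langle>M, e\<rangle>\<close> of \<open>N \<subseteq> M\<close> with Jones projection \<open>e\<close>: there is a
  *-isomorphism from \<open>R\<close> onto the von Neumann algebra on \<open>L\<^sup>2(M, \<tau>)\<close> that is generated by \<open>M\<close>,
  acting by left multiplication, and the projection onto \<open>L\<^sup>2(N, \<tau>)\<close>; it extends the left regular
  representation of \<open>M\<close> and maps \<open>e\<close> to that projection.  The first argument only
  names the Hilbert space that plays the role of \<open>L\<^sup>2(M, \<tau>)\<close>.\<close>

definition basic_construction ::
    "'k::chilbert_space itself \<Rightarrow> ('h::chilbert_space bop \<Rightarrow> complex) \<Rightarrow> 'h bop set \<Rightarrow> 'h bop set \<Rightarrow>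
      'h bop set \<Rightarrow> 'h bop \<Rightarrow> bool" where
  "basic_construction K \<tau> N M R e \<longleftrightarrow>
    N \<subseteq> M \<and> M \<subseteq> R \<and> e \<in> R \<and>
    (\<exists>(\<pi> :: 'h bop \<Rightarrow> 'k bop) \<Omega>.
      star_hom_on R \<pi> \<and> inj_on \<pi> R \<and> standard_rep \<tau> M \<pi> \<Omega> \<and>
      projection_onto (orbit_closure (\<pi> ` N) \<Omega>) (\<pi> e) \<and>
      \<pi> ` R = commutant (commutant (\<pi> ` M \<union> {\<pi> e})))"

text \<open>The Murray-von Neumann coupling constant \<open>dim\<^sub>P(H)\<close> of a \<open>II\<^sub>1\<close> factor \<open>P\<close> on \<open>H\<close> whose commutant is
  finite: the quotient of the trace in \<open>P\<close> of the projection onto the closure of \<open>P' \<xi>\<close> by the trace in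
  \<open>P'\<close> of the projection onto the closure of \<open>P \<xi>\<close>, for any nonzero vector \<open>\<xi>\<close>.\<close>

definition coupling_constant :: "'a::chilbert_space bop set \<Rightarrow> real \<Rightarrow> bool" where
  "coupling_constant P d \<longleftrightarrow>
    (\<exists>tr tr'. normalized_trace P tr \<and> normalized_trace (commutant P) tr' \<and>
      (\<forall>\<xi> p q. \<xi> \<noteq> 0 \<longrightarrow> projection_onto (orbit_closure (commutant P) \<xi>) p \<longrightarrow>
        projection_onto (orbit_closure P \<xi>) q \<longrightarrow> tr p = complex_of_real d * tr' q))"

text \<open>\<open>[M : N] = dim\<^sub>N(L\<^sup>2(M, \<tau>))\<close>, and this is the finite number \<open>d\<close>.\<close>

definition finite_jones_index ::
    "'k::chilbert_space itself \<Rightarrow> ('h::chilbert_space bop \<Rightarrow> complex) \<Rightarrow> 'h bop set \<Rightarrow> 'h bop set \<Rightarrow>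
      real \<Rightarrow> bool" where
  "finite_jones_index K \<tau> N M d \<longleftrightarrow>
    (\<exists>(\<pi> :: 'h bop \<Rightarrow> 'k bop) \<Omega>. standard_rep \<tau> M \<pi> \<Omega> \<and> coupling_constant (\<pi> ` N) d)"


section \<open>The structure on \<open>M' \<inter> M\<^sub>2\<close>\<close>

definition canonical_weight ::
    "('a::chilbert_space bop \<Rightarrow> complex) \<Rightarrow> 'a bop set \<Rightarrow> 'a bop \<Rightarrow> bool" where
  "canonical_weight \<tau> C w \<longleftrightarrow>
    w \<in> rel_commutant C C \<and> positive_op w \<and> (\<exists>v. w * v = 1 \<and> v * w = 1) \<and>
    (\<forall>z\<in>C. \<tau> (w * z) = endo_trace C (\<lambda>x. z * x))"

definition pairing ::
    "real \<Rightarrow> ('a::chilbert_space bop \<Rightarrow> complex) \<Rightarrow> 'a bop \<Rightarrow> 'a bop \<Rightarrow> 'a bop \<Rightarrow> 'a bop \<Rightarrow> 'a bop \<Rightarrow>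
      complex" where
  "pairing lam \<tau> e1 e2 w a b = complex_of_real (1 / lam\<^sup>2) * \<tau> (a * e2 * e1 * w * b)"

definition tower_action ::
    "real \<Rightarrow> ('a::chilbert_space bop \<Rightarrow> 'a bop) \<Rightarrow> 'a bop \<Rightarrow> 'a bop \<Rightarrow> 'a bop \<Rightarrow> 'a bop" where
  "tower_action lam E e2 b x = complex_of_real (1 / lam) *\<^sub>C E (b * x * e2)"

end

theory Submission
  imports Defs
begin

text \<open>
  The element \<open>\<lambda>\<^sup>-\<^sup>1 E(b e\<^sub>2)\<close> of \<open>M' \<inter> M\<^sub>1\<close> is the counital image \<open>\<epsilon>\<^sub>t(b)\<close>: the pairing with
  \<open>A = N' \<inter> M\<^sub>1\<close> does not distinguish the two, because \<open>\<epsilon>(x b)\<close> is the pairing of \<open>\<lambda>\<^sup>-\<^sup>1 E(b e\<^sub>2)\<close> with \<open>x\<close>, and the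
  pairing is non-degenerate on \<open>B\<close>.  Since \<open>b \<triangleright> x = x (b \<triangleright> 1)\<close> for \<open>x \<in> M\<close>, all elements of \<open>M\<close> are fixed.
  Conversely \<open>\<epsilon>\<^sub>t(e\<^sub>2) = 1\<close>, so a fixed point \<open>x\<close> satisfies \<open>e\<^sub>2 x e\<^sub>2 = x e\<^sub>2\<close>, while \<open>e\<^sub>2 x e\<^sub>2 = n e\<^sub>2\<close>
  for some \<open>n \<in> M\<close>; applying \<open>E\<close> gives \<open>x = n\<close>.

  The facts about the tower that enter are \<open>e M\<^sub>1 e = M e\<close>, the Markov property of the trace, the
  push-down property \<open>M\<^sub>2 e\<^sub>2 = M\<^sub>1 e\<^sub>2\<close>, and \<open>\<tau>(e\<^sub>1) = \<tau>(e\<^sub>2) = \<lambda>\<close>.  They rest on two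
  properties of an algebra \<open>P\<close> with a faithful normal trace: a bounded operator on \<open>L\<^sup>2(P, \<tau>)\<close> that commutes
  with right multiplications is a left multiplication, and on a factor every trace that is
  dominated by a faithful normal one is proportional to it.  The index enters by conjugating the trace of the commutant \<open>N'\<close> on \<open>L\<^sup>2(M)\<close> to a trace
  on \<open>M\<^sub>1\<close>, which agrees with \<open>\<tau>\<close> on \<open>e\<^sub>1\<close>.
\<close>

section \<open>Hilbert spaces\<close>

text \<open>\<open>L^2(P, \<tau>)\<close> cannot be formed as a type from a set \<open>P\<close> of
  operators. A normal trace is written instead as one vector state x \<mapsto> <\<zeta>, x \<zeta>>
  on square-summable sequences of vectors, and operators on \<open>L^2(P, \<tau>)\<close> become
  operators compressed to the closure of \<open>P \<zeta>\<close>. \<open>M1\<close> is only assumed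
  to be a von Neumann algebra, so uniqueness of the trace on a factor is applied to \<open>N\<close>
  and \<open>M\<close> alone. Two traces on \<open>M1\<close> are compared at \<open>e1\<close>
  only, through density of the ideal generated by \<open>e1\<close>. Trace tests and this ideal take
  the place of a finite basis of \<open>M\<close> over \<open>N\<close>. The index refers to a
  standard representation chosen independently of the one in the basic construction. The antilinear
  map x \<mapsto> \<open>adj x\<close> between the two serves both to compare them and to carry
  \<open>M1\<close> into the commutant of \<open>N\<close>. For \<open>e2\<close> no index is
  consulted: its trace is found from the relations between \<open>e1\<close> and
  \<open>e2\<close>.\<close>

lemma cinner_add_left: "cinner (x + y) z = cinner x z + cinner y z"
  by (metis cinner_add_right cinner_commute complex_cnj_add)

lemma cinner_diff_left: "cinner (x - y) z = cinner x z - cinner y z"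
  by (metis cinner_add_left add_diff_cancel_right' diff_add_cancel)

lemma cinner_diff_right: "cinner x (y - z) = cinner x y - cinner x z"
  by (metis cinner_add_right add_diff_cancel_right' diff_add_cancel)

lemma cinner_scaleC_left: "cinner (c *\<^sub>C x) y = cnj c * cinner x y"
  by (metis cinner_commute cinner_scaleC_right complex_cnj_mult)

lemma cmod_cinner_le: "cmod (cinner x y) \<le> norm x * norm y" for x y :: "'a::chilbert_space"
proof (cases "x = 0")
  case True
  have "cinner x y = 0"
    unfolding True by (metis cinner_diff_left diff_self)
  then show ?thesis by simp
next
  case False
  define c where "c = cinner x y"
  define n where "n = (norm x)\<^sup>2"
  have npos: "n > 0" using False by (simp add: n_def)
  have xx: "cinner x x = of_real n" by (simp add: cinner_self n_def)
  \<comment> \<open>\<open>n\<close> times the component of \<open>y\<close> orthogonal to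
    \<open>x\<close>; the factor \<open>n\<close> avoids a division.\<close>
  define u where "u = complex_of_real n *\<^sub>C y - c *\<^sub>C x"
  have yx: "cinner y x = cnj c" unfolding c_def by (rule cinner_commute)
  have "cinner u u = of_real n * (of_real n * cinner y y - c * cnj c)"
    unfolding u_def by (simp add: cinner_diff_left cinner_diff_right cinner_scaleC_left
        cinner_scaleC_right xx yx c_def[symmetric] algebra_simps)
  also have "\<dots> = of_real (n * (n * (norm y)\<^sup>2 - (cmod c)\<^sup>2))"
    unfolding complex_norm_square[of c, symmetric] cinner_self by simp
  finally have "(norm u)\<^sup>2 = n * (n * (norm y)\<^sup>2 - (cmod c)\<^sup>2)"
    unfolding cinner_self of_real_eq_iff .
  then have "0 \<le> n * (n * (norm y)\<^sup>2 - (cmod c)\<^sup>2)"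
    using zero_le_power2 by metis
  then have "(cmod c)\<^sup>2 \<le> n * (norm y)\<^sup>2"
    using npos by (simp add: zero_le_mult_iff)
  then have "(cmod c)\<^sup>2 \<le> (norm x * norm y)\<^sup>2" by (simp add: n_def power_mult_distrib)
  then show ?thesis unfolding c_def by (rule power2_le_imp_le) simp
qed

interpretation cinner: bounded_bilinear "cinner :: 'a::chilbert_space \<Rightarrow> 'a \<Rightarrow> complex"
proof
  fix a a' b b' :: 'a and r :: real
  show "cinner (a + a') b = cinner a b + cinner a' b"
    by (rule cinner_add_left)
  show "cinner a (b + b') = cinner a b + cinner a b'"
    by (rule cinner_add_right)
  show "cinner a (r *\<^sub>R b) = r *\<^sub>R cinner a b"
    by (simp add: scaleR_scaleC cinner_scaleC_right scaleR_conv_of_real)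
  show "cinner (r *\<^sub>R a) b = r *\<^sub>R cinner a b"
    by (simp add: scaleR_scaleC cinner_scaleC_left scaleR_conv_of_real)
  show "\<exists>K. \<forall>(a::'a) b. norm (cinner a b) \<le> norm a * norm b * K"
    by (metis cmod_cinner_le mult.right_neutral)
qed

declare cinner.zero_left [simp] cinner.zero_right [simp]

lemma norm_sq_cinner: "(norm x)\<^sup>2 = Re (cinner x x)"
  by (simp add: cinner_self)

lemma cinner_self_eq_0: "cinner x x = 0 \<longleftrightarrow> x = 0"
  by (simp add: cinner_self)

lemma norm_scaleC: "norm (c *\<^sub>C x) = cmod c * norm x" for x :: "'a::chilbert_space"
proof -
  have "complex_of_real ((norm (c *\<^sub>C x))\<^sup>2) = (c * cnj c) * complex_of_real ((norm x)\<^sup>2)"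
    unfolding cinner_self[symmetric] by (simp add: cinner_scaleC_left cinner_scaleC_right)
  also have "\<dots> = complex_of_real ((cmod c * norm x)\<^sup>2)"
    unfolding complex_norm_square[symmetric] by (simp add: power_mult_distrib)
  finally have "(norm (c *\<^sub>C x))\<^sup>2 = (cmod c * norm x)\<^sup>2"
    by (simp only: of_real_eq_iff)
  then show ?thesis by (simp add: power2_eq_iff_nonneg)
qed

lemma norm_sq_add:
  "(norm (x + y))\<^sup>2 = (norm x)\<^sup>2 + 2 * Re (cinner x y) + (norm y)\<^sup>2" for x y :: "'a::chilbert_space"
proof -
  have "Re (cinner y x) = Re (cinner x y)" by (subst cinner_commute) simp
  then show ?thesis
    by (simp add: norm_sq_cinner cinner.add_left cinner.add_right)
qed

lemma norm_sq_diff: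
  "(norm (x - y))\<^sup>2 = (norm x)\<^sup>2 - 2 * Re (cinner x y) + (norm y)\<^sup>2" for x y :: "'a::chilbert_space"
  using norm_sq_add[of x "- y"] by (simp add: cinner.minus_right)

lemma cinner_ext_closure:
  assumes "\<And>x. x \<in> X \<Longrightarrow> cinner x u = cinner x v" "y \<in> closure X"
  shows "cinner y u = cinner y v"
proof -
  obtain s where s: "\<And>n. s n \<in> X" "s \<longlonglongrightarrow> y" using assms(2) unfolding closure_sequential by blast
  have "(\<lambda>n. cinner (s n) u) \<longlonglongrightarrow> cinner y u" "(\<lambda>n. cinner (s n) v) \<longlonglongrightarrow> cinner y v"
    by (intro cinner.tendsto s tendsto_const)+
  then show ?thesis using s(1) assms(1) LIMSEQ_unique by auto
qed

lemma eq_if_cinner_closure: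
  assumes "\<And>x. x \<in> X \<Longrightarrow> cinner x u = cinner x v" "u - v \<in> closure X"
  shows "u = v"
proof -
  have "cinner (u - v) u = cinner (u - v) v" by (rule cinner_ext_closure[OF assms])
  then have "cinner (u - v) (u - v) = 0" by (simp add: cinner.diff_right)
  then show ?thesis by (simp add: cinner_self_eq_0)
qed

lemma tendsto_scaleC:
  "(f \<longlongrightarrow> l) F \<Longrightarrow> ((\<lambda>x. c *\<^sub>C f x) \<longlongrightarrow> c *\<^sub>C l) F" for l :: "'a::chilbert_space"
  by (rule bounded_linear.tendsto[OF bounded_linear_scaleC])

lemma subspace_closure:
  fixes L :: "'a::chilbert_space set"
  assumes "complex_vector.subspace L" shows "complex_vector.subspace (closure L)"
proof (rule complex_vector.subspaceI)
  show "0 \<in> closure L" using assms closure_subset complex_vector.subspace_0 by blast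
next
  fix x y assume "x \<in> closure L" "y \<in> closure L"
  then obtain s t where s: "\<And>n. s n \<in> L" "s \<longlonglongrightarrow> x" and t: "\<And>n. t n \<in> L" "t \<longlonglongrightarrow> y"
    unfolding closure_sequential by metis
  have "(\<lambda>n. s n + t n) \<longlonglongrightarrow> x + y" by (intro tendsto_add s t)
  moreover have "s n + t n \<in> L" for n by (rule complex_vector.subspace_add[OF assms s(1) t(1)])
  ultimately show "x + y \<in> closure L" unfolding closure_sequential by (intro exI[of _ "\<lambda>n. s n + t n"]) simp
next
  fix c x assume "x \<in> closure L"
  then obtain s where s: "\<And>n. s n \<in> L" "s \<longlonglongrightarrow> x" unfolding closure_sequential by metis
  have "(\<lambda>n. c *\<^sub>C s n) \<longlonglongrightarrow> c *\<^sub>C x" by (intro tendsto_scaleC s)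
  moreover have "c *\<^sub>C s n \<in> L" for n by (rule complex_vector.subspace_scale[OF assms s(1)])
  ultimately show "c *\<^sub>C x \<in> closure L" unfolding closure_sequential by (intro exI[of _ "\<lambda>n. c *\<^sub>C s n"]) simp
qed

lemma linear_map_on_diff:
  assumes "complex_vector.subspace X" "linear_map_on X a" "x \<in> X" "y \<in> X"
  shows "a (x - y) = a x - a y"
proof -
  have "a (x + (-1) *\<^sub>C y) = a x + (-1) *\<^sub>C a y"
    using assms complex_vector.subspace_scale unfolding linear_map_on_def by metis
  then show ?thesis by simp
qed

lemma functional_on_diff:
  assumes "complex_vector.subspace X" "functional_on X a" "x \<in> X" "y \<in> X"
  shows "a (x - y) = a x - a y"
proof -
  have "a (x + (-1) *\<^sub>C y) = a x + (-1) * a y"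
    using assms complex_vector.subspace_scale unfolding functional_on_def by metis
  then show ?thesis by simp
qed

lemma subspace_image:
  assumes "complex_vector.subspace X" "linear_map_on X a"
  shows "complex_vector.subspace (a ` X)"
proof (rule complex_vector.subspaceI)
  have "a (0 *\<^sub>C 0) = 0 *\<^sub>C a 0"
    using assms complex_vector.subspace_0 unfolding linear_map_on_def by metis
  then show "0 \<in> a ` X" using complex_vector.subspace_0[OF assms(1)] by force
next
  fix u v assume "u \<in> a ` X" "v \<in> a ` X"
  then obtain x y where "x \<in> X" "y \<in> X" "u = a x" "v = a y" by blast
  then have "u + v = a (x + y)" "x + y \<in> X"
    using assms complex_vector.subspace_add unfolding linear_map_on_def by auto
  then show "u + v \<in> a ` X" by blast
next
  fix c u assume "u \<in> a ` X"
  then obtain x where "x \<in> X" "u = a x" by blast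
  then have "c *\<^sub>C u = a (c *\<^sub>C x)" "c *\<^sub>C x \<in> X"
    using assms complex_vector.subspace_scale unfolding linear_map_on_def by auto
  then show "c *\<^sub>C u \<in> a ` X" by blast
qed

section \<open>Riesz representation and operators of bounded forms\<close>

lemma cinner_bound_closure:
  fixes v :: "'a::chilbert_space"
  assumes "v \<in> closure X" "C \<ge> 0" "\<And>x. x \<in> X \<Longrightarrow> cmod (cinner v x) \<le> C * norm x"
  shows "norm v \<le> C"
proof (cases "v = 0")
  case True
  then show ?thesis using assms by simp
next
  case False
  obtain s where s: "\<And>n. s n \<in> X" "s \<longlonglongrightarrow> v" using assms(1) unfolding closure_sequential by blast
  have 1: "(\<lambda>n. cmod (cinner v (s n))) \<longlonglongrightarrow> cmod (cinner v v)"
    by (intro tendsto_norm cinner.tendsto s tendsto_const)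
  have 2: "(\<lambda>n. C * norm (s n)) \<longlonglongrightarrow> C * norm v" by (intro tendsto_intros s)
  have "cmod (cinner v v) \<le> C * norm v"
    by (rule LIMSEQ_le[OF 1 2]) (use assms(3) s(1) in blast)
  moreover have "cmod (cinner v v) = norm v * norm v"
    unfolding cinner_self by (simp add: power2_eq_square norm_mult)
  ultimately show ?thesis using False by simp
qed


text \<open>\<open>X\<close> is a mere vector space and \<open>a\<close> need not be injective, so
  \<open>X\<close> carries only the seminorm pulled back along \<open>a\<close>. The completion of
  the quotient is the closure of the image of \<open>a\<close>, and no new type has to be built for
  it.\<close>

lemma riesz_closure:
  fixes X :: "'x::complex_vector set" and a :: "'x \<Rightarrow> 'a::chilbert_space"
  assumes X: "complex_vector.subspace X" and a: "linear_map_on X a" and f: "functional_on X f"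
    and bd: "\<And>x. x \<in> X \<Longrightarrow> cmod (f x) \<le> C * norm (a x)"
  obtains v where "v \<in> closure (a ` X)" "\<And>x. x \<in> X \<Longrightarrow> cinner v (a x) = f x"
proof -
  \<comment> \<open>For the vector \<open>v\<close> sought, \<open>F x\<close> equals ||a x - v||^2
    - ||v||^2, so the images under \<open>a\<close> of a minimizing sequence for \<open>F\<close>
    converge to \<open>v\<close>.\<close>
  define F where "F x = (norm (a x))\<^sup>2 - 2 * Re (f x)" for x
  have low: "- C\<^sup>2 \<le> F x" if "x \<in> X" for x
  proof -
    have "Re (f x) \<le> C * norm (a x)" using bd[OF that] complex_Re_le_cmod[of "f x"] by linarith
    moreover have "0 \<le> (norm (a x) - C)\<^sup>2" by simp
    ultimately show ?thesis unfolding F_def power2_diff by (simp add: mult.commute)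
  qed
  have bb: "bdd_below (F ` X)" using low by (intro bdd_belowI2[of _ "- C\<^sup>2"]) auto
  define I where "I = Inf (F ` X)"
  have IF: "I \<le> F x" if "x \<in> X" for x unfolding I_def by (rule cInf_lower) (use that bb in auto)
  have ne: "F ` X \<noteq> {}" using complex_vector.subspace_0[OF X] by blast
  have "\<exists>x\<in>X. F x < I + inverse (real (Suc n))" for n
    using cInf_lessD[OF ne, of "I + inverse (real (Suc n))"] unfolding I_def by auto
  then obtain s where s: "\<And>n. s n \<in> X" "\<And>n. F (s n) < I + inverse (real (Suc n))" by metis
  have add: "a (x + y) = a x + a y" "f (x + y) = f x + f y" "x + y \<in> X" if "x \<in> X" "y \<in> X" for x y
    using that a f complex_vector.subspace_add[OF X] unfolding linear_map_on_def functional_on_def by auto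
  have sc: "a (c *\<^sub>C x) = c *\<^sub>C a x" "f (c *\<^sub>C x) = c * f x" "c *\<^sub>C x \<in> X" if "x \<in> X" for c x
    using that a f complex_vector.subspace_scale[OF X] unfolding linear_map_on_def functional_on_def by auto
  \<comment> \<open>The midpoint of \<open>x\<close> and \<open>y\<close> has value at least
    \<open>I\<close>; the parallelogram law turns this into a bound for the distance.\<close>
  have par: "(norm (a x - a y))\<^sup>2 \<le> 2 * F x + 2 * F y - 4 * I" if x: "x \<in> X" and y: "y \<in> X" for x y
  proof -
    have "I \<le> F ((1/2) *\<^sub>C (x + y))" by (intro IF sc add x y)
    also have "\<dots> = (norm (a x + a y))\<^sup>2 / 4 - Re (f x) - Re (f y)"
      unfolding F_def by (simp add: sc add x y norm_scaleC power_mult_distrib power_divide add_divide_distrib)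
    finally have "I \<le> (norm (a x + a y))\<^sup>2 / 4 - Re (f x) - Re (f y)" .
    moreover have "A - 2 * R + D \<le> 2 * (A - 2 * p) + 2 * (D - 2 * q) - 4 * i"
      if "i \<le> (A + 2 * R + D) / 4 - p - q" for A R D p q i :: real using that by argo
    ultimately show ?thesis unfolding F_def norm_sq_diff norm_sq_add by blast
  qed
  have "Cauchy (\<lambda>n. a (s n))"
  proof (rule metric_CauchyI)
    fix e :: real assume e: "0 < e"
    obtain M where M: "inverse (real (Suc M)) < e\<^sup>2 / 4"
      using reals_Archimedean[of "e\<^sup>2/4"] e by auto
    have "dist (a (s m)) (a (s n)) < e" if "m \<ge> M" "n \<ge> M" for m n
    proof -
      have *: "inverse (real (Suc k)) \<le> inverse (real (Suc M))" if "k \<ge> M" for k using that by simp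
      have "(norm (a (s m) - a (s n)))\<^sup>2 < e\<^sup>2"
        using par[OF s(1)[of m] s(1)[of n]] s(2)[of m] s(2)[of n] *[OF that(1)] *[OF that(2)] M by linarith
      then show ?thesis unfolding dist_norm using e by (meson less_imp_le power_less_imp_less_base)
    qed
    then show "\<exists>M. \<forall>m\<ge>M. \<forall>n\<ge>M. dist (a (s m)) (a (s n)) < e" by blast
  qed
  then obtain v where v: "(\<lambda>n. a (s n)) \<longlonglongrightarrow> v" using Cauchy_convergent convergent_def by metis
  have vc: "v \<in> closure (a ` X)"
    unfolding closure_sequential using s(1) v by (intro exI[of _ "\<lambda>n. a (s n)"]) auto
  have "cinner v (a x) = f x" if x: "x \<in> X" for x
  proof -
    define d where "d n = cinner (a (s n)) (a x) - f x" for n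
    define K where "K = 1 + (norm (a x))\<^sup>2"
    have K: "K > 0" "(norm (a x))\<^sup>2 \<le> K" unfolding K_def by (auto simp: add_pos_nonneg)
    have b: "(cmod (d n))\<^sup>2 \<le> K * inverse (real (Suc n))" for n
    proof -
      \<comment> \<open>Moving from \<open>s n\<close> by \<open>t\<close> in the direction
        \<open>x\<close> lowers \<open>F\<close> by at least |d n|^2 / K, while
        \<open>F (s n)\<close> is within 1 / (n + 1) of the infimum. The summand 1 in
        \<open>K\<close> keeps it positive when \<open>a x = 0\<close>.\<close>
      define t where "t = - (complex_of_real (1/K) * cnj (d n))"
      have td: "Re (t * d n) = - ((cmod (d n))\<^sup>2 / K)"
      proof -
        have "t * d n = - complex_of_real (1/K) * (d n * cnj (d n))" by (simp add: t_def)
        also have "\<dots> = complex_of_real (- ((cmod (d n))\<^sup>2 / K))"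
          unfolding complex_norm_square[symmetric] by simp
        finally show ?thesis by (metis Re_complex_of_real)
      qed
      have tn: "(cmod t)\<^sup>2 = (cmod (d n))\<^sup>2 / K\<^sup>2"
        using K by (simp add: t_def norm_mult norm_divide power_divide)
      have "I \<le> F (s n + t *\<^sub>C x)" by (intro IF sc add s x)
      also have "\<dots> = F (s n) + (cmod t)\<^sup>2 * (norm (a x))\<^sup>2 + 2 * Re (t * d n)"
        unfolding F_def d_def
        by (simp add: sc add s x norm_sq_add norm_scaleC power_mult_distrib cinner_scaleC_right algebra_simps)
      also have "\<dots> \<le> F (s n) + (cmod (d n))\<^sup>2 / K\<^sup>2 * K - 2 * ((cmod (d n))\<^sup>2 / K)"
        unfolding td tn using mult_left_mono[OF K(2), of "(cmod (d n))\<^sup>2 / K\<^sup>2"] by simp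
      also have "\<dots> = F (s n) - (cmod (d n))\<^sup>2 / K" using K by (simp add: power2_eq_square)
      finally have "(cmod (d n))\<^sup>2 / K \<le> inverse (real (Suc n))" using s(2)[of n] by linarith
      then show ?thesis using K by (simp add: pos_divide_le_eq mult.commute)
    qed
    have "(\<lambda>n. K * inverse (real (Suc n))) \<longlonglongrightarrow> 0"
      using tendsto_mult[OF tendsto_const LIMSEQ_inverse_real_of_nat, of K] by simp
    then have "(\<lambda>n. (cmod (d n))\<^sup>2) \<longlonglongrightarrow> 0"
      by (rule tendsto_sandwich[OF always_eventually always_eventually tendsto_const, rotated 2]) (use b in auto)
    then have "(\<lambda>n. sqrt ((cmod (d n))\<^sup>2)) \<longlonglongrightarrow> sqrt 0" by (rule tendsto_real_sqrt)
    then have "d \<longlonglongrightarrow> 0" by (simp add: tendsto_norm_zero_iff)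
    moreover have "d \<longlonglongrightarrow> cinner v (a x) - f x"
      unfolding d_def by (intro tendsto_diff cinner.tendsto v tendsto_const)
    ultimately have "cinner v (a x) - f x = 0" using LIMSEQ_unique by blast
    then show ?thesis by simp
  qed
  with vc show ?thesis using that by blast
qed

lemma closure_image_unique:
  fixes X :: "'x::complex_vector set" and a :: "'x \<Rightarrow> 'a::chilbert_space"
  assumes "complex_vector.subspace X" "linear_map_on X a" "u \<in> closure (a ` X)" "v \<in> closure (a ` X)"
    and "\<And>x. x \<in> X \<Longrightarrow> cinner u (a x) = cinner v (a x)"
  shows "u = v"
proof (rule eq_if_cinner_closure)
  show "u - v \<in> closure (a ` X)"
    by (intro complex_vector.subspace_diff subspace_closure subspace_image assms)
  show "cinner y u = cinner y v" if "y \<in> a ` X" for y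
    using that assms(5) by (metis cinner_commute imageE)
qed

lemma bounded_clinearI:
  fixes f :: "'a::chilbert_space \<Rightarrow> 'a"
  assumes "\<And>x y. f (x + y) = f x + f y" "\<And>c x. f (c *\<^sub>C x) = c *\<^sub>C f x" "\<And>x. norm (f x) \<le> K * norm x"
  shows "bounded_clinear f"
  unfolding bounded_clinear_def
proof (intro conjI allI)
  show "bounded_linear f"
    by (rule bounded_linear_intro[of _ K]) (simp_all add: assms scaleR_scaleC mult.commute)
qed (rule assms)

lemma bop_exists:
  fixes f :: "'a::chilbert_space \<Rightarrow> 'a"
  assumes "\<And>x y. f (x + y) = f x + f y" "\<And>c x. f (c *\<^sub>C x) = c *\<^sub>C f x" "\<And>x. norm (f x) \<le> K * norm x"
  obtains T where "\<And>x. bapp T x = f x"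
proof -
  have "bounded_clinear f" by (rule bounded_clinearI[OF assms])
  then have "bapp (Bop f) = f" by (simp add: Bop_inverse)
  then show ?thesis using that by metis
qed

text \<open>Riesz is used twice: \<open>g y\<close> represents the functional \<open>B y\<close>,
  and \<open>T\<close> is the adjoint of the bounded map a y \<mapsto> g y. That \<open>T\<close>
  maps into the closure and kills the orthogonal complement makes it the unique such operator, which
  later lets operators be compared through their forms.\<close>

lemma bounded_form_bop:
  fixes X :: "'x::complex_vector set" and a :: "'x \<Rightarrow> 'a::chilbert_space"
  assumes X: "complex_vector.subspace X" and a: "linear_map_on X a"
    and B1: "\<And>y. y \<in> X \<Longrightarrow> functional_on X (B y)"
    and B2: "\<And>x. x \<in> X \<Longrightarrow> functional_on X (\<lambda>y. cnj (B y x))"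
    and C: "C \<ge> 0" and bd: "\<And>x y. x \<in> X \<Longrightarrow> y \<in> X \<Longrightarrow> cmod (B y x) \<le> C * norm (a y) * norm (a x)"
  obtains T where "\<And>x y. x \<in> X \<Longrightarrow> y \<in> X \<Longrightarrow> cinner (a y) (bapp T (a x)) = B y x"
    "\<And>v. bapp T v \<in> closure (a ` X)" "\<And>v. (\<And>x. x \<in> X \<Longrightarrow> cinner (a x) v = 0) \<Longrightarrow> bapp T v = 0"
    "\<And>v. norm (bapp T v) \<le> C * norm v"
proof -
  have "\<exists>g\<in>closure (a ` X). \<forall>x\<in>X. cinner g (a x) = B y x" if y: "y \<in> X" for y
    by (rule riesz_closure[OF X a B1[OF y], of "C * norm (a y)"]) (use bd y in auto)
  then obtain g where g: "\<And>y. y \<in> X \<Longrightarrow> g y \<in> closure (a ` X)" "\<And>x y. x \<in> X \<Longrightarrow> y \<in> X \<Longrightarrow> cinner (g y) (a x) = B y x"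
    by metis
  note sc = subspace_closure[OF subspace_image[OF X a]]
  have gn: "norm (g y) \<le> C * norm (a y)" if y: "y \<in> X" for y
    by (rule cinner_bound_closure[OF g(1)[OF y]]) (use C g(2) bd y in auto)
  have gadd: "g (y + z) = g y + g z" if y: "y \<in> X" and z: "z \<in> X" for y z
  proof (rule closure_image_unique[OF X a])
    have yz: "y + z \<in> X" by (intro complex_vector.subspace_add X y z)
    show "g (y + z) \<in> closure (a ` X)" "g y + g z \<in> closure (a ` X)"
      by (intro g yz complex_vector.subspace_add[OF sc] y z)+
    fix x assume x: "x \<in> X"
    have "cnj (B (y + z) x) = cnj (B y x) + cnj (B z x)"
      using B2[OF x] y z unfolding functional_on_def by blast
    then have "B (y + z) x = B y x + B z x" by (metis complex_cnj_add complex_cnj_cancel_iff)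
    then show "cinner (g (y + z)) (a x) = cinner (g y + g z) (a x)"
      by (simp add: g x y z yz cinner_add_left)
  qed
  have gsc: "g (c *\<^sub>C y) = c *\<^sub>C g y" if y: "y \<in> X" for c y
  proof (rule closure_image_unique[OF X a])
    have cy: "c *\<^sub>C y \<in> X" by (intro complex_vector.subspace_scale X y)
    show "g (c *\<^sub>C y) \<in> closure (a ` X)" "c *\<^sub>C g y \<in> closure (a ` X)"
      by (intro g cy complex_vector.subspace_scale[OF sc] y)+
    fix x assume x: "x \<in> X"
    have "cnj (B (c *\<^sub>C y) x) = c * cnj (B y x)"
      using B2[OF x] y unfolding functional_on_def by blast
    then have "B (c *\<^sub>C y) x = cnj c * B y x" by (metis complex_cnj_cnj complex_cnj_mult)
    then show "cinner (g (c *\<^sub>C y)) (a x) = cinner (c *\<^sub>C g y) (a x)"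
      by (simp add: g x y cy cinner_scaleC_left)
  qed
  have "\<exists>w\<in>closure (a ` X). \<forall>y\<in>X. cinner w (a y) = cinner v (g y)" for v
  proof (rule riesz_closure[OF X a, of "\<lambda>y. cinner v (g y)" "norm v * C"])
    show "functional_on X (\<lambda>y. cinner v (g y))"
      unfolding functional_on_def by (simp add: gadd gsc cinner_add_right cinner_scaleC_right)
    show "cmod (cinner v (g y)) \<le> norm v * C * norm (a y)" if "y \<in> X" for y
    proof -
      have "cmod (cinner v (g y)) \<le> norm v * norm (g y)" by (rule cmod_cinner_le)
      also have "\<dots> \<le> norm v * (C * norm (a y))" by (intro mult_left_mono gn that) simp
      finally show ?thesis by (simp add: mult.assoc)
    qed
  qed auto
  then obtain t where t: "\<And>v. t v \<in> closure (a ` X)" "\<And>v y. y \<in> X \<Longrightarrow> cinner (t v) (a y) = cinner v (g y)"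
    by metis
  have tn: "norm (t v) \<le> C * norm v" for v
  proof (rule cinner_bound_closure[OF t(1)])
    fix x assume "x \<in> a ` X"
    then obtain y where y: "y \<in> X" "x = a y" by blast
    have "cmod (cinner (t v) x) = cmod (cinner v (g y))" using y t(2) by simp
    also have "\<dots> \<le> norm v * norm (g y)" by (rule cmod_cinner_le)
    also have "\<dots> \<le> norm v * (C * norm (a y))" by (intro mult_left_mono gn y) simp
    finally show "cmod (cinner (t v) x) \<le> C * norm v * norm x" using y by (simp add: mult_ac)
  qed (use C in simp)
  obtain T where T: "\<And>v. bapp T v = t v"
  proof (rule bop_exists[of t C])
    show "t (x + y) = t x + t y" for x y
      by (rule closure_image_unique[OF X a])
        (simp_all add: t complex_vector.subspace_add[OF sc] cinner_add_left)
    show "t (c *\<^sub>C x) = c *\<^sub>C t x" for c x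
      by (rule closure_image_unique[OF X a])
        (simp_all add: t complex_vector.subspace_scale[OF sc] cinner_scaleC_left)
  qed (use tn in auto)
  show ?thesis
  proof (rule that[of T])
    show "cinner (a y) (bapp T (a x)) = B y x" if "x \<in> X" "y \<in> X" for x y
      by (subst cinner_commute) (simp add: T t that g cinner_commute[of "a x"])
    show "bapp T v \<in> closure (a ` X)" "norm (bapp T v) \<le> C * norm v" for v
      by (simp_all add: T t tn)
    show "bapp T v = 0" if v: "\<And>x. x \<in> X \<Longrightarrow> cinner (a x) v = 0" for v
    proof (unfold T, rule closure_image_unique[OF X a t(1)])
      show "0 \<in> closure (a ` X)" by (rule complex_vector.subspace_0[OF sc])
      fix x assume x: "x \<in> X"
      have "cinner (g x) v = cinner (g x) 0"
        by (rule cinner_ext_closure[OF _ g(1)[OF x]]) (use v in \<open>auto simp: cinner.zero_right\<close>)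
      then have "cinner v (g x) = 0" by (metis cinner.zero_right cinner_commute complex_cnj_zero)
      then show "cinner (t v) (a x) = cinner 0 (a x)" by (simp add: t x)
    qed
  qed
qed

section \<open>Bounded operators\<close>

lemma bop_eqI: "(\<And>x. bapp S x = bapp T x) \<Longrightarrow> S = T"
  by (metis bapp_inject ext)

lemma bapp_simps [simp]:
  "bapp 0 x = 0" "bapp 1 x = x" "bapp (S + T) x = bapp S x + bapp T x"
  "bapp (S - T) x = bapp S x - bapp T x" "bapp (- S) x = - bapp S x"
  "bapp (S * T) x = bapp S (bapp T x)" "bapp (c *\<^sub>C T) x = c *\<^sub>C bapp T x"
  by (simp_all add: zero_bop.rep_eq one_bop.rep_eq plus_bop.rep_eq minus_bop.rep_eq
      uminus_bop.rep_eq times_bop.rep_eq scaleC_bop.rep_eq)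

lemma bapp_bounded_clinear: "bounded_clinear (bapp T)"
  using bapp[of T] by simp

lemma bapp_bounded_linear: "bounded_linear (bapp T)"
  using bapp_bounded_clinear unfolding bounded_clinear_def by blast

lemma bapp_scaleC: "bapp T (c *\<^sub>C x) = c *\<^sub>C bapp T x"
  using bapp_bounded_clinear[of T] unfolding bounded_clinear_def by blast

lemma bapp_add: "bapp T (x + y) = bapp T x + bapp T y"
  using bapp_bounded_linear linear_add bounded_linear.linear by blast

lemma bapp_diff: "bapp T (x - y) = bapp T x - bapp T y"
  using bapp_bounded_linear linear_diff bounded_linear.linear by blast

lemma bapp_zero [simp]: "bapp T 0 = 0"
  using bapp_diff[of T 0 0] by simp

lemma tendsto_bapp: "(f \<longlongrightarrow> l) F \<Longrightarrow> ((\<lambda>x. bapp T (f x)) \<longlongrightarrow> bapp T l) F"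
  by (rule bounded_linear.tendsto[OF bapp_bounded_linear])

lemma bapp_bound: obtains K where "K > 0" "\<And>x. norm (bapp T x) \<le> K * norm x"
  using bounded_linear.pos_bounded[OF bapp_bounded_linear, of T] by (metis mult.commute)

lemma bop_eqI_closure:
  assumes "\<And>x. x \<in> X \<Longrightarrow> bapp S x = bapp T x" "v \<in> closure X"
  shows "bapp S v = bapp T v"
proof -
  obtain s where s: "\<And>n. s n \<in> X" "s \<longlonglongrightarrow> v" using assms(2) unfolding closure_sequential by blast
  have "(\<lambda>n. bapp S (s n)) \<longlonglongrightarrow> bapp S v" "(\<lambda>n. bapp T (s n)) \<longlonglongrightarrow> bapp T v"
    by (intro tendsto_bapp s)+
  then show ?thesis using assms(1) s(1) LIMSEQ_unique by auto
qed

lemma linear_map_on_bapp_vec: "linear_map_on X (\<lambda>T. bapp T v)"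
  unfolding linear_map_on_def by simp

section \<open>Adjoints and orthogonal projections\<close>

lemma cinner_eqI: "(\<And>y. cinner y u = cinner y v) \<Longrightarrow> u = v"
  by (rule eq_if_cinner_closure[of UNIV]) auto

lemma adj_exists: "\<exists>!S. \<forall>x y. cinner (bapp S x) y = cinner x (bapp T y)"
proof -
  obtain K where K: "K > 0" "\<And>x. norm (bapp T x) \<le> K * norm x" using bapp_bound by blast
  obtain S where S: "\<And>x y. cinner y (bapp S x) = cinner (bapp T y) x"
  proof (rule bounded_form_bop[of UNIV "\<lambda>x. x" "\<lambda>y x. cinner (bapp T y) x" K])
    show "functional_on UNIV (cinner (bapp T y))" for y
      unfolding functional_on_def by (simp add: cinner_add_right cinner_scaleC_right)
    show "functional_on UNIV (\<lambda>y. cnj (cinner (bapp T y) x))" for x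
      unfolding functional_on_def
      by (simp add: cinner_add_left cinner_scaleC_left bapp_add bapp_scaleC)
    show "cmod (cinner (bapp T y) x) \<le> K * norm y * norm x" for x y
      using cmod_cinner_le[of "bapp T y" x] mult_right_mono[OF K(2)[of y], of "norm x"] by simp
  qed (use K in \<open>auto simp: linear_map_on_def\<close>)
  have "\<forall>x y. cinner (bapp S x) y = cinner x (bapp T y)"
    by (metis S cinner_commute)
  moreover have "S' = S" if "\<forall>x y. cinner (bapp S' x) y = cinner x (bapp T y)" for S'
  proof (rule bop_eqI, rule cinner_eqI)
    show "cinner y (bapp S' x) = cinner y (bapp S x)" for x y
      by (metis S that cinner_commute)
  qed
  ultimately show ?thesis by blast
qed

lemma cinner_adj_left: "cinner (bapp (adj T) x) y = cinner x (bapp T y)"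
  using theI'[OF adj_exists[of T]] unfolding adj_def by blast

lemma cinner_adj_right: "cinner x (bapp (adj T) y) = cinner (bapp T x) y"
  by (metis cinner_adj_left cinner_commute)

lemma adjI: "(\<And>x y. cinner (bapp S x) y = cinner x (bapp T y)) \<Longrightarrow> adj T = S"
  using adj_exists[of T] cinner_adj_left by blast

lemma adj_simps [simp]:
  "adj (adj T) = T" "adj (S * T) = adj T * adj S" "adj (S + T) = adj S + adj T"
  "adj (S - T) = adj S - adj T" "adj (c *\<^sub>C T) = cnj c *\<^sub>C adj T" "adj 1 = 1" "adj 0 = 0"
  by (rule adjI; simp add: cinner_adj_left cinner_adj_right cinner.add_left cinner.add_right
      cinner.diff_left cinner.diff_right cinner_scaleC_left cinner_scaleC_right cinner.zero_left cinner.zero_right)+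

text \<open>The operator of the inner product restricted to \<open>L\<close>, extended by zero on
  the orthogonal complement, is the projection. Riesz applied to \<open>cinner x\<close> supplies
  the component \<open>v\<close> of \<open>x\<close> in \<open>L\<close>.\<close>

lemma projection_exists:
  fixes L :: "'a::chilbert_space set"
  assumes L: "complex_vector.subspace L" "closed L"
  obtains p where "projection_onto L p"
proof -
  have id: "linear_map_on L (\<lambda>x. x)" unfolding linear_map_on_def by simp
  obtain T where T: "\<And>x y. x \<in> L \<Longrightarrow> y \<in> L \<Longrightarrow> cinner y (bapp T x) = cinner y x"
    "\<And>v. bapp T v \<in> closure ((\<lambda>x. x) ` L)" "\<And>v. (\<And>x. x \<in> L \<Longrightarrow> cinner x v = 0) \<Longrightarrow> bapp T v = 0"
  proof (rule bounded_form_bop[OF L(1) id, of "\<lambda>y x. cinner y x" 1])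
    show "functional_on L (cinner y)" for y
      unfolding functional_on_def by (simp add: cinner_add_right cinner_scaleC_right)
    show "functional_on L (\<lambda>y. cnj (cinner y x))" for x
      unfolding functional_on_def
      by (simp add: cinner_add_left cinner_scaleC_left)
  qed (use cmod_cinner_le in auto)
  have "cinner y (x - bapp T x) = 0" if y: "y \<in> L" for x y
  proof -
    obtain v where v: "v \<in> closure ((\<lambda>x. x) ` L)" "\<And>y. y \<in> L \<Longrightarrow> cinner v y = cinner x y"
      by (rule riesz_closure[OF L(1) id, of "cinner x" "norm x"])
        (auto simp: functional_on_def cinner_add_right cinner_scaleC_right cmod_cinner_le)
    have v': "v \<in> L" using v(1) L(2) by simp
    have "bapp T (x - v) = 0"
      by (rule T(3)) (metis v(2) cinner_commute cinner_diff_right diff_self)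
    then have "bapp T x = bapp T v" by (simp add: bapp_diff)
    then have "cinner y (bapp T x) = cinner y v" using T(1)[OF v' y] by simp
    also have "\<dots> = cinner y x" using v(2)[OF y] by (metis cinner_commute)
    finally show ?thesis by (simp add: cinner_diff_right)
  qed
  then have "projection_onto L T"
    unfolding projection_onto_def using T(2) L(2) by simp
  then show ?thesis using that by blast
qed

lemma projection_onto_fixes: "projection_onto L p \<Longrightarrow> complex_vector.subspace L \<Longrightarrow> v \<in> L \<Longrightarrow> bapp p v = v"
proof -
  assume a: "projection_onto L p" "complex_vector.subspace L" "v \<in> L"
  have m: "v - bapp p v \<in> L"
    using a unfolding projection_onto_def by (intro complex_vector.subspace_diff) auto
  then have "cinner (v - bapp p v) (v - bapp p v) = 0" using a unfolding projection_onto_def by blast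
  then show ?thesis by (simp add: cinner_self_eq_0)
qed

lemma projection_onto_idem:
  assumes "projection_onto L p" "complex_vector.subspace L" shows "p * p = p"
proof (rule bop_eqI)
  show "bapp (p * p) x = bapp p x" for x
    using projection_onto_fixes[OF assms, of "bapp p x"] assms(1) by (simp add: projection_onto_def)
qed

lemma projection_onto_adj:
  assumes p: "projection_onto L p" and L: "complex_vector.subspace L" shows "adj p = p"
proof (rule adjI)
  fix x y
  have 1: "cinner (bapp p x) (y - bapp p y) = 0" "cinner (bapp p y) (x - bapp p x) = 0"
    using p unfolding projection_onto_def by blast+
  have "cinner (bapp p x) y = cinner (bapp p x) (bapp p y)" using 1(1) by (simp add: cinner_diff_right)
  also have "\<dots> = cinner x (bapp p y)" using 1(2)
    by (metis cinner_commute cinner_diff_right right_minus_eq)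
  finally show "cinner (bapp p x) y = cinner x (bapp p y)" .
qed

lemma projection_onto_kernel:
  assumes p: "projection_onto L p" and L: "complex_vector.subspace L"
    and v: "\<And>x. x \<in> L \<Longrightarrow> cinner x v = 0"
  shows "bapp p v = 0"
proof -
  have "bapp p v \<in> L" "cinner (bapp p v) (v - bapp p v) = 0" using p unfolding projection_onto_def by blast+
  then show ?thesis using v by (simp add: cinner_diff_right cinner_self_eq_0)
qed

lemma projection_onto_commute:
  assumes p: "projection_onto L p" and L: "complex_vector.subspace L"
    and S: "\<And>v. v \<in> L \<Longrightarrow> bapp S v \<in> L" "\<And>v. v \<in> L \<Longrightarrow> bapp (adj S) v \<in> L"
  shows "p * S = S * p"
proof (rule bop_eqI)
  fix x
  have "bapp p (bapp S (x - bapp p x)) = 0"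
  proof (rule projection_onto_kernel[OF p L])
    fix y assume "y \<in> L"
    then have "cinner (bapp (adj S) y) (x - bapp p x) = 0"
      using S(2) p unfolding projection_onto_def by blast
    then show "cinner y (bapp S (x - bapp p x)) = 0" by (simp add: cinner_adj_left)
  qed
  moreover have "bapp p (bapp S (bapp p x)) = bapp S (bapp p x)"
    by (intro projection_onto_fixes[OF p L] S) (use p in \<open>auto simp: projection_onto_def\<close>)
  ultimately show "bapp (p * S) x = bapp (S * p) x" by (simp add: bapp_diff)
qed

section \<open>Square-summable sequences of vectors\<close>

text \<open>A normal functional is a series of vector functionals. On square-summable sequences it
  becomes a single vector functional of the ampliated operators, so that a trace can be handled
  through one vector.\<close>

typedef (overloaded) 'a l2 = "{f :: nat \<Rightarrow> 'a::chilbert_space. summable (\<lambda>n. (norm (f n))\<^sup>2)}"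
  morphisms l2_nth Abs_l2
  by (rule exI[of _ "\<lambda>n. 0"]) simp

setup_lifting type_definition_l2

lemma l2_summable_norm_mult:
  fixes f g :: "nat \<Rightarrow> 'a::chilbert_space"
  assumes "summable (\<lambda>n. (norm (f n))\<^sup>2)" "summable (\<lambda>n. (norm (g n))\<^sup>2)"
  shows "summable (\<lambda>n. norm (f n) * norm (g n))"
proof (rule summable_comparison_test')
  show "summable (\<lambda>n. (norm (f n))\<^sup>2 + (norm (g n))\<^sup>2)" by (intro summable_add assms)
  show "norm (norm (f n) * norm (g n)) \<le> (norm (f n))\<^sup>2 + (norm (g n))\<^sup>2" if "n \<ge> 0" for n
  proof -
    have "0 \<le> norm (f n) * norm (g n)" "norm (norm (f n) * norm (g n)) = norm (f n) * norm (g n)"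
      by (simp_all add: abs_mult)
    then show ?thesis
      using sum_squares_bound[of "norm (f n)" "norm (g n)"] unfolding mult.assoc by linarith
  qed
qed

lemma l2_summable_add:
  fixes f g :: "nat \<Rightarrow> 'a::chilbert_space"
  assumes "summable (\<lambda>n. (norm (f n))\<^sup>2)" "summable (\<lambda>n. (norm (g n))\<^sup>2)"
  shows "summable (\<lambda>n. (norm (f n + g n))\<^sup>2)"
proof (rule summable_comparison_test')
  show "summable (\<lambda>n. 2 * (norm (f n))\<^sup>2 + 2 * (norm (g n))\<^sup>2)"
    by (intro summable_add summable_mult assms)
  show "norm ((norm (f n + g n))\<^sup>2) \<le> 2 * (norm (f n))\<^sup>2 + 2 * (norm (g n))\<^sup>2" if "n \<ge> 0" for n
  proof -
    have "norm ((norm (f n + g n))\<^sup>2) = (norm (f n + g n))\<^sup>2" by simp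
    then show ?thesis
      using norm_sq_add[of "f n" "g n"] norm_sq_diff[of "f n" "g n"] zero_le_power2[of "norm (f n - g n)"]
      by linarith
  qed
qed

lemma l2_summable_scaleC:
  fixes f :: "nat \<Rightarrow> 'a::chilbert_space"
  assumes "summable (\<lambda>n. (norm (f n))\<^sup>2)"
  shows "summable (\<lambda>n. (norm (c *\<^sub>C f n))\<^sup>2)"
  using summable_mult[OF assms, of "(cmod c)\<^sup>2"] by (simp add: norm_scaleC power_mult_distrib)

lemma l2_summable_bapp:
  assumes "summable (\<lambda>n. (norm (f n))\<^sup>2)"
  shows "summable (\<lambda>n. (norm (bapp T (f n)))\<^sup>2)"
proof -
  obtain K where K: "K > 0" "\<And>x. norm (bapp T x) \<le> K * norm x" using bapp_bound by blast
  show ?thesis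
  proof (rule summable_comparison_test')
    show "summable (\<lambda>n. K\<^sup>2 * (norm (f n))\<^sup>2)" by (intro summable_mult assms)
    show "norm ((norm (bapp T (f n)))\<^sup>2) \<le> K\<^sup>2 * (norm (f n))\<^sup>2" if "n \<ge> 0" for n
      using power_mono[OF K(2)[of "f n"], of 2] by (simp add: power_mult_distrib)
  qed
qed

instantiation l2 :: (chilbert_space) real_normed_vector
begin

lift_definition zero_l2 :: "'a l2" is "\<lambda>n. 0" by simp
lift_definition plus_l2 :: "'a l2 \<Rightarrow> 'a l2 \<Rightarrow> 'a l2" is "\<lambda>f g n. f n + g n" by (rule l2_summable_add)
lift_definition uminus_l2 :: "'a l2 \<Rightarrow> 'a l2" is "\<lambda>f n. - f n" by simp
lift_definition minus_l2 :: "'a l2 \<Rightarrow> 'a l2 \<Rightarrow> 'a l2" is "\<lambda>f g n. f n - g n"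
proof -
  fix f g :: "nat \<Rightarrow> 'a"
  assume "summable (\<lambda>n. (norm (f n))\<^sup>2)" "summable (\<lambda>n. (norm (g n))\<^sup>2)"
  then show "summable (\<lambda>n. (norm (f n - g n))\<^sup>2)" using l2_summable_add[of f "\<lambda>n. - g n"] by simp
qed
lift_definition scaleR_l2 :: "real \<Rightarrow> 'a l2 \<Rightarrow> 'a l2" is "\<lambda>r f n. r *\<^sub>R f n"
  by (simp add: scaleR_scaleC l2_summable_scaleC)
lift_definition norm_l2 :: "'a l2 \<Rightarrow> real" is "\<lambda>f. sqrt (\<Sum>n. (norm (f n))\<^sup>2)" .
definition sgn_l2 :: "'a l2 \<Rightarrow> 'a l2" where "sgn_l2 x = inverse (norm x) *\<^sub>R x"
definition dist_l2 :: "'a l2 \<Rightarrow> 'a l2 \<Rightarrow> real" where "dist_l2 x y = norm (x - y)"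
definition uniformity_l2 :: "('a l2 \<times> 'a l2) filter" where
  "uniformity_l2 = (INF e\<in>{0 <..}. principal {(x, y). dist x y < e})"
definition open_l2 :: "'a l2 set \<Rightarrow> bool" where
  "open_l2 U \<longleftrightarrow> (\<forall>x\<in>U. \<forall>\<^sub>F (x', y) in uniformity. x' = x \<longrightarrow> y \<in> U)"

instance
proof
  fix x y z :: "'a l2" and r s :: real
  show "x + y + z = x + (y + z)" by transfer (simp add: add.assoc)
  show "x + y = y + x" by transfer (simp add: add.commute)
  show "0 + x = x" "- x + x = 0" "x - y = x + - y" by (transfer; simp)+
  show "r *\<^sub>R (x + y) = r *\<^sub>R x + r *\<^sub>R y" by transfer (simp add: scaleR_add_right)
  show "(r + s) *\<^sub>R x = r *\<^sub>R x + s *\<^sub>R x" by transfer (simp add: scaleR_add_left)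
  show "r *\<^sub>R s *\<^sub>R x = (r * s) *\<^sub>R x" "1 *\<^sub>R x = x" by (transfer; simp)+
  show "dist x y = norm (x - y)" by (rule dist_l2_def)
  show "sgn x = inverse (norm x) *\<^sub>R x" by (rule sgn_l2_def)
  show "uniformity = (INF e\<in>{0<..}. principal {(x :: 'a l2, y). dist x y < e})" by (rule uniformity_l2_def)
  show "open U \<longleftrightarrow> (\<forall>x\<in>U. \<forall>\<^sub>F (x', y) in uniformity. x' = x \<longrightarrow> y \<in> U)" for U :: "'a l2 set" by (rule open_l2_def)
  show "norm x = 0 \<longleftrightarrow> x = 0"
    by transfer (simp add: suminf_eq_zero_iff fun_eq_iff)
  show "norm (r *\<^sub>R x) = \<bar>r\<bar> * norm x"
    by transfer (simp add: power_mult_distrib suminf_mult real_sqrt_mult)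
  show "norm (x + y) \<le> norm x + norm y"
  proof transfer
    fix f g :: "nat \<Rightarrow> 'a"
    assume f: "summable (\<lambda>n. (norm (f n))\<^sup>2)" and g: "summable (\<lambda>n. (norm (g n))\<^sup>2)"
    note fg = l2_summable_add[OF f g]
    have 1: "(\<lambda>n. sqrt (\<Sum>i<n. (norm (f i + g i))\<^sup>2)) \<longlonglongrightarrow> sqrt (\<Sum>n. (norm (f n + g n))\<^sup>2)"
      by (intro tendsto_real_sqrt summable_LIMSEQ fg)
    have "sqrt (\<Sum>i<n. (norm (f i + g i))\<^sup>2) \<le> sqrt (\<Sum>n. (norm (f n))\<^sup>2) + sqrt (\<Sum>n. (norm (g n))\<^sup>2)" for n
    proof -
      have "sqrt (\<Sum>i<n. (norm (f i + g i))\<^sup>2) \<le> sqrt (\<Sum>i<n. (norm (f i) + norm (g i))\<^sup>2)"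
        by (intro real_sqrt_le_mono sum_mono power_mono norm_triangle_ineq) simp
      also have "\<dots> \<le> sqrt (\<Sum>i<n. (norm (f i))\<^sup>2) + sqrt (\<Sum>i<n. (norm (g i))\<^sup>2)"
        using L2_set_triangle_ineq[of "\<lambda>i. norm (f i)" "\<lambda>i. norm (g i)" "{..<n}"] by (simp add: L2_set_def)
      also have "\<dots> \<le> sqrt (\<Sum>n. (norm (f n))\<^sup>2) + sqrt (\<Sum>n. (norm (g n))\<^sup>2)"
        by (intro add_mono real_sqrt_le_mono sum_le_suminf f g) auto
      finally show ?thesis .
    qed
    then show "sqrt (\<Sum>n. (norm (f n + g n))\<^sup>2) \<le> sqrt (\<Sum>n. (norm (f n))\<^sup>2) + sqrt (\<Sum>n. (norm (g n))\<^sup>2)"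
      by (intro LIMSEQ_le_const2[OF 1]) auto
  qed
qed

end

lemma l2_nth_simps [simp]:
  "l2_nth 0 n = 0" "l2_nth (x + y) n = l2_nth x n + l2_nth y n"
  "l2_nth (x - y) n = l2_nth x n - l2_nth y n" "l2_nth (- x) n = - l2_nth x n"
  by (transfer; simp)+

lemma l2_eqI: "(\<And>n. l2_nth x n = l2_nth y n) \<Longrightarrow> x = y"
  by (metis l2_nth_inject ext)

lemma l2_nth_summable: "summable (\<lambda>n. (norm (l2_nth x n))\<^sup>2)"
  using l2_nth[of x] by simp

lemma l2_norm_sq: "(norm x)\<^sup>2 = (\<Sum>n. (norm (l2_nth x n))\<^sup>2)"
  by transfer (simp add: suminf_nonneg)

lemma l2_nth_norm_le: "norm (l2_nth x n) \<le> norm x"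
proof -
  have "(norm (l2_nth x n))\<^sup>2 = (\<Sum>i\<in>{n}. (norm (l2_nth x i))\<^sup>2)" by simp
  also have "\<dots> \<le> (norm x)\<^sup>2"
    unfolding l2_norm_sq by (intro sum_le_suminf l2_nth_summable) auto
  finally show ?thesis by (rule power2_le_imp_le) simp
qed

lemma l2_sum_norm_le: "(\<Sum>i<n. (norm (l2_nth x i))\<^sup>2) \<le> (norm x)\<^sup>2"
  unfolding l2_norm_sq by (intro sum_le_suminf l2_nth_summable) auto

lemma tendsto_l2_nth: "(f \<longlongrightarrow> l) F \<Longrightarrow> ((\<lambda>x. l2_nth (f x) n) \<longlongrightarrow> l2_nth l n) F"
proof (rule tendstoI)
  fix e :: real assume "(f \<longlongrightarrow> l) F" "0 < e"
  then have "\<forall>\<^sub>F x in F. dist (f x) l < e" by (rule tendstoD)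
  moreover have "dist (l2_nth y n) (l2_nth l n) \<le> dist y l" for y
    using l2_nth_norm_le[of "y - l" n] by (simp add: dist_norm)
  ultimately show "\<forall>\<^sub>F x in F. dist (l2_nth (f x) n) (l2_nth l n) < e"
    by (auto elim!: eventually_mono intro: order_le_less_trans)
qed

instance l2 :: (chilbert_space) banach
proof
  fix X :: "nat \<Rightarrow> 'a l2" assume X: "Cauchy X"
  have "Cauchy (\<lambda>m. l2_nth (X m) i)" for i
  proof (rule metric_CauchyI)
    fix e :: real assume "0 < e"
    then obtain M where "\<And>m k. m \<ge> M \<Longrightarrow> k \<ge> M \<Longrightarrow> dist (X m) (X k) < e" using X metric_CauchyD by blast
    moreover have "dist (l2_nth (X m) i) (l2_nth (X k) i) \<le> dist (X m) (X k)" for m k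
      using l2_nth_norm_le[of "X m - X k" i] by (simp add: dist_norm)
    ultimately show "\<exists>M. \<forall>m\<ge>M. \<forall>k\<ge>M. dist (l2_nth (X m) i) (l2_nth (X k) i) < e"
      by (meson order_le_less_trans)
  qed
  then have "\<exists>l. (\<lambda>m. l2_nth (X m) i) \<longlonglongrightarrow> l" for i using Cauchy_convergent convergent_def by blast
  then obtain f where f: "\<And>i. (\<lambda>m. l2_nth (X m) i) \<longlonglongrightarrow> f i" by metis
  have key: "\<exists>M. \<forall>m\<ge>M. \<forall>n. (\<Sum>i<n. (norm (l2_nth (X m) i - f i))\<^sup>2) \<le> e\<^sup>2" if e: "e > 0" for e :: real
  proof -
    obtain M where M: "\<And>m k. m \<ge> M \<Longrightarrow> k \<ge> M \<Longrightarrow> dist (X m) (X k) < e" using X e metric_CauchyD by blast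
    have "(\<Sum>i<n. (norm (l2_nth (X m) i - f i))\<^sup>2) \<le> e\<^sup>2" if m: "m \<ge> M" for m n
    proof (rule LIMSEQ_le_const2)
      show "(\<lambda>k. \<Sum>i<n. (norm (l2_nth (X m) i - l2_nth (X k) i))\<^sup>2) \<longlonglongrightarrow> (\<Sum>i<n. (norm (l2_nth (X m) i - f i))\<^sup>2)"
        by (intro tendsto_sum tendsto_power tendsto_norm tendsto_diff tendsto_const f)
      have "(\<Sum>i<n. (norm (l2_nth (X m) i - l2_nth (X k) i))\<^sup>2) \<le> e\<^sup>2" if "k \<ge> M" for k
        using l2_sum_norm_le[of "X m - X k" n] M[OF m that]
          power_mono[of "norm (X m - X k)" e 2] by (simp add: dist_norm)
      then show "\<exists>N. \<forall>k\<ge>N. (\<Sum>i<n. (norm (l2_nth (X m) i - l2_nth (X k) i))\<^sup>2) \<le> e\<^sup>2" by blast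
    qed
    then show ?thesis by blast
  qed
  obtain M where "\<forall>n. (\<Sum>i<n. (norm (l2_nth (X M) i - f i))\<^sup>2) \<le> 1\<^sup>2" using key[of 1] by auto
  then have "summable (\<lambda>i. (norm (l2_nth (X M) i - f i))\<^sup>2)"
    by (intro summableI_nonneg_bounded[of _ 1]) auto
  then have "summable (\<lambda>i. (norm (- (l2_nth (X M) i - f i) + l2_nth (X M) i))\<^sup>2)"
    by (intro l2_summable_add l2_nth_summable) (simp add: norm_minus_commute)
  then have sf: "summable (\<lambda>i. (norm (f i))\<^sup>2)" by simp
  define x where "x = Abs_l2 f"
  have x: "l2_nth x = f" unfolding x_def using sf by (simp add: Abs_l2_inverse)
  have "X \<longlonglongrightarrow> x"
  proof (rule metric_LIMSEQ_I)
    fix e :: real assume e: "0 < e"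
    obtain M where M: "\<forall>m\<ge>M. \<forall>n. (\<Sum>i<n. (norm (l2_nth (X m) i - f i))\<^sup>2) \<le> (e/2)\<^sup>2"
      using key[of "e/2"] e by auto
    have "dist (X m) x < e" if "m \<ge> M" for m
    proof -
      have "(norm (X m - x))\<^sup>2 \<le> (e/2)\<^sup>2"
        unfolding l2_norm_sq
        by (intro suminf_le_const l2_nth_summable) (use M that in \<open>simp add: x\<close>)
      then have "norm (X m - x) \<le> e/2" by (rule power2_le_imp_le) (use e in simp)
      then show ?thesis using e by (simp add: dist_norm)
    qed
    then show "\<exists>M. \<forall>m\<ge>M. dist (X m) x < e" by blast
  qed
  then show "convergent X" unfolding convergent_def by blast
qed

section \<open>The inner product on sequences and ampliation of operators\<close>

lemma l2_summable_cinner: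
  fixes f g :: "nat \<Rightarrow> 'a::chilbert_space"
  assumes "summable (\<lambda>n. (norm (f n))\<^sup>2)" "summable (\<lambda>n. (norm (g n))\<^sup>2)"
  shows "summable (\<lambda>n. cinner (f n) (g n))"
  by (rule summable_comparison_test'[OF l2_summable_norm_mult[OF assms]]) (simp add: cmod_cinner_le)

instantiation l2 :: (chilbert_space) chilbert_space
begin

lift_definition scaleC_l2 :: "complex \<Rightarrow> 'a l2 \<Rightarrow> 'a l2" is "\<lambda>c f n. c *\<^sub>C f n" by (rule l2_summable_scaleC)
lift_definition cinner_l2 :: "'a l2 \<Rightarrow> 'a l2 \<Rightarrow> complex" is "\<lambda>f g. \<Sum>n. cinner (f n) (g n)" .

instance
proof
  fix x y z :: "'a l2" and r :: real and c d :: complex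
  show "c *\<^sub>C (x + y) = c *\<^sub>C x + c *\<^sub>C y" by transfer (simp add: scaleC_add_right)
  show "(c + d) *\<^sub>C x = c *\<^sub>C x + d *\<^sub>C x" by transfer (simp add: scaleC_add_left)
  show "c *\<^sub>C d *\<^sub>C x = (c * d) *\<^sub>C x" by transfer (simp add: scaleC_scaleC)
  show "1 *\<^sub>C x = x" by transfer (simp add: scaleC_one)
  show "r *\<^sub>R x = complex_of_real r *\<^sub>C x" by transfer (simp add: scaleR_scaleC)
  show "cinner x y = cnj (cinner y x)"
  proof transfer
    fix f g :: "nat \<Rightarrow> 'a"
    assume "summable (\<lambda>n. (norm (f n))\<^sup>2)" "summable (\<lambda>n. (norm (g n))\<^sup>2)"
    then have "(\<lambda>n. cinner (g n) (f n)) sums (\<Sum>n. cinner (g n) (f n))"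
      by (intro summable_sums l2_summable_cinner)
    then have "(\<lambda>n. cnj (cinner (g n) (f n))) sums cnj (\<Sum>n. cinner (g n) (f n))"
      by (simp only: sums_cnj)
    then show "(\<Sum>n. cinner (f n) (g n)) = cnj (\<Sum>n. cinner (g n) (f n))"
      by (simp only: cinner_commute[symmetric] sums_unique[symmetric])
  qed
  show "cinner x (y + z) = cinner x y + cinner x z"
    by transfer (simp add: cinner_add_right suminf_add l2_summable_cinner)
  show "cinner x (c *\<^sub>C y) = c * cinner x y"
    by transfer (simp add: cinner_scaleC_right suminf_mult l2_summable_cinner)
  show "cinner x x = complex_of_real ((norm x)\<^sup>2)"
    by transfer (simp add: cinner_self suminf_of_real suminf_nonneg)
qed

end

lemma l2_nth_scaleC [simp]: "l2_nth (c *\<^sub>C x) n = c *\<^sub>C l2_nth x n"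
  by (transfer; simp)

lemma cinner_l2_sums: "(\<lambda>n. cinner (l2_nth x n) (l2_nth y n)) sums cinner x y"
  by transfer (intro summable_sums l2_summable_cinner)

text \<open>The ampliation T \<otimes> 1 on the Hilbert space tensored with the square-summable
  scalar sequences.\<close>

definition amp :: "'a::chilbert_space bop \<Rightarrow> 'a l2 bop" where
  "amp T = Bop (\<lambda>x. Abs_l2 (\<lambda>n. bapp T (l2_nth x n)))"

lemma l2_nth_amp [simp]: "l2_nth (bapp (amp T) x) n = bapp T (l2_nth x n)"
proof -
  define f where "f x = Abs_l2 (\<lambda>n. bapp T (l2_nth x n))" for x
  have f: "l2_nth (f x) n = bapp T (l2_nth x n)" for x n
    unfolding f_def by (simp add: Abs_l2_inverse l2_summable_bapp l2_nth_summable)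
  obtain K where K: "K > 0" "\<And>x. norm (bapp T x) \<le> K * norm x" using bapp_bound by blast
  have "bounded_clinear f"
  proof (rule bounded_clinearI)
    show "f (x + y) = f x + f y" for x y by (rule l2_eqI) (simp add: f bapp_add)
    show "f (c *\<^sub>C x) = c *\<^sub>C f x" for c x by (rule l2_eqI) (simp add: f bapp_scaleC)
    show "norm (f x) \<le> K * norm x" for x
    proof (rule power2_le_imp_le)
      have "(norm (f x))\<^sup>2 \<le> (\<Sum>n. K\<^sup>2 * (norm (l2_nth x n))\<^sup>2)"
        unfolding l2_norm_sq f
      proof (intro suminf_le summable_mult l2_summable_bapp l2_nth_summable)
        show "(norm (bapp T (l2_nth x n)))\<^sup>2 \<le> K\<^sup>2 * (norm (l2_nth x n))\<^sup>2" for n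
          using power_mono[OF K(2)[of "l2_nth x n"], of 2] by (simp add: power_mult_distrib)
      qed
      also have "\<dots> = (K * norm x)\<^sup>2"
        by (simp add: suminf_mult l2_nth_summable l2_norm_sq power_mult_distrib)
      finally show "(norm (f x))\<^sup>2 \<le> (K * norm x)\<^sup>2" .
    qed (use K in simp)
  qed
  then have "bapp (amp T) = f" unfolding amp_def f_def[abs_def] by (simp add: Bop_inverse)
  then show ?thesis by (simp add: f)
qed

lemma amp_simps [simp]:
  "amp (S + T) = amp S + amp T" "amp (S - T) = amp S - amp T" "amp (S * T) = amp S * amp T"
  "amp (c *\<^sub>C S) = c *\<^sub>C amp S" "amp 1 = 1" "amp 0 = 0"
  by (rule bop_eqI, rule l2_eqI, simp)+

lemma adj_amp [simp]: "adj (amp T) = amp (adj T)"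
proof (rule adjI)
  fix x y :: "'a l2"
  have "(\<lambda>n. cinner (bapp (adj T) (l2_nth x n)) (l2_nth y n)) sums cinner (bapp (amp (adj T)) x) y"
    using cinner_l2_sums[of "bapp (amp (adj T)) x" y] by simp
  moreover have "(\<lambda>n. cinner (l2_nth x n) (bapp T (l2_nth y n))) sums cinner x (bapp (amp T) y)"
    using cinner_l2_sums[of x "bapp (amp T) y"] by simp
  ultimately show "cinner (bapp (amp (adj T)) x) y = cinner x (bapp (amp T) y)"
    by (simp add: cinner_adj_left sums_unique2)
qed

lemma normal_functional_l2:
  assumes "normal_functional P \<phi>"
  obtains \<xi> \<eta> :: "'a::chilbert_space l2" where "\<And>x. x \<in> P \<Longrightarrow> \<phi> x = cinner \<xi> (bapp (amp x) \<eta>)"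
proof -
  obtain f g :: "nat \<Rightarrow> 'a" where fg: "summable (\<lambda>n. (norm (f n))\<^sup>2)" "summable (\<lambda>n. (norm (g n))\<^sup>2)"
    "\<And>x. x \<in> P \<Longrightarrow> (\<lambda>n. cinner (f n) (bapp x (g n))) sums \<phi> x"
    using assms unfolding normal_functional_def by blast
  have n: "l2_nth (Abs_l2 f) = f" "l2_nth (Abs_l2 g) = g" using fg by (auto simp: Abs_l2_inverse)
  have "\<phi> x = cinner (Abs_l2 f) (bapp (amp x) (Abs_l2 g))" if "x \<in> P" for x
    using cinner_l2_sums[of "Abs_l2 f" "bapp (amp x) (Abs_l2 g)"] fg(3)[OF that]
    by (simp add: n sums_unique2)
  then show ?thesis using that by blast
qed

section \<open>Square roots of positive operators\<close>

lemma positive_form_Cauchy_Schwarz: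
  fixes X :: "'x::complex_vector set"
  assumes X: "complex_vector.subspace X"
    and B1: "\<And>y. y \<in> X \<Longrightarrow> functional_on X (B y)"
    and B2: "\<And>x. x \<in> X \<Longrightarrow> functional_on X (\<lambda>y. cnj (B y x))"
    and pos: "\<And>x. x \<in> X \<Longrightarrow> B x x \<in> \<real>\<^sub>\<ge>\<^sub>0" and x: "x \<in> X" and y: "y \<in> X"
  shows "(cmod (B y x))\<^sup>2 \<le> Re (B y y) * Re (B x x)" "B x y = cnj (B y x)"
proof -
  have addr: "B z (u + v) = B z u + B z v" "B z (c *\<^sub>C u) = c * B z u"
    if "z \<in> X" "u \<in> X" "v \<in> X" for z u v c
    using B1[of z] that unfolding functional_on_def by auto
  have addl: "B (u + v) z = B u z + B v z" "B (c *\<^sub>C u) z = cnj c * B u z"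
    if "z \<in> X" "u \<in> X" "v \<in> X" for z u v c
  proof -
    have "cnj (B (u + v) z) = cnj (B u z) + cnj (B v z)" "cnj (B (c *\<^sub>C u) z) = c * cnj (B u z)"
      using B2[of z] that unfolding functional_on_def by auto
    then show "B (u + v) z = B u z + B v z" "B (c *\<^sub>C u) z = cnj c * B u z"
      by (metis complex_cnj_add complex_cnj_cnj, metis complex_cnj_mult complex_cnj_cnj)
  qed
  have im: "Im (B u u) = 0" "0 \<le> Re (B u u)" if "u \<in> X" for u
    using pos[OF that] by (auto simp: complex_nonneg_Reals_iff)
  have ex: "B (y + t *\<^sub>C x) (y + t *\<^sub>C x) = B y y + t * B y x + cnj t * B x y + cnj t * t * B x x" for t
    using x y by (simp add: addr addl complex_vector.subspace_add[OF X] complex_vector.subspace_scale[OF X] algebra_simps)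
  have mem: "y + t *\<^sub>C x \<in> X" for t
    using x y complex_vector.subspace_add[OF X] complex_vector.subspace_scale[OF X] by blast
  \<comment> \<open>Polarization: \<open>B\<close> is real on the diagonal, and expanding it at y +
    t x for t = \<i> and t = 1 yields the real and the imaginary part of the symmetry.\<close>
  show herm: "B x y = cnj (B y x)"
  proof (rule complex_eqI)
    show "Re (B x y) = Re (cnj (B y x))"
      using im(1)[OF mem[of \<i>]] im(1)[OF x] im(1)[OF y] unfolding ex by simp
    show "Im (B x y) = Im (cnj (B y x))"
      using im(1)[OF mem[of 1]] im(1)[OF x] im(1)[OF y] unfolding ex by simp
  qed
  define n where "n = (cmod (B y x))\<^sup>2"
  define a where "a = Re (B x x)"
  define b where "b = Re (B y y)"
  \<comment> \<open>The phase of \<open>t\<close> makes both cross terms real, which leaves a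
    polynomial in the real variable \<open>s\<close> that is nowhere negative.\<close>
  have q: "0 \<le> b - 2 * s * n + s\<^sup>2 * n * a" for s :: real
  proof -
    define t where "t = - (complex_of_real s * cnj (B y x))"
    have e1: "t * B y x = - complex_of_real (s * n)"
      unfolding t_def n_def of_real_mult complex_norm_square[of "B y x"] by simp
    have e2: "cnj t * B x y = - complex_of_real (s * n)"
      unfolding t_def n_def of_real_mult complex_norm_square[of "B y x"] herm by simp
    have e3: "cnj t * t = complex_of_real (s\<^sup>2 * n)"
      unfolding t_def n_def of_real_mult complex_norm_square[of "B y x"] by (simp add: power2_eq_square)
    have "Re (B y y + t * B y x + cnj t * B x y + cnj t * t * B x x) = b - 2 * s * n + s\<^sup>2 * n * a"
      unfolding e1 e2 e3 by (simp add: a_def b_def)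
    then show ?thesis using im(2)[OF mem[of t]] unfolding ex by simp
  qed
  have n0: "n \<ge> 0" "a \<ge> 0" unfolding n_def a_def using im(2)[OF x] by auto
  have "n \<le> b * a"
  proof (cases "a = 0")
    case True
    have "n = 0"
    proof (rule ccontr)
      assume "n \<noteq> 0"
      \<comment> \<open>For \<open>a = 0\<close> the polynomial is linear in \<open>s\<close>; this
        value of \<open>s\<close> brings it to -1 unless its slope vanishes.\<close>
      then have "0 \<le> b - 2 * ((b + 1) / (2 * n)) * n" using q[of "(b + 1) / (2 * n)"] True by simp
      also have "\<dots> = - 1" using \<open>n \<noteq> 0\<close> by (simp add: field_simps)
      finally show False by simp
    qed
    then show ?thesis using True by simp
  next
    case False
    then have a: "a > 0" using n0 by simp
    have "0 \<le> b - 2 * (1 / a) * n + (1 / a)\<^sup>2 * n * a" by (rule q)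
    also have "\<dots> = b - n / a" using a by (simp add: power2_eq_square field_simps)
    finally show ?thesis using a by (simp add: field_simps)
  qed
  then show "(cmod (B y x))\<^sup>2 \<le> Re (B y y) * Re (B x x)" unfolding n_def a_def b_def .
qed

section \<open>Operators with nonnegative quadratic form\<close>

definition selfadj_nonneg :: "'a::chilbert_space bop \<Rightarrow> bool" where
  "selfadj_nonneg T \<longleftrightarrow> adj T = T \<and> (\<forall>x. 0 \<le> Re (cinner x (bapp T x)))"

lemma selfadj_im: "adj T = T \<Longrightarrow> Im (cinner x (bapp T x)) = 0"
  by (metis cinner_adj_left cinner_commute cnj.simps(2) equal_neg_zero)

lemma selfadj_nonneg_Cauchy_Schwarz:
  assumes "selfadj_nonneg T"
  shows "(cmod (cinner y (bapp T x)))\<^sup>2 \<le> Re (cinner y (bapp T y)) * Re (cinner x (bapp T x))"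
proof (rule positive_form_Cauchy_Schwarz(1)[of UNIV "\<lambda>y x. cinner y (bapp T x)"])
  show "functional_on UNIV (\<lambda>x. cinner y (bapp T x))" for y
    by (simp add: functional_on_def bapp_add bapp_scaleC cinner_add_right cinner_scaleC_right)
  show "functional_on UNIV (\<lambda>y. cnj (cinner y (bapp T x)))" for x
    by (simp add: functional_on_def cinner_add_left cinner_scaleC_left)
  show "cinner x (bapp T x) \<in> \<real>\<^sub>\<ge>\<^sub>0" for x
    using assms selfadj_im unfolding selfadj_nonneg_def complex_nonneg_Reals_iff by auto
qed auto

text \<open>Cauchy-Schwarz for the form of \<open>T\<close>, at the vectors T x and x: ||T x||^4
  \<le> <T x, T T x> <x, T x>, and the hypothesis bounds both factors.\<close>

lemma selfadj_nonneg_contraction: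
  assumes T: "selfadj_nonneg T" and le: "\<And>x. Re (cinner x (bapp T x)) \<le> (norm x)\<^sup>2"
  shows "norm (bapp T x) \<le> norm x"
proof (cases "bapp T x = 0")
  case False
  have "((norm (bapp T x))\<^sup>2)\<^sup>2 = (cmod (cinner (bapp T x) (bapp T x)))\<^sup>2"
    unfolding cinner_self by (simp add: norm_power)
  also have "\<dots> \<le> Re (cinner (bapp T x) (bapp T (bapp T x))) * Re (cinner x (bapp T x))"
    by (rule selfadj_nonneg_Cauchy_Schwarz[OF T])
  also have "\<dots> \<le> (norm (bapp T x))\<^sup>2 * (norm x)\<^sup>2"
    by (intro mult_mono le) (use T in \<open>auto simp: selfadj_nonneg_def\<close>)
  finally have "(norm (bapp T x))\<^sup>2 * (norm (bapp T x))\<^sup>2 \<le> (norm (bapp T x))\<^sup>2 * (norm x)\<^sup>2"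
    by (simp only: power2_eq_square[of "(norm (bapp T x))\<^sup>2"])
  then have "(norm (bapp T x))\<^sup>2 \<le> (norm x)\<^sup>2"
    using False by (subst (asm) mult_le_cancel_left_pos) auto
  then show ?thesis by (rule power2_le_imp_le) simp
qed simp

text \<open>Polynomials in \<open>A\<close> with nonnegative coefficients. They are closed under
  sums and products, and are positive operators when \<open>A\<close> is. This makes the
  monotonicity of the square root iteration visible without a spectral theorem.\<close>

inductive_set power_cone :: "'a::complex_algebra \<Rightarrow> 'a set" for A where
  zero: "0 \<in> power_cone A"
| add: "T \<in> power_cone A \<Longrightarrow> c \<ge> 0 \<Longrightarrow> complex_of_real c *\<^sub>C A ^ k + T \<in> power_cone A"

lemma power_cone_plus: "T \<in> power_cone A \<Longrightarrow> U \<in> power_cone A \<Longrightarrow> T + U \<in> power_cone A"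
  by (induction rule: power_cone.induct) (auto simp: add.assoc intro: power_cone.add)

lemma power_cone_scale: "T \<in> power_cone A \<Longrightarrow> r \<ge> 0 \<Longrightarrow> complex_of_real r *\<^sub>C T \<in> power_cone A"
proof (induction rule: power_cone.induct)
  case (add T c k)
  then show ?case using power_cone.add[of "complex_of_real r *\<^sub>C T" A "r * c" k]
    by (simp add: scaleC_add_right scaleC_scaleC)
qed (simp add: power_cone.zero)

lemma power_cone_power_mult: "T \<in> power_cone A \<Longrightarrow> A ^ j * T \<in> power_cone A"
proof (induction rule: power_cone.induct)
  case (add T c k)
  then show ?case using power_cone.add[of "A ^ j * T" A c "j + k"]
    by (simp add: distrib_left scaleC_mult_right power_add)
qed (simp add: power_cone.zero)

lemma power_cone_mult: "T \<in> power_cone A \<Longrightarrow> U \<in> power_cone A \<Longrightarrow> T * U \<in> power_cone A"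
proof (induction rule: power_cone.induct)
  case (add T c k)
  then show ?case
    by (simp add: distrib_right scaleC_mult_left power_cone_plus power_cone_scale power_cone_power_mult)
qed (simp add: power_cone.zero)

lemma power_cone_base: "A \<in> power_cone A"
  using power_cone.add[OF power_cone.zero, of 1 A 1] by (simp add: scaleC_one)

lemma power_cone_commute: "T \<in> power_cone A \<Longrightarrow> U * A = A * U \<Longrightarrow> U * T = T * U"
  by (induction rule: power_cone.induct)
    (auto simp: distrib_left distrib_right scaleC_mult_left scaleC_mult_right power_commuting_commutes)

text \<open>Powers reduce two at a time to A^0 and A^1, since A^(j+2) = A A^j A and <x, A T A x> =
  <A x, T A x>.\<close>

lemma selfadj_nonneg_power:
  assumes "selfadj_nonneg A" shows "selfadj_nonneg (A ^ k)"
proof (induction k rule: nat_less_induct)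
  case (1 k)
  consider "k = 0" | "k = 1" | j where "k = Suc (Suc j)" by (metis One_nat_def not0_implies_Suc)
  then show ?case
  proof cases
    case 1
    then show ?thesis by (simp add: selfadj_nonneg_def flip: norm_sq_cinner)
  next
    case 2
    then show ?thesis using assms by simp
  next
    case (3 j)
    then have j: "selfadj_nonneg (A ^ j)" using 1 by simp
    have e: "A ^ k = A * A ^ j * A" by (simp add: 3 power_commutes mult.assoc)
    show ?thesis
      using assms j unfolding selfadj_nonneg_def e
      by (simp add: mult.assoc) (metis cinner_adj_left)
  qed
qed

lemma power_cone_nonneg: "T \<in> power_cone A \<Longrightarrow> selfadj_nonneg A \<Longrightarrow> selfadj_nonneg T"
proof (induction rule: power_cone.induct)
  case (add T c k)
  then show ?case
    using selfadj_nonneg_power[OF add.prems, of k]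
    by (simp add: selfadj_nonneg_def cinner_add_right cinner_scaleC_right)
qed (simp add: selfadj_nonneg_def)

lemma selfadj_nonneg_sqrt_contraction:
  fixes A :: "'a::chilbert_space bop"
  assumes A: "selfadj_nonneg A" and A1: "\<And>x. norm (bapp A x) \<le> norm x"
  obtains Q where "adj Q = Q" "Q * Q = 1 - A" "\<And>T. T * A = A * T \<Longrightarrow> T * Q = Q * T"
proof -
  \<comment> \<open>With Q = 1 - R, the equation Q Q = 1 - A reads R = (A + R R) / 2.
    \<open>X\<close> is the fixed-point iteration for it, started at 0; its iterates and their
    increments lie in \<open>power_cone A\<close>.\<close>
  define X where "X = rec_nat 0 (\<lambda>_ Y. complex_of_real (1/2) *\<^sub>C (A + Y * Y))"
  have X0: "X 0 = 0" and XS: "X (Suc n) = complex_of_real (1/2) *\<^sub>C (A + X n * X n)" for n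
    by (simp_all add: X_def)
  have Xc: "X n \<in> power_cone A" for n
    by (induction n) (auto simp: X0 XS intro!: power_cone.zero power_cone_scale power_cone_plus power_cone_mult power_cone_base simp del: of_real_divide)
  have comm: "X n * X m = X m * X n" for n m
    using power_cone_commute[OF Xc[of m], of "X n"] power_cone_commute[OF Xc[of n], of A] by metis
  have D: "X (Suc n) - X n \<in> power_cone A" for n
  proof (induction n)
    case 0
    show ?case using power_cone_scale[OF power_cone_base, of "1/2" A] by (simp add: XS X0)
  next
    case (Suc n)
    have "X (Suc (Suc n)) - X (Suc n) = complex_of_real (1/2) *\<^sub>C (X (Suc n) * X (Suc n) - X n * X n)"
      unfolding XS[of "Suc n"] XS[of n] by (simp flip: complex_vector.scale_right_diff_distrib)
    also have "X (Suc n) * X (Suc n) - X n * X n = (X (Suc n) + X n) * (X (Suc n) - X n)"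
      using comm[of n "Suc n"] by (simp add: algebra_simps)
    finally show ?case using Suc Xc by (simp add: power_cone_scale power_cone_mult power_cone_plus del: of_real_divide)
  qed
  have Dm: "X (m + n) - X n \<in> power_cone A" for m n
  proof (induction m)
    case (Suc m)
    have "X (Suc m + n) - X n = (X (Suc (m + n)) - X (m + n)) + (X (m + n) - X n)" by simp
    show ?case unfolding \<open>X (Suc m + n) - X n = _\<close> by (rule power_cone_plus[OF D Suc])
  qed (simp add: power_cone.zero)
  have X1: "norm (bapp (X n) x) \<le> norm x" for n x
  proof (induction n arbitrary: x)
    case (Suc n)
    have "norm (bapp (X (Suc n)) x) = norm (bapp A x + bapp (X n) (bapp (X n) x)) / 2"
      by (simp add: XS norm_scaleC)
    also have "\<dots> \<le> (norm (bapp A x) + norm (bapp (X n) (bapp (X n) x))) / 2"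
      by (simp add: norm_triangle_ineq)
    also have "\<dots> \<le> norm x" using A1[of x] Suc[of x] Suc[of "bapp (X n) x"] by simp
    finally show ?case .
  qed (simp add: X0)
  define a where "a x n = Re (cinner x (bapp (X n) x))" for x n
  have ale: "a x n \<le> (norm x)\<^sup>2" for x n
  proof -
    have "a x n \<le> cmod (cinner x (bapp (X n) x))" unfolding a_def by (rule complex_Re_le_cmod)
    also have "\<dots> \<le> norm x * norm (bapp (X n) x)" by (rule cmod_cinner_le)
    also have "\<dots> \<le> norm x * norm x" by (intro mult_left_mono X1) simp
    finally show ?thesis by (simp add: power2_eq_square)
  qed
  \<comment> \<open>For E \<ge> 0, Cauchy-Schwarz gives ||E x||^2 \<le> ||E|| <x, E x>, and here
    ||E|| \<le> 2. So convergence of the bounded increasing sequence \<open>a x\<close> forces the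
    iterates to converge strongly.\<close>
  have diff: "(norm (bapp (X (m + n)) x - bapp (X n) x))\<^sup>2 \<le> 2 * (a x (m + n) - a x n)" for m n x
  proof -
    define E where "E = X (m + n) - X n"
    have E: "selfadj_nonneg E" unfolding E_def by (rule power_cone_nonneg[OF Dm A])
    have E2: "norm (bapp E y) \<le> 2 * norm y" for y
      unfolding E_def using norm_triangle_ineq4[of "bapp (X (m + n)) y" "bapp (X n) y"] X1[of "m + n" y] X1[of n y]
      by simp
    have aE: "Re (cinner x (bapp E x)) = a x (m + n) - a x n"
      by (simp add: E_def a_def cinner_diff_right)
    have a0: "0 \<le> a x (m + n) - a x n" using E aE unfolding selfadj_nonneg_def by metis
    have "(norm (bapp E x))\<^sup>2 \<le> 2 * (a x (m + n) - a x n)"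
    proof (cases "bapp E x = 0")
      case False
      have "((norm (bapp E x))\<^sup>2)\<^sup>2 = (cmod (cinner (bapp E x) (bapp E x)))\<^sup>2"
        unfolding cinner_self by (simp add: norm_power)
      also have "\<dots> \<le> Re (cinner (bapp E x) (bapp E (bapp E x))) * Re (cinner x (bapp E x))"
        by (rule selfadj_nonneg_Cauchy_Schwarz[OF E])
      also have "\<dots> \<le> (2 * (norm (bapp E x))\<^sup>2) * (a x (m + n) - a x n)"
      proof (intro mult_mono)
        have "Re (cinner (bapp E x) (bapp E (bapp E x))) \<le> cmod (cinner (bapp E x) (bapp E (bapp E x)))"
          by (rule complex_Re_le_cmod)
        also have "\<dots> \<le> norm (bapp E x) * norm (bapp E (bapp E x))" by (rule cmod_cinner_le)
        also have "\<dots> \<le> norm (bapp E x) * (2 * norm (bapp E x))" by (intro mult_left_mono E2) simp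
        finally show "Re (cinner (bapp E x) (bapp E (bapp E x))) \<le> 2 * (norm (bapp E x))\<^sup>2"
          by (simp add: power2_eq_square)
      qed (use a0 aE in simp_all)
      finally have "(norm (bapp E x))\<^sup>2 * (norm (bapp E x))\<^sup>2 \<le> (norm (bapp E x))\<^sup>2 * (2 * (a x (m + n) - a x n))"
        unfolding power2_eq_square[of "(norm (bapp E x))\<^sup>2"] by (simp only: mult_ac)
      then show ?thesis using False by (subst (asm) mult_le_cancel_left_pos) auto
    qed (use a0 in simp)
    then show ?thesis by (simp add: E_def)
  qed
  have "\<exists>l. (\<lambda>n. bapp (X n) x) \<longlonglongrightarrow> l" for x
  proof -
    have mono: "incseq (a x)"
    proof (rule incseq_SucI)
      fix n
      have "0 \<le> Re (cinner x (bapp (X (Suc n) - X n) x))"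
        using power_cone_nonneg[OF D A] unfolding selfadj_nonneg_def by blast
      then show "a x n \<le> a x (Suc n)" by (simp add: a_def cinner_diff_right)
    qed
    then obtain L where "a x \<longlonglongrightarrow> L" using incseq_convergent[OF mono, of "(norm x)\<^sup>2"] ale by metis
    then have Ca: "Cauchy (a x)" by (rule LIMSEQ_imp_Cauchy)
    have "Cauchy (\<lambda>n. bapp (X n) x)"
    proof (rule metric_CauchyI)
      fix e :: real assume e: "0 < e"
      obtain M where M: "\<And>m n. m \<ge> M \<Longrightarrow> n \<ge> M \<Longrightarrow> dist (a x m) (a x n) < e\<^sup>2 / 2"
        using metric_CauchyD[OF Ca, of "e\<^sup>2/2"] e by auto
      have *: "dist (bapp (X m) x) (bapp (X n) x) < e" if "n \<ge> M" "m \<ge> n" for m n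
      proof -
        have "(norm (bapp (X m) x - bapp (X n) x))\<^sup>2 \<le> 2 * (a x m - a x n)"
          using diff[of "m - n" n x] that by simp
        also have "\<dots> < e\<^sup>2" using M[of m n] that unfolding dist_real_def by (smt (verit) le_trans field_sum_of_halves)
        finally show ?thesis unfolding dist_norm using e by (meson less_imp_le power_less_imp_less_base)
      qed
      have "dist (bapp (X m) x) (bapp (X n) x) < e" if "m \<ge> M" "n \<ge> M" for m n
        using *[of n m] *[of m n] that by (cases "n \<le> m") (auto simp: dist_commute)
      then show "\<exists>M. \<forall>m\<ge>M. \<forall>n\<ge>M. dist (bapp (X m) x) (bapp (X n) x) < e" by blast
    qed
    then show ?thesis using Cauchy_convergent convergent_def by blast
  qed
  then obtain f where f: "\<And>x. (\<lambda>n. bapp (X n) x) \<longlonglongrightarrow> f x" by metis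
  obtain R where R: "\<And>x. bapp R x = f x"
  proof (rule bop_exists[of f 1])
    show "f (x + y) = f x + f y" for x y
      using LIMSEQ_unique[OF f[of "x + y"]] tendsto_add[OF f[of x] f[of y]] by (simp add: bapp_add)
    show "f (c *\<^sub>C x) = c *\<^sub>C f x" for c x
      using LIMSEQ_unique[OF f[of "c *\<^sub>C x"]] tendsto_scaleC[OF f[of x]] by (simp add: bapp_scaleC)
    show "norm (f x) \<le> 1 * norm x" for x
      by (rule LIMSEQ_le_const2[OF tendsto_norm[OF f[of x]]]) (use X1 in auto)
  qed blast
  have lim: "(\<lambda>n. bapp (X n) x) \<longlonglongrightarrow> bapp R x" for x using f R by simp
  \<comment> \<open>Strong limits pass to the square because the iterates are contractions.\<close>
  have lim2: "(\<lambda>n. bapp (X n) (bapp (X n) x)) \<longlonglongrightarrow> bapp R (bapp R x)" for x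
  proof -
    have "(\<lambda>n. norm (bapp (X n) x - bapp R x)) \<longlonglongrightarrow> 0"
      using tendsto_diff[OF lim[of x] tendsto_const[of "bapp R x"]] tendsto_norm_zero by fastforce
    then have "(\<lambda>n. bapp (X n) (bapp (X n) x - bapp R x)) \<longlonglongrightarrow> 0"
      by (rule Lim_null_comparison[rotated]) (use X1 in auto)
    from tendsto_add[OF this lim[of "bapp R x"]] show ?thesis by (simp add: bapp_diff)
  qed
  have Req: "R = complex_of_real (1/2) *\<^sub>C (A + R * R)"
  proof (rule bop_eqI)
    fix x
    have l1: "(\<lambda>n. bapp (X (Suc n)) x) \<longlonglongrightarrow> bapp R x" by (rule LIMSEQ_Suc[OF lim])
    have l2: "(\<lambda>n. bapp (X (Suc n)) x) \<longlonglongrightarrow> complex_of_real (1/2) *\<^sub>C (bapp A x + bapp R (bapp R x))"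
      unfolding XS bapp_simps by (intro tendsto_scaleC tendsto_add tendsto_const lim2)
    show "bapp R x = bapp (complex_of_real (1/2) *\<^sub>C (A + R * R)) x"
      unfolding bapp_simps by (rule LIMSEQ_unique[OF l1 l2])
  qed
  have RR: "R + R = A + R * R"
  proof -
    have "R + R = (1 + 1) *\<^sub>C R" by (simp only: scaleC_add_left scaleC_one)
    also have "\<dots> = ((1 + 1) * complex_of_real (1/2)) *\<^sub>C (A + R * R)"
      unfolding scaleC_scaleC[symmetric] by (rule arg_cong[OF Req])
    finally show ?thesis by (simp add: scaleC_one)
  qed
  show ?thesis
  proof (rule that[of "1 - R"])
    have "adj R = R"
    proof (rule adjI)
      fix x y
      have "(\<lambda>n. cinner (bapp (X n) x) y) \<longlonglongrightarrow> cinner (bapp R x) y"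
        by (intro cinner.tendsto lim tendsto_const)
      moreover have "(\<lambda>n. cinner x (bapp (X n) y)) \<longlonglongrightarrow> cinner x (bapp R y)"
        by (intro cinner.tendsto lim tendsto_const)
      moreover have "cinner (bapp (X n) x) y = cinner x (bapp (X n) y)" for n
        using power_cone_nonneg[OF Xc A] cinner_adj_left unfolding selfadj_nonneg_def by metis
      ultimately show "cinner (bapp R x) y = cinner x (bapp R y)" by (simp add: LIMSEQ_unique)
    qed
    then show "adj (1 - R) = 1 - R" by simp
    show "(1 - R) * (1 - R) = 1 - A" using RR by (simp add: algebra_simps)
    fix T assume T: "T * A = A * T"
    have "T * R = R * T"
    proof (rule bop_eqI)
      fix x
      have "(\<lambda>n. bapp T (bapp (X n) x)) \<longlonglongrightarrow> bapp T (bapp R x)" by (intro tendsto_bapp lim)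
      moreover have "bapp T (bapp (X n) x) = bapp (X n) (bapp T x)" for n
        using power_cone_commute[OF Xc T, of n] by (metis bapp_simps(6))
      ultimately show "bapp (T * R) x = bapp (R * T) x"
        using LIMSEQ_unique lim[of "bapp T x"] by simp
    qed
    then show "T * (1 - R) = (1 - R) * T" by (simp add: algebra_simps)
  qed
qed

text \<open>For a bound \<open>K\<close> of \<open>S\<close> the operator 1 - S / K is a positive
  contraction, so the iteration yields a square root of S / K; it is scaled back by
  \<open>sqrt K\<close>.\<close>

lemma selfadj_nonneg_sqrt:
  fixes S :: "'a::chilbert_space bop"
  assumes S: "selfadj_nonneg S"
  obtains R where "adj R = R" "R * R = S" "\<And>T. T * S = S * T \<Longrightarrow> T * R = R * T"
proof -
  obtain K where K: "K > 0" "\<And>x. norm (bapp S x) \<le> K * norm x" using bapp_bound by blast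
  define A where "A = 1 - complex_of_real (1 / K) *\<^sub>C S"
  have cS: "Re (cinner x (bapp S x)) \<le> K * (norm x)\<^sup>2" for x
  proof -
    have "Re (cinner x (bapp S x)) \<le> norm x * norm (bapp S x)"
      using complex_Re_le_cmod cmod_cinner_le order_trans by blast
    also have "\<dots> \<le> norm x * (K * norm x)" by (intro mult_left_mono K) simp
    finally show ?thesis by (simp add: power2_eq_square mult_ac)
  qed
  have ReA: "Re (cinner x (bapp A x)) = (norm x)\<^sup>2 - Re (cinner x (bapp S x)) / K" for x
    by (simp add: A_def cinner_diff_right cinner_scaleC_right flip: norm_sq_cinner)
  have A: "selfadj_nonneg A"
    unfolding selfadj_nonneg_def
  proof (intro conjI allI)
    show "adj A = A" using S unfolding A_def selfadj_nonneg_def by simp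
    show "0 \<le> Re (cinner x (bapp A x))" for x
      unfolding ReA using cS[of x] K(1) by (simp add: pos_divide_le_eq mult.commute)
  qed
  have A1: "norm (bapp A x) \<le> norm x" for x
  proof (rule selfadj_nonneg_contraction[OF A])
    show "Re (cinner x (bapp A x)) \<le> (norm x)\<^sup>2" for x
      unfolding ReA using S K(1) unfolding selfadj_nonneg_def by simp
  qed
  obtain Q where Q: "adj Q = Q" "Q * Q = 1 - A" "\<And>T. T * A = A * T \<Longrightarrow> T * Q = Q * T"
    using selfadj_nonneg_sqrt_contraction[OF A A1] by blast
  show ?thesis
  proof (rule that[of "complex_of_real (sqrt K) *\<^sub>C Q"])
    show "adj (complex_of_real (sqrt K) *\<^sub>C Q) = complex_of_real (sqrt K) *\<^sub>C Q" by (simp add: Q)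
    have "complex_of_real (sqrt K) * complex_of_real (sqrt K) = complex_of_real K"
      using K(1) by (simp flip: of_real_mult)
    then show "(complex_of_real (sqrt K) *\<^sub>C Q) * (complex_of_real (sqrt K) *\<^sub>C Q) = S"
      using K(1) by (simp add: scaleC_mult_left scaleC_mult_right scaleC_scaleC Q A_def mult.assoc[symmetric] scaleC_one)
    fix T assume "T * S = S * T"
    then have "T * A = A * T"
      by (simp add: A_def algebra_simps scaleC_mult_left scaleC_mult_right)
    then show "T * (complex_of_real (sqrt K) *\<^sub>C Q) = complex_of_real (sqrt K) *\<^sub>C Q * T"
      using Q(3) by (simp add: scaleC_mult_left scaleC_mult_right)
  qed
qed

section \<open>Bounded forms on dense subspaces\<close>

lemma closure_sequenceE:
  fixes v :: "'a::real_normed_vector"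
  assumes "v \<in> closure S"
  obtains s where "\<And>n. s n \<in> S" "s \<longlonglongrightarrow> v"
  using assms unfolding closure_sequential by blast

lemma closure_image_sequenceE:
  fixes v :: "'a::real_normed_vector"
  assumes "v \<in> closure (a ` X)"
  obtains s where "\<And>n. s n \<in> X" "(\<lambda>n. a (s n)) \<longlonglongrightarrow> v"
proof -
  obtain t where t: "\<And>n. t n \<in> a ` X" "t \<longlonglongrightarrow> v" using closure_sequenceE[OF assms] by blast
  then have "\<forall>n. \<exists>x\<in>X. t n = a x" by blast
  then obtain s where s: "\<And>n. s n \<in> X" "\<And>n. t n = a (s n)" by metis
  have e: "t = (\<lambda>n. a (s n))" by (rule ext) (rule s(2))
  show ?thesis by (rule that[of s, OF s(1) t(2)[unfolded e]])
qed

lemma closure_sequentialI: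
  fixes v :: "'a::real_normed_vector"
  assumes "\<And>n. s n \<in> S" "s \<longlonglongrightarrow> v"
  shows "v \<in> closure S"
  using assms unfolding closure_sequential by blast

lemma projection_onto_closure:
  assumes "projection_onto L p" shows "bapp p v \<in> L"
  using assms unfolding projection_onto_def by blast

text \<open>The equations \<open>p * T = T\<close> and \<open>T * p = T\<close> stand in for an
  operator on the Hilbert space closure (a X), which is a subspace and not a type of its own. Such
  operators are closed under products and are determined by their form on \<open>X\<close>.\<close>

lemma bounded_form_compressed:
  fixes X :: "'x::complex_vector set" and a :: "'x \<Rightarrow> 'a::chilbert_space"
  assumes X: "complex_vector.subspace X" and a: "linear_map_on X a"
    and p: "projection_onto (closure (a ` X)) p"
    and B1: "\<And>y. y \<in> X \<Longrightarrow> functional_on X (B y)"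
    and B2: "\<And>x. x \<in> X \<Longrightarrow> functional_on X (\<lambda>y. cnj (B y x))"
    and C: "C \<ge> 0" and bd: "\<And>x y. x \<in> X \<Longrightarrow> y \<in> X \<Longrightarrow> cmod (B y x) \<le> C * norm (a y) * norm (a x)"
  obtains T where "\<And>x y. x \<in> X \<Longrightarrow> y \<in> X \<Longrightarrow> cinner (a y) (bapp T (a x)) = B y x"
    "p * T = T" "T * p = T" "\<And>v. norm (bapp T v) \<le> C * norm v"
proof -
  note sc = subspace_closure[OF subspace_image[OF X a]]
  obtain T where T: "\<And>x y. x \<in> X \<Longrightarrow> y \<in> X \<Longrightarrow> cinner (a y) (bapp T (a x)) = B y x"
    "\<And>v. bapp T v \<in> closure (a ` X)" "\<And>v. (\<And>x. x \<in> X \<Longrightarrow> cinner (a x) v = 0) \<Longrightarrow> bapp T v = 0"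
    "\<And>v. norm (bapp T v) \<le> C * norm v"
    using bounded_form_bop[OF X a B1 B2 C bd] by metis
  have "p * T = T"
    by (rule bop_eqI) (simp add: projection_onto_fixes[OF p sc T(2)])
  moreover have "T * p = T"
  proof (rule bop_eqI)
    fix v
    have "bapp T (v - bapp p v) = 0"
      by (rule T(3)) (use p closure_subset[of "a ` X"] in \<open>auto simp: projection_onto_def\<close>)
    then show "bapp (T * p) v = bapp T v" by (simp add: bapp_diff)
  qed
  ultimately show ?thesis using that T by blast
qed

lemma compressed_eqI:
  fixes X :: "'x::complex_vector set" and a :: "'x \<Rightarrow> 'a::chilbert_space"
  assumes X: "complex_vector.subspace X" and a: "linear_map_on X a"
    and p: "projection_onto (closure (a ` X)) p"
    and S: "p * S = S" "S * p = S" and T: "p * T = T" "T * p = T"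
    and eq: "\<And>x y. x \<in> X \<Longrightarrow> y \<in> X \<Longrightarrow> cinner (a y) (bapp S (a x)) = cinner (a y) (bapp T (a x))"
  shows "S = T"
proof (rule bop_eqI)
  fix v
  note sc = subspace_closure[OF subspace_image[OF X a]]
  have rng: "bapp S v \<in> closure (a ` X)" "bapp T v \<in> closure (a ` X)" for v
    using S(1) T(1) projection_onto_closure[OF p] by (metis bapp_simps(6))+
  have "bapp S u = bapp T u" if "u \<in> a ` X" for u
  proof (rule eq_if_cinner_closure)
    show "bapp S u - bapp T u \<in> closure (a ` X)" by (rule complex_vector.subspace_diff[OF sc rng])
  qed (use that eq in auto)
  then have "bapp S (bapp p v) = bapp T (bapp p v)"
    by (rule bop_eqI_closure[OF _ projection_onto_closure[OF p]])
  then show "bapp S v = bapp T v" using S(2) T(2) by (metis bapp_simps(6))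
qed

lemma compressed_selfadj_nonneg:
  fixes X :: "'x::complex_vector set" and a :: "'x \<Rightarrow> 'a::chilbert_space"
  assumes X: "complex_vector.subspace X" and a: "linear_map_on X a"
    and p: "projection_onto (closure (a ` X)) p"
    and S: "p * S = S" "S * p = S"
    and herm: "\<And>x y. x \<in> X \<Longrightarrow> y \<in> X \<Longrightarrow> cinner (a y) (bapp S (a x)) = cnj (cinner (a x) (bapp S (a y)))"
    and nonneg: "\<And>x. x \<in> X \<Longrightarrow> 0 \<le> Re (cinner (a x) (bapp S (a x)))"
  shows "selfadj_nonneg S"
  unfolding selfadj_nonneg_def
proof (intro conjI allI)
  note sc = subspace_closure[OF subspace_image[OF X a]]
  have ap: "adj p = p" by (rule projection_onto_adj[OF p sc])
  show "adj S = S"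
  proof (rule compressed_eqI[OF X a p _ _ S])
    show "p * adj S = adj S" "adj S * p = adj S" using S ap by (metis adj_simps(2))+
    show "cinner (a y) (bapp (adj S) (a x)) = cinner (a y) (bapp S (a x))" if "x \<in> X" "y \<in> X" for x y
      using herm[OF that] by (metis cinner_adj_right cinner_commute)
  qed
  fix v
  obtain s where s: "\<And>n. s n \<in> a ` X" "s \<longlonglongrightarrow> bapp p v"
    using closure_sequenceE[OF projection_onto_closure[OF p]] by blast
  have "(\<lambda>n. Re (cinner (s n) (bapp S (s n)))) \<longlonglongrightarrow> Re (cinner (bapp p v) (bapp S (bapp p v)))"
    by (intro tendsto_Re cinner.tendsto s tendsto_bapp)
  moreover have "0 \<le> Re (cinner (s n) (bapp S (s n)))" for n using s(1)[of n] nonneg by auto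
  ultimately have "0 \<le> Re (cinner (bapp p v) (bapp S (bapp p v)))"
    by (intro LIMSEQ_le_const) auto
  also have "cinner (bapp p v) (bapp S (bapp p v)) = cinner v (bapp S v)"
    using S ap by (metis cinner_adj_left bapp_simps(6))
  finally show "0 \<le> Re (cinner v (bapp S v))" .
qed

section \<open>Star algebras and traces\<close>

definition star_algebra :: "'a::chilbert_space bop set \<Rightarrow> bool" where
  "star_algebra P \<longleftrightarrow> unital_subalgebra P \<and> adj ` P \<subseteq> P"

lemma star_algebraD:
  assumes "star_algebra P"
  shows "complex_vector.subspace P" "1 \<in> P" "\<And>x y. x \<in> P \<Longrightarrow> y \<in> P \<Longrightarrow> x * y \<in> P" "\<And>x. x \<in> P \<Longrightarrow> adj x \<in> P"
    "\<And>x y. x \<in> P \<Longrightarrow> y \<in> P \<Longrightarrow> x + y \<in> P" "\<And>x y. x \<in> P \<Longrightarrow> y \<in> P \<Longrightarrow> x - y \<in> P" "\<And>c x. x \<in> P \<Longrightarrow> c *\<^sub>C x \<in> P"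
    "0 \<in> P"
  using assms unfolding star_algebra_def unital_subalgebra_def
  by (auto intro: complex_vector.subspace_add complex_vector.subspace_diff complex_vector.subspace_scale
      complex_vector.subspace_0)

lemma unital_subalgebra_commutant: "unital_subalgebra (commutant P)"
  for P :: "'a::complex_algebra set"
  unfolding unital_subalgebra_def
proof (intro conjI ballI)
  show "complex_vector.subspace (commutant P)"
    by (rule complex_vector.subspaceI)
      (auto simp: commutant_def distrib_left distrib_right scaleC_mult_left scaleC_mult_right)
  show "x * y \<in> commutant P" if "x \<in> commutant P" "y \<in> commutant P" for x y
  proof -
    have "(x * y) * z = z * (x * y)" if "z \<in> P" for z
      using \<open>x \<in> commutant P\<close> \<open>y \<in> commutant P\<close> that unfolding commutant_def
      by (metis (mono_tags, lifting) mem_Collect_eq mult.assoc)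
    then show ?thesis unfolding commutant_def by blast
  qed
qed (simp add: commutant_def)

lemma commutant_adj:
  assumes "adj ` P \<subseteq> P" "x \<in> commutant P" shows "adj x \<in> commutant P"
proof -
  have "adj x * y = y * adj x" if "y \<in> P" for y
  proof -
    have "x * adj y = adj y * x" using assms that unfolding commutant_def by blast
    then have "adj (x * adj y) = adj (adj y * x)" by simp
    then show ?thesis by simp
  qed
  then show ?thesis unfolding commutant_def by blast
qed

lemma star_algebra_commutant: "adj ` P \<subseteq> P \<Longrightarrow> star_algebra (commutant P)"
  unfolding star_algebra_def using unital_subalgebra_commutant commutant_adj by blast

lemma von_neumann_algebra_star_algebra: "von_neumann_algebra P \<Longrightarrow> star_algebra P"
  unfolding von_neumann_algebra_def
  by (metis commutant_adj image_subsetI star_algebra_commutant)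

lemma functional_on_add_scale:
  assumes "functional_on P \<phi>" "x \<in> P" "y \<in> P"
  shows "\<phi> (x + y) = \<phi> x + \<phi> y" "\<phi> (c *\<^sub>C x) = c * \<phi> x"
  using assms unfolding functional_on_def by auto

lemma functional_on_form:
  assumes P: "star_algebra P" and \<phi>: "functional_on P \<phi>"
  shows "y \<in> P \<Longrightarrow> functional_on P (\<lambda>x. \<phi> (adj y * x))"
    "x \<in> P \<Longrightarrow> functional_on P (\<lambda>y. cnj (\<phi> (adj y * x)))"
  unfolding functional_on_def using star_algebraD[OF P]
  by (auto simp: distrib_left distrib_right scaleC_mult_right scaleC_mult_left functional_on_add_scale[OF \<phi>])

section \<open>Positive functionals and their vectors\<close>

definition positive_functional :: "'a::chilbert_space bop set \<Rightarrow> ('a bop \<Rightarrow> complex) \<Rightarrow> bool" where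
  "positive_functional P \<phi> \<longleftrightarrow> functional_on P \<phi> \<and> (\<forall>x\<in>P. \<phi> (adj x * x) \<in> \<real>\<^sub>\<ge>\<^sub>0)"

lemma positive_functional_Cauchy_Schwarz:
  assumes P: "star_algebra P" and \<phi>: "positive_functional P \<phi>" and x: "x \<in> P" and y: "y \<in> P"
  shows "(cmod (\<phi> (adj y * x)))\<^sup>2 \<le> Re (\<phi> (adj y * y)) * Re (\<phi> (adj x * x))"
    "\<phi> (adj x * y) = cnj (\<phi> (adj y * x))" "\<phi> (adj x) = cnj (\<phi> x)" "0 \<le> Re (\<phi> (adj x * x))"
    "Im (\<phi> (adj x * x)) = 0"
proof -
  note f = positive_form_Cauchy_Schwarz[of P "\<lambda>y x. \<phi> (adj y * x)"]
  have \<phi>': "functional_on P \<phi>" "\<And>x. x \<in> P \<Longrightarrow> \<phi> (adj x * x) \<in> \<real>\<^sub>\<ge>\<^sub>0"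
    using \<phi> unfolding positive_functional_def by auto
  show "(cmod (\<phi> (adj y * x)))\<^sup>2 \<le> Re (\<phi> (adj y * y)) * Re (\<phi> (adj x * x))"
    by (rule f(1)) (use star_algebraD[OF P] functional_on_form[OF P \<phi>'(1)] \<phi>'(2) x y in auto)
  have h: "\<phi> (adj x * y) = cnj (\<phi> (adj y * x))" if "x \<in> P" "y \<in> P" for x y
    by (rule f(2)) (use star_algebraD[OF P] functional_on_form[OF P \<phi>'(1)] \<phi>'(2) that in auto)
  from h[OF x y] show "\<phi> (adj x * y) = cnj (\<phi> (adj y * x))" .
  from h[of x 1] x star_algebraD(2)[OF P] show "\<phi> (adj x) = cnj (\<phi> x)" by simp
  show "0 \<le> Re (\<phi> (adj x * x))" "Im (\<phi> (adj x * x)) = 0"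
    using \<phi>'(2)[OF x] by (auto simp: complex_nonneg_Reals_iff)
qed

lemma projection_commute_cyclic:
  assumes P: "star_algebra P" and z: "z \<in> P"
    and p: "projection_onto (closure ((\<lambda>x. bapp (amp x) \<kappa>) ` P)) p"
  shows "p * amp z = amp z * p"
proof (rule projection_onto_commute[OF p])
  show "complex_vector.subspace (closure ((\<lambda>x. bapp (amp x) \<kappa>) ` P))"
    by (intro subspace_closure subspace_image star_algebraD[OF P]) (simp add: linear_map_on_def)
  have *: "bapp (amp z) v \<in> closure ((\<lambda>x. bapp (amp x) \<kappa>) ` P)"
    if "v \<in> closure ((\<lambda>x. bapp (amp x) \<kappa>) ` P)" "z \<in> P" for z v
  proof -
    obtain s where s: "\<And>n. s n \<in> (\<lambda>x. bapp (amp x) \<kappa>) ` P" "s \<longlonglongrightarrow> v"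
      using closure_sequenceE[OF \<open>v \<in> closure ((\<lambda>x. bapp (amp x) \<kappa>) ` P)\<close>] by blast
    have "bapp (amp z) (s n) \<in> (\<lambda>x. bapp (amp x) \<kappa>) ` P" for n
    proof -
      obtain x where "x \<in> P" "s n = bapp (amp x) \<kappa>" using s(1)[of n] by blast
      then have "bapp (amp z) (s n) = bapp (amp (z * x)) \<kappa>" "z * x \<in> P"
        using star_algebraD(3)[OF P that(2)] by auto
      then show ?thesis by blast
    qed
    then show ?thesis unfolding closure_sequential
      by (intro exI[of _ "\<lambda>n. bapp (amp z) (s n)"]) (auto intro: tendsto_bapp s)
  qed
  show "bapp (amp z) v \<in> closure ((\<lambda>x. bapp (amp x) \<kappa>) ` P)"
    "bapp (adj (amp z)) v \<in> closure ((\<lambda>x. bapp (amp x) \<kappa>) ` P)"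
    if "v \<in> closure ((\<lambda>x. bapp (amp x) \<kappa>) ` P)" for v
    using *[OF that] z star_algebraD(4)[OF P] by auto
qed

text \<open>With \<open>\<phi>(x) = \<langle>\<xi>, x \<eta>\<rangle>\<close>, polarization bounds \<open>\<phi>(x\<^sup>*x)\<close> by \<open>\<parallel>x \<kappa>\<parallel>\<^sup>2\<close> for \<open>\<kappa> = (\<xi> + \<eta>) / 2\<close>, so that
  \<open>\<phi>(y\<^sup>*x) = \<langle>y \<kappa>, S x \<kappa>\<rangle>\<close> with \<open>S \<ge> 0\<close> in the commutant; then \<open>\<zeta> = S\<^sup>1\<^sup>/\<^sup>2 \<kappa>\<close>.\<close>

lemma normal_positive_functional_vector:
  fixes P :: "'a::chilbert_space bop set"
  assumes P: "star_algebra P" and \<phi>: "positive_functional P \<phi>" and n\<phi>: "normal_functional P \<phi>"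
  obtains \<zeta> where "\<And>x. x \<in> P \<Longrightarrow> \<phi> x = cinner \<zeta> (bapp (amp x) \<zeta>)"
proof -
  note PD = star_algebraD[OF P]
  have f\<phi>: "functional_on P \<phi>" using \<phi> unfolding positive_functional_def by blast
  obtain \<xi> \<eta> :: "'a l2" where n: "\<And>x. x \<in> P \<Longrightarrow> \<phi> x = cinner \<xi> (bapp (amp x) \<eta>)"
    using normal_functional_l2[OF n\<phi>] by blast
  define \<kappa> where "\<kappa> = complex_of_real (1/2) *\<^sub>C (\<xi> + \<eta>)"
  define a where "a x = bapp (amp x) \<kappa>" for x
  have a: "linear_map_on P a" unfolding a_def linear_map_on_def by simp
  have le: "Re (\<phi> (adj x * x)) \<le> (norm (a x))\<^sup>2" if x: "x \<in> P" for x
  proof -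
    define u where "u = bapp (amp x) \<xi>"
    define v where "v = bapp (amp x) \<eta>"
    have "\<phi> (adj x * x) = cinner \<xi> (bapp (adj (amp x)) v)" using n[of "adj x * x"] x PD by (simp add: v_def)
    then have 1: "\<phi> (adj x * x) = cinner u v" by (simp add: cinner_adj_right u_def del: adj_amp)
    have "a x = complex_of_real (1/2) *\<^sub>C (u + v)" by (simp add: a_def \<kappa>_def u_def v_def bapp_scaleC bapp_add)
    then have "(norm (a x))\<^sup>2 = (norm (u + v))\<^sup>2 / 4" by (simp add: norm_scaleC power_divide)
    then show ?thesis unfolding 1 using norm_sq_add[of u v] norm_sq_diff[of u v] zero_le_power2[of "norm (u - v)"]
      by linarith
  qed
  have "complex_vector.subspace (closure (a ` P))" by (intro subspace_closure subspace_image PD a)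
  then obtain p where p: "projection_onto (closure (a ` P)) p" using projection_exists closed_closure by blast
  have pz: "p * amp z = amp z * p" if "z \<in> P" for z
    by (rule projection_commute_cyclic[OF P that p[unfolded a_def]])
  obtain S where S: "\<And>x y. x \<in> P \<Longrightarrow> y \<in> P \<Longrightarrow> cinner (a y) (bapp S (a x)) = \<phi> (adj y * x)"
    "p * S = S" "S * p = S"
  proof (rule bounded_form_compressed[OF PD(1) a p functional_on_form[OF P f\<phi>], of 1])
    fix x y assume xy: "x \<in> P" "y \<in> P"
    have "(cmod (\<phi> (adj y * x)))\<^sup>2 \<le> Re (\<phi> (adj y * y)) * Re (\<phi> (adj x * x))"
      by (rule positive_functional_Cauchy_Schwarz(1)[OF P \<phi> xy])
    also have "\<dots> \<le> (norm (a y))\<^sup>2 * (norm (a x))\<^sup>2"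
      using positive_functional_Cauchy_Schwarz(4)[OF P \<phi>] xy by (intro mult_mono le) auto
    finally have "(cmod (\<phi> (adj y * x)))\<^sup>2 \<le> (norm (a y) * norm (a x))\<^sup>2" by (simp add: power_mult_distrib)
    then have "cmod (\<phi> (adj y * x)) \<le> norm (a y) * norm (a x)" by (rule power2_le_imp_le) simp
    then show "cmod (\<phi> (adj y * x)) \<le> 1 * norm (a y) * norm (a x)" by simp
  qed auto
  have "selfadj_nonneg S"
  proof (rule compressed_selfadj_nonneg[OF PD(1) a p S(2,3)])
    fix x assume x: "x \<in> P"
    show "0 \<le> Re (cinner (a x) (bapp S (a x)))"
      unfolding S(1)[OF x x] by (rule positive_functional_Cauchy_Schwarz(4)[OF P \<phi> x x])
    fix y assume y: "y \<in> P"
    show "cinner (a y) (bapp S (a x)) = cnj (cinner (a x) (bapp S (a y)))"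
      unfolding S(1)[OF x y] S(1)[OF y x] by (rule positive_functional_Cauchy_Schwarz(2)[OF P \<phi> y x])
  qed
  then obtain R where R: "adj R = R" "R * R = S" "\<And>T. T * S = S * T \<Longrightarrow> T * R = R * T"
    using selfadj_nonneg_sqrt by blast
  \<comment> \<open>Both products are compressed by \<open>p\<close> and have the matrix
    coefficients \<phi> (adj y * z * x).\<close>
  have comm: "amp z * S = S * amp z" if z: "z \<in> P" for z
  proof (rule compressed_eqI[OF PD(1) a p])
    show "p * (amp z * S) = amp z * S" "amp z * S * p = amp z * S"
      "p * (S * amp z) = S * amp z" "S * amp z * p = S * amp z"
      using S(2,3) pz[OF z] by (metis mult.assoc)+
    fix x y assume xy: "x \<in> P" "y \<in> P"
    have "cinner (a y) (bapp (amp z * S) (a x)) = cinner (a (adj z * y)) (bapp S (a x))"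
      by (simp add: a_def cinner_adj_left flip: adj_amp)
    also have "\<dots> = \<phi> (adj y * (z * x))" using S(1) xy z PD by (simp add: mult.assoc)
    also have "\<dots> = cinner (a y) (bapp S (a (z * x)))" using S(1) xy z PD by simp
    also have "\<dots> = cinner (a y) (bapp (S * amp z) (a x))" by (simp add: a_def)
    finally show "cinner (a y) (bapp (amp z * S) (a x)) = cinner (a y) (bapp (S * amp z) (a x))" .
  qed
  have "\<phi> x = cinner (bapp R \<kappa>) (bapp (amp x) (bapp R \<kappa>))" if x: "x \<in> P" for x
  proof -
    have "cinner (bapp R \<kappa>) (bapp (amp x) (bapp R \<kappa>)) = cinner \<kappa> (bapp (R * amp x * R) \<kappa>)"
      using R(1) by (metis bapp_simps(6) cinner_adj_left)
    also have "R * amp x * R = S * amp x" using R(3)[OF comm[OF x]] R(2) by (metis mult.assoc)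
    also have "cinner \<kappa> (bapp (S * amp x) \<kappa>) = cinner (a 1) (bapp S (a x))" by (simp add: a_def)
    also have "\<dots> = \<phi> x" using S(1)[OF x PD(2)] by simp
    finally show ?thesis by simp
  qed
  then show ?thesis using that by blast
qed

text \<open>No normalization is demanded, so that the sum of two traces is covered as well; the
  index computation needs such a sum.\<close>

definition faithful_normal_trace :: "'a::chilbert_space bop set \<Rightarrow> ('a bop \<Rightarrow> complex) \<Rightarrow> bool" where
  "faithful_normal_trace P \<tau> \<longleftrightarrow> positive_functional P \<tau> \<and> (\<forall>x\<in>P. \<forall>y\<in>P. \<tau> (x * y) = \<tau> (y * x)) \<and>
    (\<forall>x\<in>P. \<tau> (adj x * x) = 0 \<longrightarrow> x = 0) \<and> normal_functional P \<tau>"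

lemma normalized_trace_faithful_normal_trace: "normalized_trace P \<tau> \<Longrightarrow> faithful_normal_trace P \<tau>"
  unfolding normalized_trace_def faithful_normal_trace_def positive_functional_def by simp

lemma faithful_normal_trace_mono:
  assumes "faithful_normal_trace P \<tau>" "Q \<subseteq> P" shows "faithful_normal_trace Q \<tau>"
  using assms unfolding faithful_normal_trace_def positive_functional_def functional_on_def normal_functional_def
  by (meson subsetD)

section \<open>Left multiplications\<close>

text \<open>A bounded form with \<open>B y x = B (y x\<^sup>*) 1\<close> is an operator on \<open>L\<^sup>2(P, \<tau>)\<close> that commutes with right
  multiplications.  Its multiplier is constructed on the \<open>\<tau>\<close>-bounded vectors of the given representation
  of \<open>P\<close>, which avoids the Kaplansky density theorem.\<close>

locale traced_algebra =
  fixes P :: "'a::chilbert_space bop set" and \<tau> :: "'a bop \<Rightarrow> complex" and \<zeta> :: "'a l2" and p :: "'a l2 bop"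
  assumes vN: "von_neumann_algebra P" and trace: "faithful_normal_trace P \<tau>"
    and vec: "\<And>x. x \<in> P \<Longrightarrow> \<tau> x = cinner \<zeta> (bapp (amp x) \<zeta>)"
    and proj: "projection_onto (closure ((\<lambda>x. bapp (amp x) \<zeta>) ` P)) p"
begin

definition hat where "hat x = bapp (amp x) \<zeta>"

lemmas PD = star_algebraD[OF von_neumann_algebra_star_algebra[OF vN]]

lemma \<tau>_commute: "x \<in> P \<Longrightarrow> y \<in> P \<Longrightarrow> \<tau> (x * y) = \<tau> (y * x)"
  using trace unfolding faithful_normal_trace_def by blast

lemma \<tau>_faithful: "x \<in> P \<Longrightarrow> \<tau> (adj x * x) = 0 \<Longrightarrow> x = 0"
  using trace unfolding faithful_normal_trace_def by blast

lemma hat_linear: "linear_map_on P hat"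
  unfolding hat_def linear_map_on_def by simp

lemma hat_diff: "hat (x - y) = hat x - hat y"
  by (simp add: hat_def)

lemma amp_hat: "bapp (amp z) (hat x) = hat (z * x)"
  by (simp add: hat_def)

lemma hat_1: "hat 1 = \<zeta>"
  by (simp add: hat_def)

lemma cinner_hat: "x \<in> P \<Longrightarrow> y \<in> P \<Longrightarrow> cinner (hat y) (hat x) = \<tau> (adj y * x)"
  using vec[of "adj y * x"] PD by (simp add: hat_def cinner_adj_right flip: adj_amp)

lemma norm_hat_sq: "x \<in> P \<Longrightarrow> (norm (hat x))\<^sup>2 = Re (\<tau> (adj x * x))"
  by (simp add: norm_sq_cinner cinner_hat)

lemma norm_hat_adj: "x \<in> P \<Longrightarrow> norm (hat (adj x)) = norm (hat x)"
proof -
  assume x: "x \<in> P"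
  have "(norm (hat (adj x)))\<^sup>2 = (norm (hat x))\<^sup>2"
    using norm_hat_sq[OF x] norm_hat_sq[of "adj x"] \<tau>_commute[of x "adj x"] x PD(4) by simp
  then show ?thesis by (simp add: power2_eq_iff_nonneg)
qed

lemma proj_hat: "projection_onto (closure (hat ` P)) p"
  using proj by (simp add: hat_def[abs_def])

lemma p_amp: "z \<in> P \<Longrightarrow> p * amp z = amp z * p"
  by (rule projection_commute_cyclic[OF von_neumann_algebra_star_algebra[OF vN] _ proj])

lemma compressed_hat:
  assumes "p * T = T"
  obtains s where "\<And>n. s n \<in> P" "(\<lambda>n. hat (s n)) \<longlonglongrightarrow> bapp T v"
proof -
  have "bapp T v \<in> closure (hat ` P)"
    using projection_onto_closure[OF proj_hat] assms by (metis bapp_simps(6))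
  then show ?thesis using closure_image_sequenceE that by blast
qed

text \<open>\<open>R\<close> commutes with left multiplications, and \<open>tr\<close> says that
  \<open>T\<close> formally commutes with right ones. If hat (r n) tends to R \<zeta>, then <b, T R
  a> and <b, R T a> are both limits of \<open>B (b * adj (r n) * adj a) 1\<close>. For the second,
  \<open>adj (r n)\<close> must approximate R \<zeta> too, which is where self-adjointness of
  \<open>R\<close> and traciality enter.\<close>

lemma right_left_commute:
  assumes R: "p * R = R" "R * p = R" "adj R = R" "\<And>z. z \<in> P \<Longrightarrow> amp z * R = R * amp z"
    and T: "p * T = T" "T * p = T" "\<And>x y. x \<in> P \<Longrightarrow> y \<in> P \<Longrightarrow> cinner (hat y) (bapp T (hat x)) = B y x"
    and tr: "\<And>x y. x \<in> P \<Longrightarrow> y \<in> P \<Longrightarrow> B y x = B (y * adj x) 1"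
  shows "R * T = T * R"
proof -
  obtain r where r: "\<And>n. r n \<in> P" "(\<lambda>n. hat (r n)) \<longlonglongrightarrow> bapp R \<zeta>" using compressed_hat[OF R(1)] by blast
  have ra: "adj (r n) \<in> P" for n using r(1) PD(4) by blast
  have "Cauchy (\<lambda>n. hat (r n))" using r(2) by (rule LIMSEQ_imp_Cauchy)
  moreover have "dist (hat (adj (r m))) (hat (adj (r n))) = dist (hat (r m)) (hat (r n))" for m n
    using norm_hat_adj[OF PD(6)[OF r(1)[of m] r(1)[of n]]] by (simp add: dist_norm hat_diff)
  ultimately have "Cauchy (\<lambda>n. hat (adj (r n)))" unfolding Cauchy_def by simp
  then obtain v where v: "(\<lambda>n. hat (adj (r n))) \<longlonglongrightarrow> v" using Cauchy_convergent convergent_def by blast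
  \<comment> \<open>The vector R \<zeta> is fixed by the conjugation hat x \<mapsto> hat (adj x),
    because \<open>R\<close> is self-adjoint and commutes with \<open>P\<close>.\<close>
  have "v = bapp R \<zeta>"
  proof (rule eq_if_cinner_closure)
    have vc: "v \<in> closure (hat ` P)" by (rule closure_sequentialI[OF _ v]) (use ra in blast)
    have "bapp R \<zeta> \<in> closure (hat ` P)" by (rule closure_sequentialI[OF _ r(2)]) (use r in blast)
    with vc show "v - bapp R \<zeta> \<in> closure (hat ` P)"
      by (intro complex_vector.subspace_diff subspace_closure subspace_image PD hat_linear)
    fix u assume "u \<in> hat ` P"
    then obtain b where b: "b \<in> P" "u = hat b" by blast
    have "cinner (hat b) (hat (adj (r n))) = cinner (hat (r n)) (hat (adj b))" for n
      using b ra[of n] r(1)[of n] PD(4) \<tau>_commute[of "adj b" "adj (r n)"] by (simp add: cinner_hat)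
    then have "(\<lambda>n. cinner (hat b) (hat (adj (r n)))) \<longlonglongrightarrow> cinner (bapp R \<zeta>) (hat (adj b))"
      using cinner.tendsto[OF r(2) tendsto_const, of "hat (adj b)"] by simp
    moreover have "(\<lambda>n. cinner (hat b) (hat (adj (r n)))) \<longlonglongrightarrow> cinner (hat b) v"
      by (intro cinner.tendsto tendsto_const v)
    ultimately have "cinner (hat b) v = cinner (bapp R \<zeta>) (hat (adj b))" using LIMSEQ_unique by blast
    also have "\<dots> = cinner \<zeta> (bapp (R * amp (adj b)) \<zeta>)"
      using R(3) cinner_adj_left[of R \<zeta>] by (simp add: hat_def)
    also have "\<dots> = cinner \<zeta> (bapp (amp (adj b)) (bapp R \<zeta>))"
      using R(4)[OF PD(4)[OF b(1)]] by (metis bapp_simps(6))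
    also have "\<dots> = cinner (hat b) (bapp R \<zeta>)" by (simp add: hat_def cinner_adj_right flip: adj_amp)
    finally show "cinner u v = cinner u (bapp R \<zeta>)" using b by simp
  qed
  with v have ra_lim: "(\<lambda>n. hat (adj (r n))) \<longlonglongrightarrow> bapp R \<zeta>" by simp
  have Rhat: "bapp R (hat x) = bapp (amp x) (bapp R \<zeta>)" if "x \<in> P" for x
    using R(4)[OF that] by (metis bapp_simps(6) hat_def)
  show ?thesis
  proof (rule compressed_eqI[OF PD(1) hat_linear proj_hat])
    show "p * (R * T) = R * T" "R * T * p = R * T" "p * (T * R) = T * R" "T * R * p = T * R"
      using R(1,2) T(1,2) by (metis mult.assoc)+
    fix a b assume a: "a \<in> P" and b: "b \<in> P"
    have 1: "(\<lambda>n. B (b * adj (r n) * adj a) 1) \<longlonglongrightarrow> cinner (hat b) (bapp T (bapp R (hat a)))"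
    proof -
      have "(\<lambda>n. cinner (hat b) (bapp T (bapp (amp a) (hat (r n))))) \<longlonglongrightarrow> cinner (hat b) (bapp T (bapp (amp a) (bapp R \<zeta>)))"
        by (intro cinner.tendsto tendsto_const tendsto_bapp r)
      moreover have "cinner (hat b) (bapp T (bapp (amp a) (hat (r n)))) = B (b * adj (r n) * adj a) 1" for n
        using tr[OF PD(3)[OF a r(1)[of n]] b] T(3)[OF PD(3)[OF a r(1)[of n]] b] by (simp add: amp_hat mult.assoc)
      ultimately show ?thesis by (simp add: Rhat a)
    qed
    have 2: "(\<lambda>n. B (b * adj (r n) * adj a) 1) \<longlonglongrightarrow> cinner (bapp R (hat b)) (bapp T (hat a))"
    proof -
      have "(\<lambda>n. cinner (bapp (amp b) (hat (adj (r n)))) (bapp T (hat a))) \<longlonglongrightarrow> cinner (bapp (amp b) (bapp R \<zeta>)) (bapp T (hat a))"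
        by (intro cinner.tendsto tendsto_const tendsto_bapp ra_lim)
      moreover have "cinner (bapp (amp b) (hat (adj (r n)))) (bapp T (hat a)) = B (b * adj (r n) * adj a) 1" for n
        using tr[OF a PD(3)[OF b ra[of n]]] T(3)[OF a PD(3)[OF b ra[of n]]] by (simp add: amp_hat mult.assoc)
      ultimately show ?thesis by (simp add: Rhat b)
    qed
    have "cinner (hat b) (bapp (R * T) (hat a)) = cinner (bapp R (hat b)) (bapp T (hat a))"
      using R(3) cinner_adj_left[of R "hat b"] by simp
    then show "cinner (hat b) (bapp (R * T) (hat a)) = cinner (hat b) (bapp (T * R) (hat a))"
      using LIMSEQ_unique[OF 1 2] by simp
  qed
qed

text \<open>The vectors \<open>u\<close> of the given space for which a \<zeta> \<mapsto> a u is a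
  bounded map. On them convergence of hat (s n) implies convergence of the operators
  \<open>s n\<close> themselves.\<close>

definition bounded_vectors :: "'a set" where
  "bounded_vectors = {u. \<exists>C\<ge>0. \<forall>a\<in>P. norm (bapp a u) \<le> C * norm (hat a)}"

lemma bounded_vectors_subspace: "complex_vector.subspace bounded_vectors"
proof (rule complex_vector.subspaceI)
  show "0 \<in> bounded_vectors" unfolding bounded_vectors_def by (auto intro: exI[of _ 0])
next
  fix u v assume "u \<in> bounded_vectors" "v \<in> bounded_vectors"
  then obtain C D where C: "C \<ge> 0" "\<And>a. a \<in> P \<Longrightarrow> norm (bapp a u) \<le> C * norm (hat a)"
    and D: "D \<ge> 0" "\<And>a. a \<in> P \<Longrightarrow> norm (bapp a v) \<le> D * norm (hat a)" unfolding bounded_vectors_def by blast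
  have "norm (bapp a (u + v)) \<le> (C + D) * norm (hat a)" if "a \<in> P" for a
    using norm_triangle_ineq[of "bapp a u" "bapp a v"] C(2)[OF that] D(2)[OF that]
    by (simp add: bapp_add distrib_right)
  then show "u + v \<in> bounded_vectors" unfolding bounded_vectors_def using C(1) D(1)
    by (auto intro!: exI[of _ "C + D"])
next
  fix c u assume "u \<in> bounded_vectors"
  then obtain C where C: "C \<ge> 0" "\<And>a. a \<in> P \<Longrightarrow> norm (bapp a u) \<le> C * norm (hat a)"
    unfolding bounded_vectors_def by blast
  have "norm (bapp a (c *\<^sub>C u)) \<le> (cmod c * C) * norm (hat a)" if "a \<in> P" for a
    using mult_left_mono[OF C(2)[OF that], of "cmod c"] by (simp add: bapp_scaleC norm_scaleC mult.assoc)
  then show "c *\<^sub>C u \<in> bounded_vectors" unfolding bounded_vectors_def using C(1)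
    by (auto intro!: exI[of _ "cmod c * C"])
qed

lemma bounded_vectors_commutant:
  assumes y: "y \<in> commutant P" and u: "u \<in> bounded_vectors"
  shows "bapp y u \<in> bounded_vectors"
proof -
  obtain C where C: "C \<ge> 0" "\<And>a. a \<in> P \<Longrightarrow> norm (bapp a u) \<le> C * norm (hat a)"
    using u unfolding bounded_vectors_def by blast
  obtain K where K: "K > 0" "\<And>x. norm (bapp y x) \<le> K * norm x" using bapp_bound by blast
  have "norm (bapp a (bapp y u)) \<le> (K * C) * norm (hat a)" if a: "a \<in> P" for a
  proof -
    have "bapp a (bapp y u) = bapp y (bapp a u)"
      using y a unfolding commutant_def by (metis (mono_tags, lifting) bapp_simps(6) mem_Collect_eq)
    then show ?thesis
      using order_trans[OF K(2)[of "bapp a u"] mult_left_mono[OF C(2)[OF a] less_imp_le[OF K(1)]]]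
      by (simp add: mult.assoc)
  qed
  then show ?thesis unfolding bounded_vectors_def using C(1) K(1) by (auto intro!: exI[of _ "K * C"])
qed

text \<open>The closure is invariant under the commutant of \<open>P\<close>, so its projection
  \<open>q\<close> belongs to \<open>P\<close>. Each coordinate of \<zeta> is bounded with constant
  1, hence (1 - q) \<zeta> = 0, and faithfulness of the trace gives q = 1.\<close>

lemma bounded_vectors_dense: "closure bounded_vectors = UNIV"
proof -
  note sc = subspace_closure[OF bounded_vectors_subspace]
  obtain q where q: "projection_onto (closure bounded_vectors) q"
    using projection_exists[OF sc] by auto
  have aP: "adj ` P \<subseteq> P" using vN unfolding von_neumann_algebra_def by blast
  have inv: "bapp y v \<in> closure bounded_vectors" if y: "y \<in> commutant P" and v: "v \<in> closure bounded_vectors" for y v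
  proof -
    obtain s where s: "\<And>n. s n \<in> bounded_vectors" "s \<longlonglongrightarrow> v" using closure_sequenceE[OF v] by blast
    show ?thesis by (rule closure_sequentialI[OF bounded_vectors_commutant[OF y s(1)] tendsto_bapp[OF s(2)]])
  qed
  have "q * y = y * q" if "y \<in> commutant P" for y
    by (rule projection_onto_commute[OF q sc]) (use inv that commutant_adj[OF aP that] in auto)
  then have "q \<in> commutant (commutant P)" unfolding commutant_def by blast
  then have qP: "q \<in> P" using vN unfolding von_neumann_algebra_def by blast
  have "l2_nth \<zeta> n \<in> bounded_vectors" for n
    unfolding bounded_vectors_def
    by (auto intro!: exI[of _ 1]) (metis hat_def l2_nth_amp l2_nth_norm_le)
  then have qfix: "bapp q (l2_nth \<zeta> n) = l2_nth \<zeta> n" for n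
    by (intro projection_onto_fixes[OF q sc]) (rule subsetD[OF closure_subset])
  have "hat (1 - q) = 0"
    unfolding hat_def by (rule l2_eqI) (simp add: qfix)
  then have "\<tau> (adj (1 - q) * (1 - q)) = 0"
    using cinner_hat[of "1 - q" "1 - q"] PD qP by simp
  then have "1 - q = 0" by (rule \<tau>_faithful[OF PD(6)[OF PD(2) qP]])
  then have "bapp q v = v" for v by simp
  then have "v \<in> closure bounded_vectors" for v using projection_onto_closure[OF q, of v] by simp
  then show ?thesis by blast
qed

text \<open>\<open>R\<close> is the absolute square of the map a \<zeta> \<mapsto> a u. It commutes
  with \<open>P\<close> because that map intertwines the two actions of \<open>P\<close>.\<close>

lemma bounded_vector_operator:
  assumes u: "u \<in> bounded_vectors"
  obtains R where "p * R = R" "R * p = R" "selfadj_nonneg R" "\<And>z. z \<in> P \<Longrightarrow> amp z * R = R * amp z"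
    "\<And>x y. x \<in> P \<Longrightarrow> y \<in> P \<Longrightarrow> cinner (hat y) (bapp R (hat x)) = cinner (bapp y u) (bapp x u)"
proof -
  obtain C where C: "C \<ge> 0" "\<And>a. a \<in> P \<Longrightarrow> norm (bapp a u) \<le> C * norm (hat a)"
    using u unfolding bounded_vectors_def by blast
  obtain R where R: "\<And>x y. x \<in> P \<Longrightarrow> y \<in> P \<Longrightarrow> cinner (hat y) (bapp R (hat x)) = cinner (bapp y u) (bapp x u)"
    "p * R = R" "R * p = R"
  proof (rule bounded_form_compressed[OF PD(1) hat_linear proj_hat, of "\<lambda>y x. cinner (bapp y u) (bapp x u)" "C * C"])
    show "functional_on P (\<lambda>x. cinner (bapp y u) (bapp x u))" for y
      unfolding functional_on_def by (simp add: cinner_add_right cinner_scaleC_right)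
    show "functional_on P (\<lambda>y. cnj (cinner (bapp y u) (bapp x u)))" for x
      unfolding functional_on_def by (simp add: cinner_add_left cinner_scaleC_left)
    show "cmod (cinner (bapp y u) (bapp x u)) \<le> C * C * norm (hat y) * norm (hat x)" if "x \<in> P" "y \<in> P" for x y
    proof -
      have "cmod (cinner (bapp y u) (bapp x u)) \<le> norm (bapp y u) * norm (bapp x u)" by (rule cmod_cinner_le)
      also have "\<dots> \<le> (C * norm (hat y)) * (C * norm (hat x))"
        by (intro mult_mono C that) (use C in auto)
      finally show ?thesis by (simp add: mult_ac)
    qed
  qed (use C in auto)
  show ?thesis
  proof (rule that[OF R(2,3) _ _ R(1)])
    show "selfadj_nonneg R"
    proof (rule compressed_selfadj_nonneg[OF PD(1) hat_linear proj_hat R(2,3)])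
      fix x assume x: "x \<in> P"
      show "0 \<le> Re (cinner (hat x) (bapp R (hat x)))" unfolding R(1)[OF x x] by (simp flip: norm_sq_cinner)
      fix y assume y: "y \<in> P"
      show "cinner (hat y) (bapp R (hat x)) = cnj (cinner (hat x) (bapp R (hat y)))"
        unfolding R(1)[OF x y] R(1)[OF y x] by (rule cinner_commute)
    qed
    fix z assume z: "z \<in> P"
    show "amp z * R = R * amp z"
    proof (rule compressed_eqI[OF PD(1) hat_linear proj_hat])
      show "p * (amp z * R) = amp z * R" "amp z * R * p = amp z * R"
        "p * (R * amp z) = R * amp z" "R * amp z * p = R * amp z"
        using R(2,3) p_amp[OF z] by (metis mult.assoc)+
      fix x y assume xy: "x \<in> P" "y \<in> P"
      have "cinner (hat y) (bapp (amp z * R) (hat x)) = cinner (hat (adj z * y)) (bapp R (hat x))"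
        by (simp add: amp_hat[symmetric] cinner_adj_left flip: adj_amp)
      also have "\<dots> = cinner (bapp y u) (bapp z (bapp x u))"
        using R(1)[of x "adj z * y"] xy z PD by (simp add: cinner_adj_left)
      also have "\<dots> = cinner (hat y) (bapp (R * amp z) (hat x))"
        using R(1)[of "z * x" y] xy z PD by (simp add: amp_hat)
      finally show "cinner (hat y) (bapp (amp z * R) (hat x)) = cinner (hat y) (bapp (R * amp z) (hat x))" .
    qed
  qed
qed

lemma left_multiplier:
  assumes B1: "\<And>y. y \<in> P \<Longrightarrow> functional_on P (B y)"
    and B2: "\<And>x. x \<in> P \<Longrightarrow> functional_on P (\<lambda>y. cnj (B y x))"
    and C: "C \<ge> 0" and bd: "\<And>x y. x \<in> P \<Longrightarrow> y \<in> P \<Longrightarrow> cmod (B y x) \<le> C * norm (hat y) * norm (hat x)"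
    and tr: "\<And>x y. x \<in> P \<Longrightarrow> y \<in> P \<Longrightarrow> B y x = B (y * adj x) 1"
  obtains m where "m \<in> P" "\<And>x y. x \<in> P \<Longrightarrow> y \<in> P \<Longrightarrow> B y x = \<tau> (adj y * m * x)"
proof -
  obtain T where T: "\<And>x y. x \<in> P \<Longrightarrow> y \<in> P \<Longrightarrow> cinner (hat y) (bapp T (hat x)) = B y x"
    "p * T = T" "T * p = T" "\<And>v. norm (bapp T v) \<le> C * norm v"
    using bounded_form_compressed[OF PD(1) hat_linear proj_hat B1 B2 C bd] by metis
  obtain s where s: "\<And>n. s n \<in> P" "(\<lambda>n. hat (s n)) \<longlonglongrightarrow> bapp T \<zeta>" using compressed_hat[OF T(2)] by blast
  \<comment> \<open>Convergence alone would not make the limit a bounded operator; the bound by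
    \<open>C\<close> is the point. With Q the square root of \<open>R\<close>, the squared norm of
    the limit is <T \<zeta>, R T \<zeta>> = ||Q T \<zeta>||^2 = ||T Q \<zeta>||^2, and ||Q \<zeta>||
    = ||u||. The exchange of \<open>Q\<close> and \<open>T\<close> rests on
    \<open>right_left_commute\<close>.\<close>
  have lim: "\<exists>l. (\<lambda>n. bapp (s n) u) \<longlonglongrightarrow> l \<and> norm l \<le> C * norm u" if u: "u \<in> bounded_vectors" for u
  proof -
    obtain D where D: "D \<ge> 0" "\<And>a. a \<in> P \<Longrightarrow> norm (bapp a u) \<le> D * norm (hat a)"
      using u unfolding bounded_vectors_def by blast
    obtain R where R: "p * R = R" "R * p = R" "selfadj_nonneg R" "\<And>z. z \<in> P \<Longrightarrow> amp z * R = R * amp z"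
      "\<And>x y. x \<in> P \<Longrightarrow> y \<in> P \<Longrightarrow> cinner (hat y) (bapp R (hat x)) = cinner (bapp y u) (bapp x u)"
      using bounded_vector_operator[OF u] by blast
    have "adj R = R" using R(3) unfolding selfadj_nonneg_def by blast
    then have RT: "T * R = R * T"
      using right_left_commute[OF R(1,2) _ R(4) T(2,3,1) tr] by simp
    obtain Q where Q: "adj Q = Q" "Q * Q = R" "\<And>T. T * R = R * T \<Longrightarrow> T * Q = Q * T"
      using selfadj_nonneg_sqrt[OF R(3)] by blast
    have Qn: "cinner v (bapp R v) = of_real ((norm (bapp Q v))\<^sup>2)" for v
      unfolding Q(2)[symmetric] using Q(1) by (metis bapp_simps(6) cinner_adj_left cinner_self)
    have nu: "norm (bapp Q \<zeta>) = norm u"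
    proof -
      have "(norm (bapp Q \<zeta>))\<^sup>2 = (norm u)\<^sup>2"
        using R(5)[OF PD(2) PD(2)] Qn[of \<zeta>] unfolding hat_1 cinner_self by (simp add: cinner_self flip: of_real_power)
      then show ?thesis by (simp add: power2_eq_iff_nonneg)
    qed
    have "Cauchy (\<lambda>n. hat (s n))" using s(2) by (rule LIMSEQ_imp_Cauchy)
    have "Cauchy (\<lambda>n. bapp (s n) u)"
    proof (rule metric_CauchyI)
      fix e :: real assume e: "0 < e"
      obtain M where M: "\<And>m n. m \<ge> M \<Longrightarrow> n \<ge> M \<Longrightarrow> dist (hat (s m)) (hat (s n)) < e / (D + 1)"
        using metric_CauchyD[OF \<open>Cauchy (\<lambda>n. hat (s n))\<close>, of "e / (D + 1)"] e D(1) by auto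
      have "dist (bapp (s m) u) (bapp (s n) u) < e" if "m \<ge> M" "n \<ge> M" for m n
      proof -
        have "dist (bapp (s m) u) (bapp (s n) u) \<le> D * norm (hat (s m) - hat (s n))"
          using D(2)[OF PD(6)[OF s(1)[of m] s(1)[of n]]] by (simp add: dist_norm hat_diff)
        also have "\<dots> \<le> (D + 1) * dist (hat (s m)) (hat (s n))" by (simp add: dist_norm distrib_right)
        also have "\<dots> < e" using M[OF that] D(1) by (simp add: pos_less_divide_eq mult.commute)
        finally show ?thesis .
      qed
      then show "\<exists>M. \<forall>m\<ge>M. \<forall>n\<ge>M. dist (bapp (s m) u) (bapp (s n) u) < e" by blast
    qed
    then obtain l where l: "(\<lambda>n. bapp (s n) u) \<longlonglongrightarrow> l" using Cauchy_convergent convergent_def by blast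
    have "(\<lambda>n. cinner (hat (s n)) (bapp R (hat (s n)))) \<longlonglongrightarrow> cinner (bapp T \<zeta>) (bapp R (bapp T \<zeta>))"
      by (intro cinner.tendsto tendsto_bapp s)
    moreover have "cinner (hat (s n)) (bapp R (hat (s n))) = cinner (bapp (s n) u) (bapp (s n) u)" for n
      by (rule R(5)[OF s(1) s(1)])
    ultimately have "(\<lambda>n. cinner (bapp (s n) u) (bapp (s n) u)) \<longlonglongrightarrow> cinner (bapp T \<zeta>) (bapp R (bapp T \<zeta>))" by simp
    moreover have "(\<lambda>n. cinner (bapp (s n) u) (bapp (s n) u)) \<longlonglongrightarrow> cinner l l" by (intro cinner.tendsto l)
    ultimately have "cinner l l = cinner (bapp T \<zeta>) (bapp R (bapp T \<zeta>))" using LIMSEQ_unique by blast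
    also have "\<dots> = of_real ((norm (bapp Q (bapp T \<zeta>)))\<^sup>2)" by (rule Qn)
    also have "bapp Q (bapp T \<zeta>) = bapp T (bapp Q \<zeta>)" using Q(3)[OF RT] by (metis bapp_simps(6))
    finally have "(norm l)\<^sup>2 = (norm (bapp T (bapp Q \<zeta>)))\<^sup>2" unfolding cinner_self of_real_eq_iff .
    then have "norm l = norm (bapp T (bapp Q \<zeta>))" by (simp add: power2_eq_iff_nonneg)
    also have "\<dots> \<le> C * norm u" using T(4)[of "bapp Q \<zeta>"] nu by simp
    finally show ?thesis using l by blast
  qed
  then obtain f where f: "\<And>u. u \<in> bounded_vectors \<Longrightarrow> (\<lambda>n. bapp (s n) u) \<longlonglongrightarrow> f u"
    "\<And>u. u \<in> bounded_vectors \<Longrightarrow> norm (f u) \<le> C * norm u" by metis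
  have fadd: "f (u + v) = f u + f v" if u: "u \<in> bounded_vectors" and v: "v \<in> bounded_vectors" for u v
  proof -
    have "(\<lambda>n. bapp (s n) (u + v)) \<longlonglongrightarrow> f u + f v" unfolding bapp_add by (intro tendsto_add f u v)
    moreover have "(\<lambda>n. bapp (s n) (u + v)) \<longlonglongrightarrow> f (u + v)"
      by (intro f complex_vector.subspace_add[OF bounded_vectors_subspace] u v)
    ultimately show ?thesis using LIMSEQ_unique by blast
  qed
  have fsc: "f (c *\<^sub>C u) = c *\<^sub>C f u" if u: "u \<in> bounded_vectors" for u c
  proof -
    have "(\<lambda>n. bapp (s n) (c *\<^sub>C u)) \<longlonglongrightarrow> c *\<^sub>C f u" unfolding bapp_scaleC by (intro tendsto_scaleC f u)
    moreover have "(\<lambda>n. bapp (s n) (c *\<^sub>C u)) \<longlonglongrightarrow> f (c *\<^sub>C u)"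
      by (intro f complex_vector.subspace_scale[OF bounded_vectors_subspace] u)
    ultimately show ?thesis using LIMSEQ_unique by blast
  qed
  obtain m where m: "\<And>x y. x \<in> bounded_vectors \<Longrightarrow> y \<in> bounded_vectors \<Longrightarrow> cinner y (bapp m x) = cinner y (f x)"
  proof (rule bounded_form_bop[OF bounded_vectors_subspace, of "\<lambda>x. x" "\<lambda>y x. cinner y (f x)" C])
    show "functional_on bounded_vectors (\<lambda>x. cinner y (f x))" for y
      unfolding functional_on_def by (simp add: fadd fsc cinner_add_right cinner_scaleC_right)
    show "functional_on bounded_vectors (\<lambda>y. cnj (cinner y (f x)))" for x
      unfolding functional_on_def by (simp add: cinner_add_left cinner_scaleC_left)
    show "cmod (cinner y (f x)) \<le> C * norm y * norm x" if "x \<in> bounded_vectors" for x y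
      using cmod_cinner_le[of y "f x"] mult_left_mono[OF f(2)[OF that], of "norm y"] by (simp add: mult_ac)
  qed (use C in \<open>auto simp: linear_map_on_def\<close>)
  have mf: "bapp m x = f x" if "x \<in> bounded_vectors" for x
    by (rule eq_if_cinner_closure[of bounded_vectors]) (use m that bounded_vectors_dense in auto)
  have mP: "m \<in> P"
  proof -
    have "m * y = y * m" if y: "y \<in> commutant P" for y
    proof (rule bop_eqI)
      fix v
      have "bapp (m * y) v = bapp (y * m) v" if v: "v \<in> bounded_vectors" for v
      proof -
        have sy: "bapp (s n) (bapp y v) = bapp y (bapp (s n) v)" for n
          using y s(1)[of n] unfolding commutant_def by (metis (mono_tags, lifting) bapp_simps(6) mem_Collect_eq)
        have "(\<lambda>n. bapp (s n) (bapp y v)) \<longlonglongrightarrow> f (bapp y v)" by (intro f bounded_vectors_commutant y v)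
        moreover have "(\<lambda>n. bapp (s n) (bapp y v)) \<longlonglongrightarrow> bapp y (f v)"
          unfolding sy by (intro tendsto_bapp f v)
        ultimately have "f (bapp y v) = bapp y (f v)" using LIMSEQ_unique by blast
        then show ?thesis by (simp add: mf v bounded_vectors_commutant y)
      qed
      then show "bapp (m * y) v = bapp (y * m) v"
        by (rule bop_eqI_closure[of bounded_vectors]) (simp_all add: bounded_vectors_dense)
    qed
    then have "m \<in> commutant (commutant P)" unfolding commutant_def by blast
    then show ?thesis using vN unfolding von_neumann_algebra_def by blast
  qed
  \<comment> \<open>The coordinates of \<zeta> are bounded vectors, so \<open>m\<close> is computed
    on them as the limit of \<open>s n\<close>.\<close>
  have "hat m = bapp T \<zeta>"
  proof (rule l2_eqI)
    fix k
    have z: "l2_nth \<zeta> k \<in> bounded_vectors"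
      unfolding bounded_vectors_def
      by (auto intro!: exI[of _ 1]) (metis hat_def l2_nth_amp l2_nth_norm_le)
    have "(\<lambda>n. bapp (s n) (l2_nth \<zeta> k)) \<longlonglongrightarrow> l2_nth (bapp T \<zeta>) k"
      using tendsto_l2_nth[OF s(2), of k] by (simp add: hat_def)
    then have "l2_nth (bapp T \<zeta>) k = f (l2_nth \<zeta> k)" using f(1)[OF z] LIMSEQ_unique by blast
    then show "l2_nth (hat m) k = l2_nth (bapp T \<zeta>) k" by (simp add: hat_def mf[OF z])
  qed
  then have "B y x = \<tau> (adj y * m * x)" if xy: "x \<in> P" "y \<in> P" for x y
  proof -
    have "B y x = cinner (hat (y * adj x)) (bapp T (hat 1))"
      using tr[OF xy] T(1)[of 1 "y * adj x"] PD xy by simp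
    also have "\<dots> = \<tau> (adj (y * adj x) * m)"
      unfolding hat_1 \<open>hat m = bapp T \<zeta>\<close>[symmetric] by (rule cinner_hat) (use mP xy PD in auto)
    also have "\<dots> = \<tau> (x * (adj y * m))" by (simp add: mult.assoc)
    also have "\<dots> = \<tau> (adj y * m * x)" by (rule \<tau>_commute) (use mP xy PD in auto)
    finally show ?thesis .
  qed
  then show ?thesis using that mP by blast
qed

end

lemma traced_algebra_exists:
  fixes P :: "'a::chilbert_space bop set"
  assumes vN: "von_neumann_algebra P" and \<tau>: "faithful_normal_trace P \<tau>"
  obtains \<zeta> p where "traced_algebra P \<tau> \<zeta> p"
proof -
  have P: "star_algebra P" by (rule von_neumann_algebra_star_algebra[OF vN])
  obtain \<zeta> where \<zeta>: "\<And>x. x \<in> P \<Longrightarrow> \<tau> x = cinner \<zeta> (bapp (amp x) \<zeta>)"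
    using normal_positive_functional_vector[OF P, of \<tau>] \<tau> unfolding faithful_normal_trace_def by metis
  have "complex_vector.subspace (closure ((\<lambda>x. bapp (amp x) \<zeta>) ` P))"
    by (intro subspace_closure subspace_image star_algebraD[OF P]) (simp add: linear_map_on_def)
  then obtain p where "projection_onto (closure ((\<lambda>x. bapp (amp x) \<zeta>) ` P)) p"
    using projection_exists closed_closure by blast
  then have "traced_algebra P \<tau> \<zeta> p" using vN \<tau> \<zeta> by unfold_locales
  then show ?thesis using that by blast
qed

lemma left_multiplier_exists:
  fixes P :: "'a::chilbert_space bop set"
  assumes vN: "von_neumann_algebra P" and \<tau>: "faithful_normal_trace P \<tau>"
    and B1: "\<And>y. y \<in> P \<Longrightarrow> functional_on P (B y)"
    and B2: "\<And>x. x \<in> P \<Longrightarrow> functional_on P (\<lambda>y. cnj (B y x))"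
    and C: "C \<ge> 0"
    and bd: "\<And>x y. x \<in> P \<Longrightarrow> y \<in> P \<Longrightarrow>
      (cmod (B y x))\<^sup>2 \<le> C\<^sup>2 * Re (\<tau> (adj y * y)) * Re (\<tau> (adj x * x))"
    and tr: "\<And>x y. x \<in> P \<Longrightarrow> y \<in> P \<Longrightarrow> B y x = B (y * adj x) 1"
  obtains m where "m \<in> P" "\<And>x y. x \<in> P \<Longrightarrow> y \<in> P \<Longrightarrow> B y x = \<tau> (adj y * m * x)"
proof -
  obtain \<zeta> p where "traced_algebra P \<tau> \<zeta> p" using traced_algebra_exists[OF vN \<tau>] .
  then interpret traced_algebra P \<tau> \<zeta> p .
  show ?thesis
  proof (rule left_multiplier[OF B1 B2 C _ tr that])
    fix x y assume "x \<in> P" "y \<in> P"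
    then have "(cmod (B y x))\<^sup>2 \<le> (C * norm (hat y) * norm (hat x))\<^sup>2"
      using bd by (simp add: power_mult_distrib norm_hat_sq)
    then show "cmod (B y x) \<le> C * norm (hat y) * norm (hat x)" by (rule power2_le_imp_le) (use C in simp)
  qed auto
qed

lemma trace_eqI:
  assumes P: "star_algebra P" and \<tau>: "faithful_normal_trace P \<tau>" and x: "x \<in> P" and y: "y \<in> P"
    and eq: "\<And>z. z \<in> P \<Longrightarrow> \<tau> (adj z * x) = \<tau> (adj z * y)"
  shows "x = y"
proof -
  have d: "x - y \<in> P" using star_algebraD(6)[OF P x y] .
  have f: "functional_on P \<tau>" using \<tau> unfolding faithful_normal_trace_def positive_functional_def by blast
  have "\<tau> (adj (x - y) * x - adj (x - y) * y) = 0"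
    using functional_on_diff[OF star_algebraD(1)[OF P] f] eq[OF d] star_algebraD[OF P] x y d by simp
  then have "\<tau> (adj (x - y) * (x - y)) = 0" by (simp add: right_diff_distrib)
  then have "x - y = 0" using \<tau> d unfolding faithful_normal_trace_def by blast
  then show ?thesis by simp
qed

text \<open>A Radon-Nikodym argument: domination gives \<psi> = \<tau> (m * _) with \<open>m\<close>
  in \<open>P\<close>, and the trace property of both sides makes \<open>m\<close> central, hence a
  scalar.\<close>

lemma factor_trace_unique:
  fixes P :: "'a::chilbert_space bop set"
  assumes P: "factor P" and \<tau>: "faithful_normal_trace P \<tau>" and \<psi>: "positive_functional P \<psi>"
    and \<psi>tr: "\<And>x y. x \<in> P \<Longrightarrow> y \<in> P \<Longrightarrow> \<psi> (x * y) = \<psi> (y * x)"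
    and le: "\<And>x. x \<in> P \<Longrightarrow> Re (\<psi> (adj x * x)) \<le> C * Re (\<tau> (adj x * x))" and C: "C \<ge> 0" and x: "x \<in> P"
  shows "\<psi> x * \<tau> 1 = \<psi> 1 * \<tau> x"
proof -
  have vN: "von_neumann_algebra P" using P unfolding factor_def by blast
  have sP: "star_algebra P" by (rule von_neumann_algebra_star_algebra[OF vN])
  note PD = star_algebraD[OF sP]
  have f\<psi>: "functional_on P \<psi>" and f\<tau>: "functional_on P \<tau>"
    using \<psi> \<tau> unfolding positive_functional_def faithful_normal_trace_def by auto
  have \<tau>tr: "\<tau> (a * b) = \<tau> (b * a)" if "a \<in> P" "b \<in> P" for a b
    using \<tau> that unfolding faithful_normal_trace_def by blast
  obtain m where m: "m \<in> P" "\<And>x y. x \<in> P \<Longrightarrow> y \<in> P \<Longrightarrow> \<psi> (adj y * x) = \<tau> (adj y * m * x)"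
  proof (rule left_multiplier_exists[OF vN \<tau> functional_on_form[OF sP f\<psi>] C])
    fix x y assume xy: "x \<in> P" "y \<in> P"
    have "(cmod (\<psi> (adj y * x)))\<^sup>2 \<le> Re (\<psi> (adj y * y)) * Re (\<psi> (adj x * x))"
      by (rule positive_functional_Cauchy_Schwarz(1)[OF sP \<psi> xy])
    also have "\<dots> \<le> (C * Re (\<tau> (adj y * y))) * (C * Re (\<tau> (adj x * x)))"
      by (intro mult_mono le xy mult_nonneg_nonneg C positive_functional_Cauchy_Schwarz(4)[OF sP \<psi> xy(1) xy(1)])
        (use positive_functional_Cauchy_Schwarz(4)[OF sP _ xy(2) xy(2)] \<tau> in \<open>auto simp: faithful_normal_trace_def\<close>)
    finally show "(cmod (\<psi> (adj y * x)))\<^sup>2 \<le> C\<^sup>2 * Re (\<tau> (adj y * y)) * Re (\<tau> (adj x * x))"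
      by (simp add: power2_eq_square mult_ac)
    show "\<psi> (adj y * x) = \<psi> (adj (y * adj x) * 1)"
      using \<psi>tr[of "adj y" x] xy PD by simp
  qed auto
  have \<psi>m: "\<psi> x = \<tau> (m * x)" if "x \<in> P" for x using m(2)[OF that PD(2)] by simp
  have "m * a = a * m" if a: "a \<in> P" for a
  proof (rule trace_eqI[OF sP \<tau>])
    fix z assume z: "z \<in> P"
    have "\<tau> (adj z * (m * a)) = \<tau> (m * (a * adj z))"
      using \<tau>tr[of "adj z" "m * a"] z a m PD by (simp add: mult.assoc)
    also have "\<dots> = \<psi> (a * adj z)" using \<psi>m[of "a * adj z"] z a PD by simp
    also have "\<dots> = \<psi> (adj z * a)" using \<psi>tr z a PD by simp
    also have "\<dots> = \<tau> (m * adj z * a)" using \<psi>m[of "adj z * a"] z a PD by (simp add: mult.assoc)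
    also have "\<dots> = \<tau> (adj z * (a * m))"
      using \<tau>tr[of m "adj z * a"] z a m PD by (simp add: mult.assoc)
    finally show "\<tau> (adj z * (m * a)) = \<tau> (adj z * (a * m))" .
  qed (use a m PD in auto)
  then have "m \<in> rel_commutant P P" using m(1) unfolding rel_commutant_def commutant_def by blast
  then obtain c where c: "m = c *\<^sub>C 1" using P unfolding factor_def by blast
  have "\<psi> x = c * \<tau> x" if "x \<in> P" for x
    using \<psi>m[OF that] functional_on_add_scale(2)[OF f\<tau> that that] by (simp add: c scaleC_mult_left)
  then show ?thesis using x PD(2) by simp
qed

section \<open>Standard representations\<close>

text \<open>For \<open>q\<close> the projection onto the closed space K generated by the vectors z
  u, the vector z (u - q u) lies in K and is orthogonal to K for each \<open>z\<close> in
  \<open>I\<close>; nondegeneracy then gives u = q u.\<close>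

lemma nondegenerate_ideal_closure:
  fixes I :: "'a::chilbert_space bop set"
  assumes I: "complex_vector.subspace I" "\<And>x y. x \<in> I \<Longrightarrow> y \<in> I \<Longrightarrow> x * y \<in> I" "\<And>x. x \<in> I \<Longrightarrow> adj x \<in> I"
    and nd: "\<And>v. (\<And>z. z \<in> I \<Longrightarrow> bapp z v = 0) \<Longrightarrow> v = 0"
  shows "u \<in> closure ((\<lambda>z. bapp z u) ` I)"
proof -
  define K where "K = closure ((\<lambda>z. bapp z u) ` I)"
  have K: "complex_vector.subspace K" "closed K"
    unfolding K_def by (auto intro!: subspace_closure subspace_image I linear_map_on_bapp_vec)
  obtain q where q: "projection_onto K q" using projection_exists[OF K] .
  have inv: "bapp z v \<in> K" if z: "z \<in> I" and v: "v \<in> K" for z v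
  proof -
    obtain s where s: "\<And>n. s n \<in> I" "(\<lambda>n. bapp (s n) u) \<longlonglongrightarrow> v"
      using closure_image_sequenceE[OF v[unfolded K_def]] by blast
    have "(\<lambda>n. bapp (z * s n) u) \<longlonglongrightarrow> bapp z v" using tendsto_bapp[OF s(2), of z] by simp
    moreover have "bapp (z * s n) u \<in> (\<lambda>z. bapp z u) ` I" for n using I(2)[OF z s(1)] by blast
    ultimately show ?thesis unfolding K_def by (intro closure_sequentialI[of "\<lambda>n. bapp (z * s n) u"])
  qed
  have "u - bapp q u = 0"
  proof (rule nd)
    fix z assume z: "z \<in> I"
    define w where "w = bapp z (u - bapp q u)"
    have "bapp z u \<in> K" unfolding K_def using z by (intro subsetD[OF closure_subset]) blast
    then have wK: "w \<in> K"
      using inv[OF z projection_onto_closure[OF q]] K(1) by (simp add: w_def bapp_diff complex_vector.subspace_diff)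
    have "cinner w w = cinner (bapp (adj z) w) (u - bapp q u)" by (simp add: w_def cinner_adj_left)
    also have "\<dots> = 0" using q inv[OF I(3)[OF z] wK] unfolding projection_onto_def by blast
    finally show "bapp z (u - bapp q u) = 0" by (simp add: cinner_self_eq_0 w_def)
  qed
  then show ?thesis using projection_onto_closure[OF q, of u] unfolding K_def by simp
qed

lemma eq_on_dense:
  fixes S T :: "'a::chilbert_space bop"
  assumes "closure X = UNIV" "\<And>x. x \<in> X \<Longrightarrow> bapp S x = bapp T x" shows "S = T"
  by (rule bop_eqI, rule bop_eqI_closure[of X]) (use assms in auto)

locale std_rep =
  fixes M :: "'h::chilbert_space bop set" and \<tau> :: "'h bop \<Rightarrow> complex"
    and \<pi> :: "'h bop \<Rightarrow> 'k::chilbert_space bop" and \<Omega> :: 'k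
  assumes M: "star_algebra M" and trace: "faithful_normal_trace M \<tau>" and std: "standard_rep \<tau> M \<pi> \<Omega>"
begin

lemmas MD = star_algebraD[OF M]

definition hat where "hat x = bapp (\<pi> x) \<Omega>"

lemma \<tau>_commute: "x \<in> M \<Longrightarrow> y \<in> M \<Longrightarrow> \<tau> (x * y) = \<tau> (y * x)"
  using trace unfolding faithful_normal_trace_def by blast

lemma hom: "star_hom_on M \<pi>"
  using std unfolding standard_rep_def by blast

lemma \<pi>_mult: "x \<in> M \<Longrightarrow> y \<in> M \<Longrightarrow> \<pi> (x * y) = \<pi> x * \<pi> y" and \<pi>_1: "\<pi> 1 = 1"
  and \<pi>_adj: "x \<in> M \<Longrightarrow> \<pi> (adj x) = adj (\<pi> x)" and \<pi>_linear: "linear_map_on M \<pi>"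
  using hom unfolding star_hom_on_def by auto

lemma hat_1: "hat 1 = \<Omega>"
  by (simp add: hat_def \<pi>_1)

lemma hat_linear: "linear_map_on M hat"
  using \<pi>_linear unfolding hat_def linear_map_on_def by simp

lemma \<pi>_hat: "x \<in> M \<Longrightarrow> y \<in> M \<Longrightarrow> bapp (\<pi> x) (hat y) = hat (x * y)"
  by (simp add: hat_def \<pi>_mult)

lemma cinner_hat: "x \<in> M \<Longrightarrow> y \<in> M \<Longrightarrow> cinner (hat y) (hat x) = \<tau> (adj y * x)"
proof -
  assume x: "x \<in> M" and y: "y \<in> M"
  have "\<tau> (adj y * x) = cinner \<Omega> (bapp (\<pi> (adj y * x)) \<Omega>)"
    using std x y MD unfolding standard_rep_def by simp
  then show ?thesis using x y MD by (simp add: hat_def \<pi>_mult \<pi>_adj cinner_adj_right)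
qed

lemma norm_hat_sq: "x \<in> M \<Longrightarrow> (norm (hat x))\<^sup>2 = Re (\<tau> (adj x * x))"
  by (simp add: norm_sq_cinner cinner_hat)

lemma norm_hat_adj: "x \<in> M \<Longrightarrow> norm (hat (adj x)) = norm (hat x)"
proof -
  assume x: "x \<in> M"
  have "(norm (hat (adj x)))\<^sup>2 = (norm (hat x))\<^sup>2"
    using norm_hat_sq[OF x] norm_hat_sq[of "adj x"] \<tau>_commute[of x "adj x"] x MD(4) by simp
  then show ?thesis by (simp add: power2_eq_iff_nonneg)
qed

lemma dense: "closure (hat ` M) = UNIV"
proof -
  have "closure ((\<lambda>x. bapp x \<Omega>) ` \<pi> ` M) = UNIV" using std unfolding standard_rep_def orbit_closure_def by blast
  then show ?thesis by (simp add: image_image hat_def)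
qed

lemma cinner_hat_eqI: "(\<And>x. x \<in> M \<Longrightarrow> cinner (hat x) u = cinner (hat x) v) \<Longrightarrow> u = v"
  by (rule eq_if_cinner_closure[of "hat ` M"]) (auto simp: dense)

lemma \<pi>_inj: "inj_on \<pi> M"
proof (rule inj_onI)
  fix x y assume xy: "x \<in> M" "y \<in> M" "\<pi> x = \<pi> y"
  have "hat (x - y) = 0"
    using linear_map_on_diff[OF MD(1) hat_linear xy(1,2)] xy(3) by (simp add: hat_def)
  then have "\<tau> (adj (x - y) * (x - y)) = 0" using cinner_hat[of "x - y" "x - y"] xy MD by simp
  then have "x - y = 0" using trace MD(6)[OF xy(1,2)] unfolding faithful_normal_trace_def by blast
  then show "x = y" by simp
qed

text \<open>Since \<tau> is a trace, taking adjoints preserves the norm of \<open>hat\<close>. Thus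
  right multiplication by \<open>a\<close> has the same bound as left multiplication by
  \<open>adj a\<close>.\<close>

lemma right_mult_exists:
  assumes a: "a \<in> M"
  shows "\<exists>T. \<forall>x\<in>M. bapp T (hat x) = hat (x * a)"
proof -
  obtain K where K: "K > 0" "\<And>x. norm (bapp (\<pi> (adj a)) x) \<le> K * norm x" using bapp_bound by blast
  have bd: "norm (hat (x * a)) \<le> K * norm (hat x)" if x: "x \<in> M" for x
  proof -
    have "norm (hat (x * a)) = norm (hat (adj a * adj x))" using norm_hat_adj[of "x * a"] x a MD by simp
    also have "\<dots> \<le> K * norm (hat (adj x))" using K(2)[of "hat (adj x)"] x a MD by (simp add: \<pi>_hat)
    finally show ?thesis using norm_hat_adj[OF x] by simp
  qed
  have lin: "hat ((x + y) * a) = hat (x * a) + hat (y * a)" "hat (c *\<^sub>C x * a) = c *\<^sub>C hat (x * a)"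
    if "x \<in> M" "y \<in> M" for x y c
    using hat_linear that a MD unfolding linear_map_on_def by (auto simp: distrib_right scaleC_mult_left)
  have lin': "hat (x + y) = hat x + hat y" "hat (c *\<^sub>C x) = c *\<^sub>C hat x" if "x \<in> M" "y \<in> M" for x y c
    using hat_linear that unfolding linear_map_on_def by auto
  obtain T where T: "\<And>x y. x \<in> M \<Longrightarrow> y \<in> M \<Longrightarrow> cinner (hat y) (bapp T (hat x)) = cinner (hat y) (hat (x * a))"
  proof (rule bounded_form_bop[OF MD(1) hat_linear, of "\<lambda>y x. cinner (hat y) (hat (x * a))" K])
    show "functional_on M (\<lambda>x. cinner (hat y) (hat (x * a)))" for y
      unfolding functional_on_def by (simp add: lin cinner_add_right cinner_scaleC_right)
    show "functional_on M (\<lambda>y. cnj (cinner (hat y) (hat (x * a))))" for x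
      unfolding functional_on_def by (simp add: lin' cinner_add_left cinner_scaleC_left)
    show "cmod (cinner (hat y) (hat (x * a))) \<le> K * norm (hat y) * norm (hat x)" if "x \<in> M" for x y
      using cmod_cinner_le[of "hat y" "hat (x * a)"] mult_left_mono[OF bd[OF that], of "norm (hat y)"]
      by (simp add: mult_ac)
  qed (use K in auto)
  then have "bapp T (hat x) = hat (x * a)" if "x \<in> M" for x using that by (intro cinner_hat_eqI) auto
  then show ?thesis by blast
qed

definition rmult where "rmult a = (SOME T. \<forall>x\<in>M. bapp T (hat x) = hat (x * a))"

lemma rmult_hat: "a \<in> M \<Longrightarrow> x \<in> M \<Longrightarrow> bapp (rmult a) (hat x) = hat (x * a)"
  using someI_ex[OF right_mult_exists] unfolding rmult_def by blast

lemma rmult_adj: "a \<in> M \<Longrightarrow> adj (rmult a) = rmult (adj a)"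
proof (rule eq_on_dense[OF dense])
  fix v assume a: "a \<in> M" and "v \<in> hat ` M"
  then obtain x where x: "x \<in> M" "v = hat x" by blast
  show "bapp (adj (rmult a)) v = bapp (rmult (adj a)) v"
  proof (rule cinner_hat_eqI)
    fix y assume y: "y \<in> M"
    have "cinner (hat y) (bapp (adj (rmult a)) v) = cinner (hat (y * a)) (hat x)"
      using rmult_hat[OF a y] x by (simp add: cinner_adj_right)
    also have "\<dots> = \<tau> (adj a * (adj y * x))" using x y a MD by (simp add: cinner_hat mult.assoc)
    also have "\<dots> = \<tau> (adj y * x * adj a)" by (rule \<tau>_commute) (use x y a MD in auto)
    also have "\<dots> = cinner (hat y) (bapp (rmult (adj a)) v)"
      using x y a MD by (simp add: rmult_hat cinner_hat mult.assoc)
    finally show "cinner (hat y) (bapp (adj (rmult a)) v) = cinner (hat y) (bapp (rmult (adj a)) v)" .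
  qed
qed

lemma rmult_commute: "a \<in> M \<Longrightarrow> x \<in> M \<Longrightarrow> rmult a * \<pi> x = \<pi> x * rmult a"
  by (rule eq_on_dense[OF dense]) (auto simp: rmult_hat \<pi>_hat MD mult.assoc)

lemma rmult_commutant: "a \<in> M \<Longrightarrow> rmult a \<in> commutant (\<pi> ` M)"
  unfolding commutant_def by (auto simp: rmult_commute)

text \<open>\<open>Q\<close> is the algebra of the right multiplications with which \<open>T\<close> is required to commute.\<close>

lemma left_multiplier_of_operator:
  assumes Q: "von_neumann_algebra Q" "Q \<subseteq> M" and T: "\<And>a. a \<in> Q \<Longrightarrow> rmult a * T = T * rmult a"
  obtains m where "m \<in> Q" "\<And>x y. x \<in> Q \<Longrightarrow> y \<in> Q \<Longrightarrow> cinner (hat y) (bapp T (hat x)) = \<tau> (adj y * m * x)"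
proof -
  note QD = star_algebraD[OF von_neumann_algebra_star_algebra[OF Q(1)]]
  obtain K where K: "K > 0" "\<And>x. norm (bapp T x) \<le> K * norm x" using bapp_bound by blast
  have lin': "hat (x + y) = hat x + hat y" "hat (c *\<^sub>C x) = c *\<^sub>C hat x" if "x \<in> Q" "y \<in> Q" for x y c
    using hat_linear Q(2)[THEN subsetD, OF that(1)] Q(2)[THEN subsetD, OF that(2)]
    unfolding linear_map_on_def by auto
  show ?thesis
  proof (rule left_multiplier_exists[OF Q(1) faithful_normal_trace_mono[OF trace Q(2)],
        of "\<lambda>y x. cinner (hat y) (bapp T (hat x))" K])
    show "functional_on Q (\<lambda>x. cinner (hat y) (bapp T (hat x)))" for y
      unfolding functional_on_def by (simp add: lin' bapp_add bapp_scaleC cinner_add_right cinner_scaleC_right)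
    show "functional_on Q (\<lambda>y. cnj (cinner (hat y) (bapp T (hat x))))" for x
      unfolding functional_on_def by (simp add: lin' cinner_add_left cinner_scaleC_left)
    fix x y assume xy: "x \<in> Q" "y \<in> Q"
    then have xy': "x \<in> M" "y \<in> M" using Q(2) by auto
    have "cmod (cinner (hat y) (bapp T (hat x))) \<le> norm (hat y) * norm (bapp T (hat x))" by (rule cmod_cinner_le)
    also have "\<dots> \<le> norm (hat y) * (K * norm (hat x))" by (intro mult_left_mono K) simp
    finally have "(cmod (cinner (hat y) (bapp T (hat x))))\<^sup>2 \<le> (norm (hat y) * (K * norm (hat x)))\<^sup>2"
      by (intro power_mono) auto
    then show "(cmod (cinner (hat y) (bapp T (hat x))))\<^sup>2 \<le> K\<^sup>2 * Re (\<tau> (adj y * y)) * Re (\<tau> (adj x * x))"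
      using xy' by (simp add: power_mult_distrib norm_hat_sq mult_ac)
    have "cinner (hat (y * adj x)) (bapp T (hat 1)) = cinner (bapp (rmult (adj x)) (hat y)) (bapp T (hat 1))"
      using xy' MD by (simp add: rmult_hat)
    also have "\<dots> = cinner (hat y) (bapp (rmult x * T) (hat 1))"
      using rmult_adj[of "adj x"] xy' MD cinner_adj_left[of "rmult x"] by (metis adj_simps(1) bapp_simps(6) cinner_adj_right)
    also have "\<dots> = cinner (hat y) (bapp T (bapp (rmult x) (hat 1)))" using T[OF xy(1)] by simp
    also have "\<dots> = cinner (hat y) (bapp T (hat x))" using xy' MD by (simp add: rmult_hat)
    finally show "cinner (hat y) (bapp T (hat x)) = cinner (hat (y * adj x)) (bapp T (hat 1))" ..
  qed (use K that in auto)
qed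

text \<open>An element of the bicommutant commutes with all right multiplications and is therefore a
  left multiplication. No continuity argument for \<pi> is needed to see that its image is again a
  von Neumann algebra.\<close>

lemma image_von_neumann_algebra:
  assumes vN: "von_neumann_algebra M"
  shows "von_neumann_algebra (\<pi> ` M)"
  unfolding von_neumann_algebra_def
proof
  show "adj ` \<pi> ` M \<subseteq> \<pi> ` M" using MD(4) by (auto simp flip: \<pi>_adj)
  show "commutant (commutant (\<pi> ` M)) = \<pi> ` M"
  proof
    show "\<pi> ` M \<subseteq> commutant (commutant (\<pi> ` M))" unfolding commutant_def by auto
    show "commutant (commutant (\<pi> ` M)) \<subseteq> \<pi> ` M"
    proof
      fix T assume T: "T \<in> commutant (commutant (\<pi> ` M))"
      have "rmult a * T = T * rmult a" if "a \<in> M" for a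
        using T rmult_commutant[OF that] unfolding commutant_def by (metis (mono_tags, lifting) mem_Collect_eq)
      then obtain m where m: "m \<in> M" "\<And>x y. x \<in> M \<Longrightarrow> y \<in> M \<Longrightarrow> cinner (hat y) (bapp T (hat x)) = \<tau> (adj y * m * x)"
        using left_multiplier_of_operator[OF vN order_refl] by metis
      have "bapp T (hat x) = bapp (\<pi> m) (hat x)" if x: "x \<in> M" for x
        by (rule cinner_hat_eqI) (use x m MD in \<open>simp add: \<pi>_hat cinner_hat mult.assoc\<close>)
      then have "T = \<pi> m" by (intro eq_on_dense[OF dense]) auto
      then show "T \<in> \<pi> ` M" using m(1) by blast
    qed
  qed
qed

lemma image_factor:
  assumes F: "factor M"
  shows "factor (\<pi> ` M)"
  unfolding factor_def
proof
  show "von_neumann_algebra (\<pi> ` M)" using image_von_neumann_algebra F unfolding factor_def by blast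
  have sc: "\<pi> (c *\<^sub>C 1) = c *\<^sub>C 1" for c using \<pi>_linear MD(2) \<pi>_1 unfolding linear_map_on_def by simp
  show "rel_commutant (\<pi> ` M) (\<pi> ` M) = range (\<lambda>c. c *\<^sub>C 1)"
  proof
    show "rel_commutant (\<pi> ` M) (\<pi> ` M) \<subseteq> range (\<lambda>c. c *\<^sub>C 1)"
    proof
      fix T assume "T \<in> rel_commutant (\<pi> ` M) (\<pi> ` M)"
      then obtain z where z: "z \<in> M" "T = \<pi> z" and c: "\<And>y. y \<in> M \<Longrightarrow> \<pi> z * \<pi> y = \<pi> y * \<pi> z"
        unfolding rel_commutant_def commutant_def by auto
      have "z * y = y * z" if y: "y \<in> M" for y
        using \<pi>_inj c[OF y] z y MD(3) by (metis inj_onD \<pi>_mult)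
      then have "z \<in> rel_commutant M M" using z(1) unfolding rel_commutant_def commutant_def by blast
      then obtain c where "z = c *\<^sub>C 1" using F unfolding factor_def by blast
      then show "T \<in> range (\<lambda>c. c *\<^sub>C 1)" using z sc by blast
    qed
    show "range (\<lambda>c. c *\<^sub>C 1) \<subseteq> rel_commutant (\<pi> ` M) (\<pi> ` M)"
    proof
      fix T :: "'k bop" assume "T \<in> range (\<lambda>c. c *\<^sub>C 1)"
      then obtain c where "T = c *\<^sub>C 1" by blast
      then have "T = \<pi> (c *\<^sub>C 1)" "c *\<^sub>C 1 \<in> M" using sc MD by auto
      moreover have "T * y = y * T" for y using \<open>T = c *\<^sub>C 1\<close> by (simp add: scaleC_mult_left scaleC_mult_right)
      ultimately show "T \<in> rel_commutant (\<pi> ` M) (\<pi> ` M)" unfolding rel_commutant_def commutant_def by blast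
    qed
  qed
qed

end

section \<open>The basic construction\<close>

text \<open>One stage of the tower. It is used for N \<subseteq> M \<subseteq> M1 and again for M
  \<subseteq> M1 \<subseteq> M2, so only the smallest algebra is required to be a factor.\<close>

locale jones_step = std_rep M \<tau> \<pi> \<Omega>
  for M :: "'h::chilbert_space bop set" and \<tau> :: "'h bop \<Rightarrow> complex"
    and \<pi> :: "'h bop \<Rightarrow> 'k::chilbert_space bop" and \<Omega> :: 'k +
  fixes N R :: "'h bop set" and e :: "'h bop"
  assumes N: "factor N" and R: "von_neumann_algebra R" and NM: "N \<subseteq> M" and MR: "M \<subseteq> R" and eR: "e \<in> R"
    and traceR: "faithful_normal_trace R \<tau>" and \<tau>1: "\<tau> 1 = 1"
    and homR: "star_hom_on R \<pi>" and injR: "inj_on \<pi> R"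
    and proj_e: "projection_onto (orbit_closure (\<pi> ` N) \<Omega>) (\<pi> e)"
    and image_R: "\<pi> ` R = commutant (commutant (\<pi> ` M \<union> {\<pi> e}))"
begin

lemma starR: "star_algebra R"
  by (rule von_neumann_algebra_star_algebra[OF R])

lemmas RD = star_algebraD[OF starR]

lemma vN_N: "von_neumann_algebra N"
  using N unfolding factor_def by blast

lemma starN: "star_algebra N"
  by (rule von_neumann_algebra_star_algebra[OF vN_N])

lemmas ND = star_algebraD[OF starN]

lemma NR: "N \<subseteq> R" using NM MR by blast

lemma R_mult: "x \<in> R \<Longrightarrow> y \<in> R \<Longrightarrow> \<pi> (x * y) = \<pi> x * \<pi> y"
  and R_adj: "x \<in> R \<Longrightarrow> \<pi> (adj x) = adj (\<pi> x)" and R_linear: "linear_map_on R \<pi>"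
  using homR unfolding star_hom_on_def by auto

lemma \<pi>_0: "\<pi> 0 = 0"
  using linear_map_on_diff[OF RD(1) R_linear RD(8) RD(8)] by simp

lemma \<tau>R_commute: "x \<in> R \<Longrightarrow> y \<in> R \<Longrightarrow> \<tau> (x * y) = \<tau> (y * x)"
  using traceR unfolding faithful_normal_trace_def by blast

lemma \<tau>R_positive: "positive_functional R \<tau>"
  using traceR unfolding faithful_normal_trace_def by blast

lemma orbit_N: "orbit_closure (\<pi> ` N) \<Omega> = closure (hat ` N)"
  unfolding orbit_closure_def by (simp add: image_image hat_def)

lemma hat_linear_N: "linear_map_on N hat"
  using hat_linear NM unfolding linear_map_on_def by blast

lemma proj_e_hat: "projection_onto (closure (hat ` N)) (\<pi> e)"
  using proj_e unfolding orbit_N .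

lemma closure_hat_N: "complex_vector.subspace (closure (hat ` N))"
  by (intro subspace_closure subspace_image ND hat_linear_N)

lemma e_hat: "x \<in> N \<Longrightarrow> bapp (\<pi> e) (hat x) = hat x"
  by (rule projection_onto_fixes[OF proj_e_hat closure_hat_N]) (rule subsetD[OF closure_subset], blast)

lemma \<pi>_e_idem: "\<pi> e * \<pi> e = \<pi> e"
  by (rule projection_onto_idem[OF proj_e_hat closure_hat_N])

lemma \<pi>_e_adj: "adj (\<pi> e) = \<pi> e"
  by (rule projection_onto_adj[OF proj_e_hat closure_hat_N])

lemma e_idem: "e * e = e"
  by (rule inj_onD[OF injR]) (use eR RD in \<open>auto simp: R_mult \<pi>_e_idem\<close>)

lemma e_adj: "adj e = e"
  by (rule inj_onD[OF injR]) (use eR RD in \<open>auto simp: R_adj \<pi>_e_adj\<close>)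

section \<open>Commutation relations, compression by the Jones projection and the Markov
  property\<close>

lemma invariant_closure_N:
  assumes S: "\<And>x. x \<in> N \<Longrightarrow> bapp S (hat x) \<in> hat ` N" and v: "v \<in> closure (hat ` N)"
  shows "bapp S v \<in> closure (hat ` N)"
proof -
  obtain s where s: "\<And>n. s n \<in> N" "(\<lambda>n. hat (s n)) \<longlonglongrightarrow> v" using closure_image_sequenceE[OF v] by blast
  show ?thesis by (rule closure_sequentialI[OF S[OF s(1)] tendsto_bapp[OF s(2)]])
qed

lemma e_commute_N:
  assumes x: "x \<in> N" shows "e * x = x * e"
proof -
  have *: "bapp (\<pi> z) (hat y) \<in> hat ` N" if "z \<in> N" "y \<in> N" for z y
    using that NM[THEN subsetD] ND(3) by (simp add: \<pi>_hat)
  have "\<pi> e * \<pi> x = \<pi> x * \<pi> e"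
  proof (rule projection_onto_commute[OF proj_e_hat closure_hat_N])
    show "bapp (\<pi> x) v \<in> closure (hat ` N)" if "v \<in> closure (hat ` N)" for v
      by (rule invariant_closure_N[OF *[OF x] that])
    show "bapp (adj (\<pi> x)) v \<in> closure (hat ` N)" if "v \<in> closure (hat ` N)" for v
      using invariant_closure_N[OF *[OF ND(4)[OF x]] that] x NM by (auto simp: \<pi>_adj)
  qed
  then show ?thesis
    by (intro inj_onD[OF injR]) (use x NR eR RD in \<open>auto simp: R_mult\<close>)
qed

text \<open>Right multiplication by \<open>a\<close> and its adjoint leave the closure of hat N
  invariant, so they commute with the projection \<pi> e as well as with \<pi> M, and hence with the
  bicommutant.\<close>

lemma rmult_commute_R:
  assumes a: "a \<in> N" and z: "z \<in> R" shows "rmult a * \<pi> z = \<pi> z * rmult a"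
proof -
  have *: "bapp (rmult b) (hat y) \<in> hat ` N" if "b \<in> N" "y \<in> N" for b y
    using that NM[THEN subsetD] ND(3) by (simp add: rmult_hat)
  have "\<pi> e * rmult a = rmult a * \<pi> e"
  proof (rule projection_onto_commute[OF proj_e_hat closure_hat_N])
    show "bapp (rmult a) v \<in> closure (hat ` N)" if "v \<in> closure (hat ` N)" for v
      by (rule invariant_closure_N[OF *[OF a] that])
    show "bapp (adj (rmult a)) v \<in> closure (hat ` N)" if "v \<in> closure (hat ` N)" for v
      using invariant_closure_N[OF *[OF ND(4)[OF a]] that] a NM by (auto simp: rmult_adj)
  qed
  then have "rmult a \<in> commutant (\<pi> ` M \<union> {\<pi> e})"
    using a NM unfolding commutant_def by (auto simp: rmult_commute)
  moreover have "\<pi> z \<in> commutant (commutant (\<pi> ` M \<union> {\<pi> e}))" using z image_R by blast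
  ultimately show ?thesis unfolding commutant_def by (metis (mono_tags, lifting) mem_Collect_eq)
qed

text \<open>Compressed to \<open>L^2(N)\<close>, the operator \<pi> z commutes with right
  multiplications by \<open>N\<close>, so it is left multiplication by some \<open>n\<close>. For
  \<open>z\<close> in \<open>M\<close> this \<open>n\<close> is the conditional expectation of
  \<open>z\<close> onto \<open>N\<close>; the inner product formula thus provides expectations onto
  the smaller algebra.\<close>

lemma compression:
  assumes z: "z \<in> R"
  obtains n where "n \<in> N" "e * z * e = n * e"
    "\<And>x y. x \<in> N \<Longrightarrow> y \<in> N \<Longrightarrow> cinner (hat y) (bapp (\<pi> z) (hat x)) = \<tau> (adj y * n * x)"
    "cinner \<Omega> (bapp (\<pi> z) \<Omega>) = \<tau> n"
proof -
  obtain n where n: "n \<in> N" "\<And>x y. x \<in> N \<Longrightarrow> y \<in> N \<Longrightarrow> cinner (hat y) (bapp (\<pi> z) (hat x)) = \<tau> (adj y * n * x)"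
    using left_multiplier_of_operator[OF vN_N NM rmult_commute_R[OF _ z]] by metis
  have ne: "\<pi> e * \<pi> n = \<pi> n * \<pi> e" using e_commute_N[OF n(1)] n(1) NR eR by (metis R_mult subsetD)
  have "\<pi> e * \<pi> z * \<pi> e = \<pi> n * \<pi> e"
  proof (rule compressed_eqI[OF ND(1) hat_linear_N proj_e_hat])
    show "\<pi> e * (\<pi> e * \<pi> z * \<pi> e) = \<pi> e * \<pi> z * \<pi> e" "\<pi> e * \<pi> z * \<pi> e * \<pi> e = \<pi> e * \<pi> z * \<pi> e"
      "\<pi> e * (\<pi> n * \<pi> e) = \<pi> n * \<pi> e" "\<pi> n * \<pi> e * \<pi> e = \<pi> n * \<pi> e"
      using \<pi>_e_idem ne by (metis mult.assoc)+
    fix x y assume xy: "x \<in> N" "y \<in> N"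
    have "cinner (hat y) (bapp (\<pi> e * \<pi> z * \<pi> e) (hat x)) = cinner (bapp (\<pi> e) (hat y)) (bapp (\<pi> z) (hat x))"
      using cinner_adj_left[of "\<pi> e" "hat y" "bapp (\<pi> z) (bapp (\<pi> e) (hat x))"]
      by (simp add: \<pi>_e_adj e_hat xy)
    also have "\<dots> = \<tau> (adj y * n * x)" using n(2) xy by (simp add: e_hat)
    also have "\<dots> = cinner (hat y) (bapp (\<pi> n * \<pi> e) (hat x))"
      using xy n(1) NM MD by (simp add: e_hat \<pi>_hat cinner_hat subsetD mult.assoc)
    finally show "cinner (hat y) (bapp (\<pi> e * \<pi> z * \<pi> e) (hat x)) = cinner (hat y) (bapp (\<pi> n * \<pi> e) (hat x))" .
  qed
  then have "e * z * e = n * e"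
    by (intro inj_onD[OF injR]) (use n(1) z NR eR RD in \<open>auto simp: R_mult\<close>)
  moreover have "cinner \<Omega> (bapp (\<pi> z) \<Omega>) = \<tau> n" using n(2)[OF ND(2) ND(2)] by (simp add: hat_1)
  ultimately show ?thesis using that n by blast
qed

lemma e_nonzero: "e \<noteq> 0"
proof
  assume "e = 0"
  then have "\<Omega> = 0" using e_hat[OF ND(2)] by (simp add: hat_1 \<pi>_0)
  moreover have "cinner \<Omega> \<Omega> = 1" using cinner_hat[OF MD(2) MD(2)] \<tau>1 by (simp add: hat_1)
  ultimately show False by simp
qed

lemma \<tau>_e_nonzero: "\<tau> e \<noteq> 0"
  using traceR eR e_nonzero e_idem e_adj unfolding faithful_normal_trace_def by metis

text \<open>The functional x \<mapsto> \<phi> (x * e) is a trace on the factor \<open>N\<close>,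
  because \<open>e\<close> commutes with \<open>N\<close>, and it is dominated by \<tau>. Uniqueness
  of the trace makes it a multiple of \<tau>, with constant \<phi> e.\<close>

lemma trace_mult_e_N:
  assumes \<phi>: "positive_functional R \<phi>" and \<phi>tr: "\<And>x y. x \<in> R \<Longrightarrow> y \<in> R \<Longrightarrow> \<phi> (x * y) = \<phi> (y * x)"
    and eq: "\<And>x. x \<in> N \<Longrightarrow> \<phi> x = \<tau> x" and x: "x \<in> N"
  shows "\<phi> (x * e) = \<phi> e * \<tau> x"
proof -
  have f\<phi>: "functional_on R \<phi>" using \<phi> unfolding positive_functional_def by blast
  have sq: "\<phi> (adj x * x * e) = \<phi> (adj (x * e) * (x * e))" if "x \<in> N" for x
  proof -
    have xR: "x \<in> R" using that NR by blast
    have "\<phi> (adj x * x * e) = \<phi> ((adj x * x * e) * e)" by (simp add: mult.assoc e_idem)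
    also have "\<dots> = \<phi> (e * (adj x * x * e))" by (rule \<phi>tr) (use xR eR RD in auto)
    finally show ?thesis by (simp add: mult.assoc e_adj)
  qed
  have "\<phi> (x * e) * \<tau> 1 = \<phi> (1 * e) * \<tau> x"
  proof (rule factor_trace_unique[OF N faithful_normal_trace_mono[OF traceR NR], of "\<lambda>x. \<phi> (x * e)" 1])
    show "positive_functional N (\<lambda>x. \<phi> (x * e))"
      unfolding positive_functional_def
    proof (intro conjI ballI)
      show "functional_on N (\<lambda>x. \<phi> (x * e))"
        using f\<phi> NR eR RD unfolding functional_on_def by (auto simp: distrib_right scaleC_mult_left subset_iff)
      show "\<phi> (adj x * x * e) \<in> \<real>\<^sub>\<ge>\<^sub>0" if "x \<in> N" for x
        unfolding sq[OF that] using \<phi> that NR eR RD unfolding positive_functional_def by blast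
    qed
    show "\<phi> (x * y * e) = \<phi> (y * x * e)" if "x \<in> N" "y \<in> N" for x y
    proof -
      have m: "x \<in> R" "y \<in> R" using that NR by auto
      have "\<phi> (x * (y * e)) = \<phi> (y * e * x)" by (rule \<phi>tr) (use m eR RD in auto)
      then show ?thesis using e_commute_N[OF that(1)] by (simp add: mult.assoc)
    qed
    show "Re (\<phi> (adj x * x * e)) \<le> 1 * Re (\<tau> (adj x * x))" if x: "x \<in> N" for x
    proof -
      \<comment> \<open>\<open>y\<close> is x (1 - e), so \<phi> (adj y * y) is the defect \<phi>
        (adj x * x) - \<phi> (adj x * x * e), which is therefore nonnegative.\<close>
      define y where "y = x - x * e"
      have xR: "x \<in> R" "y \<in> R" "x * e \<in> R" using x NR eR RD by (auto simp: y_def)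
      have "adj y * y = adj x * x - adj x * x * e - (e * (adj x * x) - e * (adj x * x * e))"
        by (simp add: y_def e_adj algebra_simps)
      moreover have "\<phi> (e * (adj x * x)) = \<phi> (adj x * x * e)" "\<phi> (e * (adj x * x * e)) = \<phi> (adj x * x * e)"
        using \<phi>tr[of e "adj x * x"] \<phi>tr[of e "adj x * x * e"] xR eR RD by (simp_all add: mult.assoc e_idem)
      moreover note d = functional_on_diff[OF RD(1) f\<phi>]
      ultimately have "\<phi> (adj y * y) = \<phi> (adj x * x) - \<phi> (adj x * x * e)"
        using xR eR RD by (simp add: d)
      moreover have "0 \<le> Re (\<phi> (adj y * y))" by (rule positive_functional_Cauchy_Schwarz(4)[OF starR \<phi> xR(2) xR(2)])
      ultimately show ?thesis using eq[of "adj x * x"] x ND by simp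
    qed
  qed (use x in auto)
  then show ?thesis using \<tau>1 by simp
qed

text \<open>From e z e = n e. The vector state of \<Omega> on the right extends \<tau> from
  \<open>M\<close> to \<open>R\<close> and does not depend on \<phi>, so two traces that agree with
  \<tau> on \<open>N\<close> are proportional on products that contain \<open>e\<close>.\<close>

lemma trace_compression:
  assumes \<phi>: "positive_functional R \<phi>" and \<phi>tr: "\<And>x y. x \<in> R \<Longrightarrow> y \<in> R \<Longrightarrow> \<phi> (x * y) = \<phi> (y * x)"
    and eq: "\<And>x. x \<in> N \<Longrightarrow> \<phi> x = \<tau> x" and z: "z \<in> R"
  shows "\<phi> (z * e) = \<phi> e * cinner \<Omega> (bapp (\<pi> z) \<Omega>)"
proof -
  obtain n where n: "n \<in> N" "e * z * e = n * e" "cinner \<Omega> (bapp (\<pi> z) \<Omega>) = \<tau> n"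
    using compression[OF z] by metis
  have "\<phi> (z * e) = \<phi> (z * e * e)" by (simp add: mult.assoc e_idem)
  also have "\<dots> = \<phi> (e * (z * e))" by (rule \<phi>tr) (use z eR RD in auto)
  also have "\<dots> = \<phi> e * \<tau> n" using trace_mult_e_N[OF \<phi> \<phi>tr eq n(1)] n(2) by (simp add: mult.assoc)
  finally show ?thesis using n(3) by simp
qed

lemma \<tau>_mult_e: "z \<in> R \<Longrightarrow> \<tau> (z * e) = \<tau> e * cinner \<Omega> (bapp (\<pi> z) \<Omega>)"
  using trace_compression[OF \<tau>R_positive \<tau>R_commute] by simp

lemma \<tau>_mult_e_M:
  assumes x: "x \<in> M" shows "\<tau> (x * e) = \<tau> e * \<tau> x"
proof -
  have "cinner \<Omega> (bapp (\<pi> x) \<Omega>) = \<tau> x" using cinner_hat[OF x MD(2)] by (simp add: hat_1) (simp add: hat_def)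
  then show ?thesis using \<tau>_mult_e[of x] x MR by auto
qed

text \<open>This is how push-down identities x e = y e are verified, by traces against
  \<open>M\<close> only. The hypothesis says that \<pi> z maps \<Omega> to a vector orthogonal to
  hat M; since \<pi> z commutes with right multiplications by \<open>N\<close>, it then vanishes on
  hat N and so on the range of \<pi> e.\<close>

lemma mult_e_eq_0I:
  assumes z: "z \<in> R" and 0: "\<And>y. y \<in> M \<Longrightarrow> \<tau> (adj y * (z * e)) = 0"
  shows "z * e = 0"
proof -
  have "bapp (\<pi> z) \<Omega> = 0"
  proof (rule cinner_hat_eqI)
    fix y assume y: "y \<in> M"
    then have yR: "y \<in> R" using MR by blast
    have "\<tau> e * cinner \<Omega> (bapp (\<pi> (adj y * z)) \<Omega>) = 0"
      using \<tau>_mult_e[of "adj y * z"] 0[OF y] z yR RD by (simp add: mult.assoc)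
    then have "cinner \<Omega> (bapp (\<pi> (adj y)) (bapp (\<pi> z) \<Omega>)) = 0"
      using \<tau>_e_nonzero z yR RD by (simp add: R_mult)
    then show "cinner (hat y) (bapp (\<pi> z) \<Omega>) = cinner (hat y) 0"
      using yR by (simp add: hat_def R_adj cinner_adj_right)
  qed
  moreover have "bapp (\<pi> z) (hat a) = bapp (rmult a) (bapp (\<pi> z) \<Omega>)" if "a \<in> N" for a
  proof -
    have "hat a = bapp (rmult a) \<Omega>" using rmult_hat[of a 1] that NM MD(2) by (auto simp: hat_1)
    then show ?thesis using rmult_commute_R[OF that z] by (metis bapp_simps(6))
  qed
  ultimately have z0: "bapp (\<pi> z) v = bapp 0 v" if "v \<in> hat ` N" for v using that by auto
  have "bapp (\<pi> z) (bapp (\<pi> e) v) = bapp 0 (bapp (\<pi> e) v)" for v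
    by (rule bop_eqI_closure[OF z0 projection_onto_closure[OF proj_e_hat]])
  then have "\<pi> z * \<pi> e = 0" by (intro bop_eqI) simp
  then show ?thesis by (intro inj_onD[OF injR]) (use z eR RD in \<open>auto simp: R_mult \<pi>_0\<close>)
qed

text \<open>The central support of \<open>e\<close> is 1. The projection \<open>q\<close> onto the
  common kernel of all e x lies in \<open>R\<close>, commutes with \<open>M\<close> and satisfies q
  e = 0. So \<pi> q kills \<Omega> and with it the dense set hat M.\<close>

lemma e_nondegenerate:
  assumes u: "\<And>x. x \<in> M \<Longrightarrow> bapp (e * x) u = 0" shows "u = 0"
proof -
  define Z where "Z = {u. \<forall>x\<in>M. bapp (e * x) u = 0}"
  have sZ: "complex_vector.subspace Z"
    by (rule complex_vector.subspaceI) (auto simp: Z_def bapp_add bapp_scaleC)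
  have "closure Z \<subseteq> Z"
  proof
    fix v assume "v \<in> closure Z"
    then obtain s where s: "\<And>n. s n \<in> Z" "s \<longlonglongrightarrow> v" using closure_sequenceE by blast
    have "bapp (e * x) v = 0" if "x \<in> M" for x
    proof -
      have 0: "bapp (e * x) (s n) = 0" for n using s(1)[of n] that unfolding Z_def by blast
      show ?thesis using tendsto_bapp[OF s(2), of "e * x"] unfolding 0 LIMSEQ_const_iff ..
    qed
    then show "v \<in> Z" unfolding Z_def by blast
  qed
  then have cZ: "closed Z" using closure_subset closure_eq by blast
  obtain q where q: "projection_onto Z q" using projection_exists[OF sZ cZ] .
  have aR: "adj ` R \<subseteq> R" using R unfolding von_neumann_algebra_def by blast
  have inv: "bapp y v \<in> Z" if y: "y \<in> commutant R" and v: "v \<in> Z" for y v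
  proof -
    have "bapp (e * x) (bapp y v) = 0" if x: "x \<in> M" for x
    proof -
      have "e * x \<in> R" using eR x MR RD by blast
      then have "bapp (e * x) (bapp y v) = bapp y (bapp (e * x) v)"
        using y unfolding commutant_def by (metis (mono_tags, lifting) bapp_simps(6) mem_Collect_eq)
      also have "\<dots> = 0" using v x unfolding Z_def by (metis (mono_tags, lifting) bapp_zero mem_Collect_eq)
      finally show ?thesis .
    qed
    then show ?thesis unfolding Z_def by blast
  qed
  have "q * y = y * q" if "y \<in> commutant R" for y
    by (rule projection_onto_commute[OF q sZ]) (use inv that commutant_adj[OF aR that] in auto)
  then have "q \<in> commutant (commutant R)" unfolding commutant_def by blast
  then have qR: "q \<in> R" using R unfolding von_neumann_algebra_def by blast
  have invM: "bapp y v \<in> Z" if y: "y \<in> M" and v: "v \<in> Z" for y v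
  proof -
    have "bapp (e * x) (bapp y v) = 0" if "x \<in> M" for x
    proof -
      have "bapp (e * (x * y)) v = 0" using v MD(3)[OF that y] unfolding Z_def by blast
      then show ?thesis by simp
    qed
    then show ?thesis unfolding Z_def by blast
  qed
  have qM: "q * y = y * q" if "y \<in> M" for y
    by (rule projection_onto_commute[OF q sZ]) (use invM that MD(4) in auto)
  have "e * q = 0"
  proof (rule bop_eqI)
    fix v
    have "bapp (e * 1) (bapp q v) = 0" using projection_onto_closure[OF q, of v] MD(2) unfolding Z_def by blast
    then show "bapp (e * q) v = bapp 0 v" by simp
  qed
  then have "adj (e * q) = 0" by simp
  then have "q * e = 0" by (simp add: e_adj projection_onto_adj[OF q sZ])
  then have "\<pi> q * \<pi> e = 0" using R_mult[OF qR eR] \<pi>_0 by simp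
  then have "bapp (\<pi> q) (bapp (\<pi> e) \<Omega>) = 0" by (metis bapp_simps(1,6))
  then have q\<Omega>: "bapp (\<pi> q) \<Omega> = 0" using e_hat[OF ND(2)] by (simp add: hat_1)
  have "bapp (\<pi> q) (hat x) = bapp 0 (hat x)" if x: "x \<in> M" for x
  proof -
    have "\<pi> q * \<pi> x = \<pi> x * \<pi> q" using qM[OF x] qR x MR by (metis R_mult subsetD)
    then have "bapp (\<pi> q) (bapp (\<pi> x) \<Omega>) = bapp (\<pi> x) (bapp (\<pi> q) \<Omega>)" by (metis bapp_simps(6))
    then show ?thesis by (simp add: hat_def q\<Omega>)
  qed
  then have "\<pi> q = 0" by (intro eq_on_dense[OF dense]) auto
  then have "q = 0" by (intro inj_onD[OF injR]) (use qR RD \<pi>_0 in auto)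
  moreover have "u \<in> Z" using u unfolding Z_def by blast
  ultimately show ?thesis using projection_onto_fixes[OF q sZ] by (metis bapp_simps(1))
qed

section \<open>The ideal generated by the Jones projection and uniqueness of the trace on it\<close>

definition ideal where "ideal = complex_vector.span {x * e * y |x y. x \<in> R \<and> y \<in> R}"

lemma ideal_gen: "x \<in> R \<Longrightarrow> y \<in> R \<Longrightarrow> x * e * y \<in> ideal"
  unfolding ideal_def by (rule complex_vector.span_base) blast

lemma ideal_subspace: "complex_vector.subspace ideal"
  unfolding ideal_def by (rule complex_vector.subspace_span)

lemma ideal_induct [consumes 1, case_names zero add]:
  assumes "z \<in> ideal" and "Pr 0" and "\<And>c x y z. x \<in> R \<Longrightarrow> y \<in> R \<Longrightarrow> Pr z \<Longrightarrow> Pr (c *\<^sub>C (x * e * y) + z)"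
  shows "Pr z"
  using assms(1) unfolding ideal_def
proof (induction rule: complex_vector.span_induct_alt)
  case base
  then show ?case by (rule assms(2))
next
  case (step c w z)
  then obtain x y where "w = x * e * y" "x \<in> R" "y \<in> R" by blast
  then show ?case using assms(3) step by blast
qed

lemma ideal_R: "z \<in> ideal \<Longrightarrow> z \<in> R"
  by (induction rule: ideal_induct) (use RD eR in auto)

lemma ideal_mult: "z \<in> ideal \<Longrightarrow> w \<in> R \<Longrightarrow> z * w \<in> ideal"
proof (induction rule: ideal_induct)
  case (add c x y z)
  have "c *\<^sub>C (x * e * (y * w)) + z * w \<in> ideal"
    by (intro complex_vector.subspace_add[OF ideal_subspace] complex_vector.subspace_scale[OF ideal_subspace]
        ideal_gen RD add)
  then show ?case by (simp add: distrib_right scaleC_mult_left mult.assoc)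
qed (simp add: complex_vector.subspace_0[OF ideal_subspace])

lemma ideal_adj: "z \<in> ideal \<Longrightarrow> adj z \<in> ideal"
proof (induction rule: ideal_induct)
  case (add c x y z)
  have "cnj c *\<^sub>C (adj y * e * adj x) + adj z \<in> ideal"
    by (intro complex_vector.subspace_add[OF ideal_subspace] complex_vector.subspace_scale[OF ideal_subspace]
        ideal_gen RD add)
  then show ?case by (simp add: mult.assoc e_adj)
qed (simp add: complex_vector.subspace_0[OF ideal_subspace])

lemma ideal_nondegenerate:
  assumes "\<And>z. z \<in> ideal \<Longrightarrow> bapp z v = 0" shows "v = 0"
proof (rule e_nondegenerate)
  show "bapp (e * x) v = 0" if "x \<in> M" for x
    using assms[OF ideal_gen[of 1 x]] that MR RD by auto
qed

lemma in_closure_ideal: "u \<in> closure ((\<lambda>z. bapp z u) ` ideal)"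
  by (rule nondegenerate_ideal_closure[OF ideal_subspace ideal_mult[OF _ ideal_R] ideal_adj ideal_nondegenerate])

text \<open>\<rho> is the identity when \<phi> is \<tau>, and \<pi> when \<phi> is the trace
  transported from the commutant. Approximating \<zeta> by z \<zeta> with \<open>z\<close> in the
  ideal yields elements that look like 1 to \<phi>, both in value and in the square; these are the
  two limits that a Cauchy-Schwarz comparison requires.\<close>

lemma ideal_approximation:
  fixes \<rho> :: "'h bop \<Rightarrow> 'b::chilbert_space bop"
  assumes \<rho>: "star_hom_on R \<rho>" and \<phi>: "\<And>z. z \<in> R \<Longrightarrow> \<phi> z = cinner \<zeta> (bapp (amp (\<rho> z)) \<zeta>)"
    and nd: "\<And>v. (\<And>x. x \<in> R \<Longrightarrow> bapp (\<rho> (e * x)) v = 0) \<Longrightarrow> v = 0"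
  obtains z where "\<And>n. z n \<in> ideal" "(\<lambda>n. \<phi> (z n)) \<longlonglongrightarrow> \<phi> 1" "(\<lambda>n. \<phi> (adj (z n) * z n)) \<longlonglongrightarrow> \<phi> 1"
proof -
  have \<rho>D: "linear_map_on R \<rho>" "\<rho> 1 = 1" "\<And>x y. x \<in> R \<Longrightarrow> y \<in> R \<Longrightarrow> \<rho> (x * y) = \<rho> x * \<rho> y"
    "\<And>x. x \<in> R \<Longrightarrow> \<rho> (adj x) = adj (\<rho> x)" using \<rho> unfolding star_hom_on_def by auto
  define I where "I = (\<lambda>z. amp (\<rho> z)) ` ideal"
  have "\<zeta> \<in> closure ((\<lambda>z. bapp z \<zeta>) ` I)"
  proof (rule nondegenerate_ideal_closure)
    have "linear_map_on ideal (\<lambda>z. amp (\<rho> z))"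
      using \<rho>D(1) ideal_R unfolding linear_map_on_def by simp
    then show "complex_vector.subspace I" unfolding I_def by (rule subspace_image[OF ideal_subspace])
    show "x * y \<in> I" if x: "x \<in> I" and y: "y \<in> I" for x y
    proof -
      obtain a b where "a \<in> ideal" "b \<in> ideal" "x = amp (\<rho> a)" "y = amp (\<rho> b)"
        using x y unfolding I_def by auto
      then have "x * y = amp (\<rho> (a * b))" "a * b \<in> ideal" using \<rho>D(3) ideal_R ideal_mult by auto
      then show ?thesis unfolding I_def by blast
    qed
    show "adj x \<in> I" if x: "x \<in> I" for x
    proof -
      obtain a where "a \<in> ideal" "x = amp (\<rho> a)" using x unfolding I_def by auto
      then have "adj x = amp (\<rho> (adj a))" "adj a \<in> ideal" using \<rho>D(4) ideal_R ideal_adj by auto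
      then show ?thesis unfolding I_def by blast
    qed
    fix v :: "'b l2" assume v: "\<And>z. z \<in> I \<Longrightarrow> bapp z v = 0"
    have "l2_nth v n = 0" for n
    proof (rule nd)
      fix x assume x: "x \<in> R"
      have "amp (\<rho> (1 * e * x)) \<in> I" unfolding I_def using ideal_gen[OF RD(2) x] by blast
      then have "l2_nth (bapp (amp (\<rho> (e * x))) v) n = l2_nth 0 n" using v by simp
      then show "bapp (\<rho> (e * x)) (l2_nth v n) = 0" by simp
    qed
    then show "v = 0" by (intro l2_eqI) simp
  qed
  then have "\<zeta> \<in> closure ((\<lambda>z. bapp (amp (\<rho> z)) \<zeta>) ` ideal)" by (simp add: I_def image_image)
  then obtain z where z: "\<And>n. z n \<in> ideal" "(\<lambda>n. bapp (amp (\<rho> (z n))) \<zeta>) \<longlonglongrightarrow> \<zeta>"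
    using closure_image_sequenceE by blast
  have \<phi>1: "\<phi> 1 = cinner \<zeta> \<zeta>" using \<phi>[OF RD(2)] \<rho>D(2) by simp
  show ?thesis
  proof (rule that[OF z(1)])
    show "(\<lambda>n. \<phi> (z n)) \<longlonglongrightarrow> \<phi> 1"
      unfolding \<phi>[OF ideal_R[OF z(1)]] \<phi>1 by (intro cinner.tendsto tendsto_const z)
    have "\<phi> (adj (z n) * z n) = cinner (bapp (amp (\<rho> (z n))) \<zeta>) (bapp (amp (\<rho> (z n))) \<zeta>)" for n
      using \<phi>[of "adj (z n) * z n"] ideal_R[OF z(1)[of n]] RD \<rho>D(3,4)
      by (simp add: cinner_adj_right flip: adj_amp)
    then show "(\<lambda>n. \<phi> (adj (z n) * z n)) \<longlonglongrightarrow> \<phi> 1"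
      unfolding \<phi>1 by (simp only:) (intro cinner.tendsto z)
  qed
qed

text \<open>Since \<pi> e fixes \<Omega>, the inner product <hat y, v> equals <\<Omega>, \<pi> (e *
  adj y) v>.\<close>

lemma \<pi>_nondegenerate:
  assumes "\<And>x. x \<in> R \<Longrightarrow> bapp (\<pi> (e * x)) v = 0" shows "v = 0"
proof (rule cinner_hat_eqI)
  fix y assume y: "y \<in> M"
  then have yR: "y \<in> R" using MR by blast
  have "cinner (hat y) v = cinner (bapp (\<pi> e) \<Omega>) (bapp (\<pi> (adj y)) v)"
    using e_hat[OF ND(2)] yR by (simp add: hat_1 R_adj cinner_adj_right) (simp add: hat_def)
  also have "\<dots> = cinner \<Omega> (bapp (\<pi> (e * adj y)) v)"
    using cinner_adj_left[of "\<pi> e"] yR eR RD by (simp add: \<pi>_e_adj R_mult)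
  also have "\<dots> = 0" using assms[of "adj y"] yR RD by simp
  finally show "cinner (hat y) v = cinner (hat y) 0" by simp
qed

text \<open>\<open>\<phi>\<close> and \<open>\<tau>\<close> are proportional on the ideal generated by \<open>e\<close>; normality of either trace makes the ideal
  dense for it, which excludes a constant different from \<open>1\<close>.\<close>

lemma trace_e_unique:
  fixes \<rho> :: "'h bop \<Rightarrow> 'b::chilbert_space bop"
  assumes \<phi>: "positive_functional R \<phi>" and \<phi>tr: "\<And>x y. x \<in> R \<Longrightarrow> y \<in> R \<Longrightarrow> \<phi> (x * y) = \<phi> (y * x)"
    and eq: "\<And>x. x \<in> N \<Longrightarrow> \<phi> x = \<tau> x"
    and z: "\<And>n. z n \<in> ideal" "(\<lambda>n. \<phi> (z n)) \<longlonglongrightarrow> 1" "(\<lambda>n. \<phi> (adj (z n) * z n)) \<longlonglongrightarrow> 1"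
  shows "\<phi> e = \<tau> e"
proof -
  have f\<phi>: "functional_on R \<phi>" and f\<tau>: "functional_on R \<tau>"
    using \<phi> \<tau>R_positive unfolding positive_functional_def by auto
  have \<phi>1: "\<phi> 1 = 1" using eq[OF ND(2)] \<tau>1 by simp
  have pos: "\<kappa> e = complex_of_real (Re (\<kappa> e))" "0 \<le> Re (\<kappa> e)" if "positive_functional R \<kappa>" for \<kappa>
    using positive_functional_Cauchy_Schwarz(4,5)[OF starR that eR eR]
    by (simp_all add: e_adj e_idem complex_eq_iff)
  define c where "c = Re (\<phi> e) / Re (\<tau> e)"
  have b: "Re (\<tau> e) \<noteq> 0" using \<tau>_e_nonzero pos(1)[OF \<tau>R_positive] by (metis of_real_0)
  have c0: "0 \<le> c" unfolding c_def using pos(2)[OF \<phi>] pos(2)[OF \<tau>R_positive] by simp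
  have \<phi>e: "\<phi> e = complex_of_real c * \<tau> e"
    using pos(1)[OF \<phi>] pos(1)[OF \<tau>R_positive] b unfolding c_def
    by (metis nonzero_eq_divide_eq of_real_mult)
  have "w \<in> R \<and> \<phi> w = complex_of_real c * \<tau> w" if "w \<in> ideal" for w
    using that
  proof (induction rule: ideal_induct)
    case zero
    have "\<phi> 0 = 0" "\<tau> 0 = 0" using functional_on_diff[OF RD(1) _ RD(8) RD(8)] f\<phi> f\<tau> by fastforce+
    then show ?case by (simp add: RD)
  next
    case (add k x y w)
    then have m: "x * e * y \<in> R" "y * x \<in> R" "x * e \<in> R" "w \<in> R" "k *\<^sub>C (x * e * y) \<in> R" using eR RD by auto
    have "\<phi> (x * e * y) = \<phi> (y * x * e)" "\<tau> (x * e * y) = \<tau> (y * x * e)"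
      using \<phi>tr[OF m(3) add(2)] \<tau>R_commute[OF m(3) add(2)] by (simp_all add: mult.assoc)
    then have "\<phi> (x * e * y) = complex_of_real c * \<tau> (x * e * y)"
      using trace_compression[OF \<phi> \<phi>tr eq m(2)] \<tau>_mult_e[OF m(2)] \<phi>e by simp
    then show ?case
      using add.IH m RD functional_on_add_scale[OF f\<phi>] functional_on_add_scale[OF f\<tau>]
      by (simp add: distrib_left)
  qed
  then have proportional: "\<phi> w = complex_of_real c * \<tau> w" if "w \<in> ideal" for w using that by blast
  have CS\<phi>: "(cmod (\<phi> w))\<^sup>2 \<le> Re (\<phi> (adj w * w))" if "w \<in> R" for w
    using positive_functional_Cauchy_Schwarz(1)[OF starR \<phi> that RD(2)] \<phi>1 by simp
  have CS\<tau>: "(cmod (\<tau> w))\<^sup>2 \<le> Re (\<tau> (adj w * w))" if "w \<in> R" for w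
    using positive_functional_Cauchy_Schwarz(1)[OF starR \<tau>R_positive that RD(2)] \<tau>1 by simp
  obtain \<zeta> where \<zeta>: "\<And>x. x \<in> R \<Longrightarrow> \<tau> x = cinner \<zeta> (bapp (amp x) \<zeta>)"
    using normal_positive_functional_vector[OF starR \<tau>R_positive] traceR
    unfolding faithful_normal_trace_def by metis
  have id: "star_hom_on R (\<lambda>x. x)" unfolding star_hom_on_def linear_map_on_def by simp
  obtain y where y: "\<And>n. y n \<in> ideal" "(\<lambda>n. \<tau> (y n)) \<longlonglongrightarrow> \<tau> 1" "(\<lambda>n. \<tau> (adj (y n) * y n)) \<longlonglongrightarrow> \<tau> 1"
    using ideal_approximation[OF id \<zeta> e_nondegenerate] MR by (metis subsetD)
  have sq: "adj w * w \<in> ideal" if "w \<in> ideal" for w by (intro ideal_mult ideal_adj ideal_R that)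
  \<comment> \<open>Cauchy-Schwarz for \<phi> = c \<tau> along elements of the ideal that tend to 1
    for \<tau>.\<close>
  have "c\<^sup>2 \<le> c"
  proof (rule LIMSEQ_le)
    show "(\<lambda>n. (cmod (complex_of_real c * \<tau> (y n)))\<^sup>2) \<longlonglongrightarrow> c\<^sup>2"
      using tendsto_power[OF tendsto_norm[OF tendsto_mult[OF tendsto_const y(2)]], of "complex_of_real c" 2] \<tau>1 by simp
    show "(\<lambda>n. Re (complex_of_real c * \<tau> (adj (y n) * y n))) \<longlonglongrightarrow> c"
      using tendsto_Re[OF tendsto_mult[OF tendsto_const y(3)], of "complex_of_real c"] \<tau>1 by simp
    show "\<exists>N. \<forall>n\<ge>N. (cmod (complex_of_real c * \<tau> (y n)))\<^sup>2 \<le> Re (complex_of_real c * \<tau> (adj (y n) * y n))"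
      using CS\<phi>[OF ideal_R[OF y(1)]] proportional[OF y(1)] proportional[OF sq[OF y(1)]] by metis
  qed
  \<comment> \<open>Cauchy-Schwarz for \<tau>, multiplied by c^2, along elements that tend to 1 for
    \<phi>. Together with c^2 \<le> c this leaves only c = 1.\<close>
  moreover have "1 \<le> c"
  proof (rule LIMSEQ_le)
    show "(\<lambda>n. (cmod (\<phi> (z n)))\<^sup>2) \<longlonglongrightarrow> 1" using tendsto_power[OF tendsto_norm[OF z(2)], of 2] by simp
    show "(\<lambda>n. c * Re (\<phi> (adj (z n) * z n))) \<longlonglongrightarrow> c"
      using tendsto_mult[OF tendsto_const tendsto_Re[OF z(3)], of c] by simp
    have "(cmod (\<phi> (z n)))\<^sup>2 \<le> c * Re (\<phi> (adj (z n) * z n))" for n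
    proof -
      have "(cmod (\<phi> (z n)))\<^sup>2 = c\<^sup>2 * (cmod (\<tau> (z n)))\<^sup>2"
        unfolding proportional[OF z(1)] by (simp add: norm_mult power_mult_distrib)
      also have "\<dots> \<le> c\<^sup>2 * Re (\<tau> (adj (z n) * z n))" by (intro mult_left_mono CS\<tau> ideal_R z) simp
      also have "\<dots> = c * Re (\<phi> (adj (z n) * z n))"
        unfolding proportional[OF sq[OF z(1)]] by (simp add: power2_eq_square)
      finally show ?thesis .
    qed
    then show "\<exists>N. \<forall>n\<ge>N. (cmod (\<phi> (z n)))\<^sup>2 \<le> c * Re (\<phi> (adj (z n) * z n))" by blast
  qed
  ultimately have "c = 1" by (simp add: power2_eq_square) 
  then show ?thesis using \<phi>e by simp
qed

end

section \<open>The index\<close>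

text \<open>Tomita's conjugation as a map between two standard representations; traciality makes x
  \<mapsto> \<open>adj x\<close> isometric. One antilinear map thereby replaces a conjugation
  followed by the intertwiner of the representations.\<close>

lemma conjugation_exists:
  fixes \<pi> :: "'h::chilbert_space bop \<Rightarrow> 'k::chilbert_space bop" and \<pi>' :: "'h bop \<Rightarrow> 'l::chilbert_space bop"
  assumes A: "std_rep M \<tau> \<pi> \<Omega>" and B: "std_rep M \<tau> \<pi>' \<Omega>'"
  obtains W where "bounded_linear W" "\<And>c v. W (c *\<^sub>C v) = cnj c *\<^sub>C W v" "\<And>v. norm (W v) \<le> norm v"
    "\<And>x v. x \<in> M \<Longrightarrow> cinner (W v) (std_rep.hat \<pi>' \<Omega>' x) = cinner (std_rep.hat \<pi> \<Omega> (adj x)) v"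
    "\<And>x. x \<in> M \<Longrightarrow> W (std_rep.hat \<pi> \<Omega> x) = std_rep.hat \<pi>' \<Omega>' (adj x)"
proof -
  interpret A: std_rep M \<tau> \<pi> \<Omega> by (rule A)
  interpret B: std_rep M \<tau> \<pi>' \<Omega>' by (rule B)
  have nn: "norm (A.hat (adj x)) = norm (B.hat x)" if x: "x \<in> M" for x
  proof -
    have "(norm (A.hat x))\<^sup>2 = (norm (B.hat x))\<^sup>2" by (simp add: A.norm_hat_sq B.norm_hat_sq x)
    then show ?thesis using A.norm_hat_adj[OF x] by (simp add: power2_eq_iff_nonneg)
  qed
  have "\<exists>w. \<forall>x\<in>M. cinner w (B.hat x) = cinner (A.hat (adj x)) v" for v
  proof (rule riesz_closure[OF A.MD(1) B.hat_linear, of "\<lambda>x. cinner (A.hat (adj x)) v" "norm v"])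
    have "A.hat (x + y) = A.hat x + A.hat y" "A.hat (c *\<^sub>C x) = c *\<^sub>C A.hat x" if "x \<in> M" "y \<in> M" for x y c
      using A.hat_linear that unfolding linear_map_on_def by auto
    then show "functional_on M (\<lambda>x. cinner (A.hat (adj x)) v)"
      unfolding functional_on_def using A.MD(4) by (simp add: cinner_add_left cinner_scaleC_left)
    show "cmod (cinner (A.hat (adj x)) v) \<le> norm v * norm (B.hat x)" if "x \<in> M" for x
      using cmod_cinner_le[of "A.hat (adj x)" v] nn[OF that] by (simp add: mult.commute)
  qed blast
  then obtain W where W: "\<And>x v. x \<in> M \<Longrightarrow> cinner (W v) (B.hat x) = cinner (A.hat (adj x)) v" by metis
  have eqI: "u = v" if "\<And>x. x \<in> M \<Longrightarrow> cinner u (B.hat x) = cinner v (B.hat x)" for u v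
    by (rule B.cinner_hat_eqI) (metis that cinner_commute)
  have add: "W (u + v) = W u + W v" for u v
    by (rule eqI) (simp add: W cinner_add_left cinner_add_right)
  have sc: "W (c *\<^sub>C v) = cnj c *\<^sub>C W v" for c v
    by (rule eqI) (simp add: W cinner_scaleC_left cinner_scaleC_right)
  have nrm: "norm (W v) \<le> norm v" for v
  proof (rule cinner_bound_closure)
    show "W v \<in> closure (B.hat ` M)" by (simp add: B.dense)
    fix u assume "u \<in> B.hat ` M"
    then obtain x where x: "x \<in> M" "u = B.hat x" by blast
    then show "cmod (cinner (W v) u) \<le> norm v * norm u"
      using W[OF x(1)] cmod_cinner_le[of "A.hat (adj x)" v] nn[OF x(1)] by (simp add: mult.commute)
  qed simp
  have hat: "W (A.hat x) = B.hat (adj x)" if x: "x \<in> M" for x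
  proof (rule eqI)
    fix y assume y: "y \<in> M"
    have "cinner (W (A.hat x)) (B.hat y) = \<tau> (y * x)" using W[OF y] A.cinner_hat[OF x A.MD(4)[OF y]] by simp
    also have "\<dots> = \<tau> (x * y)" by (rule A.\<tau>_commute[OF y x])
    finally show "cinner (W (A.hat x)) (B.hat y) = cinner (B.hat (adj x)) (B.hat y)"
      using B.cinner_hat[OF y A.MD(4)[OF x]] by simp
  qed
  have "bounded_linear W"
    by (rule bounded_linear_intro[of _ 1]) (simp_all add: add sc nrm scaleR_scaleC)
  then show ?thesis using that sc nrm W hat by blast
qed

lemma conjugations_inverse:
  fixes \<pi> :: "'h::chilbert_space bop \<Rightarrow> 'k::chilbert_space bop" and \<pi>' :: "'h bop \<Rightarrow> 'l::chilbert_space bop"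
  assumes A: "std_rep M \<tau> \<pi> \<Omega>" and B: "std_rep M \<tau> \<pi>' \<Omega>'"
  obtains W V where "bounded_linear W" "\<And>c v. W (c *\<^sub>C v) = cnj c *\<^sub>C W v" "\<And>v. norm (W v) \<le> norm v"
    "bounded_linear V" "\<And>c v. V (c *\<^sub>C v) = cnj c *\<^sub>C V v" "\<And>v. norm (V v) \<le> norm v"
    "\<And>x. x \<in> M \<Longrightarrow> W (std_rep.hat \<pi> \<Omega> x) = std_rep.hat \<pi>' \<Omega>' (adj x)"
    "\<And>x. x \<in> M \<Longrightarrow> V (std_rep.hat \<pi>' \<Omega>' x) = std_rep.hat \<pi> \<Omega> (adj x)"
    "\<And>v. W (V v) = v" "\<And>v. V (W v) = v" "\<And>u v. cinner (W u) v = cinner (V v) u"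
proof -
  interpret A: std_rep M \<tau> \<pi> \<Omega> by (rule A)
  interpret B: std_rep M \<tau> \<pi>' \<Omega>' by (rule B)
  obtain W where W: "bounded_linear W" "\<And>c v. W (c *\<^sub>C v) = cnj c *\<^sub>C W v" "\<And>v. norm (W v) \<le> norm v"
    "\<And>x v. x \<in> M \<Longrightarrow> cinner (W v) (B.hat x) = cinner (A.hat (adj x)) v"
    "\<And>x. x \<in> M \<Longrightarrow> W (A.hat x) = B.hat (adj x)"
    using conjugation_exists[OF A B] by metis
  obtain V where V: "bounded_linear V" "\<And>c v. V (c *\<^sub>C v) = cnj c *\<^sub>C V v" "\<And>v. norm (V v) \<le> norm v"
    "\<And>x. x \<in> M \<Longrightarrow> V (B.hat x) = A.hat (adj x)"
    using conjugation_exists[OF B A] by metis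
  have seqA: "\<exists>s. (\<forall>n. s n \<in> M) \<and> (\<lambda>n. A.hat (s n)) \<longlonglongrightarrow> v" for v
    using closure_image_sequenceE[of v A.hat M] A.dense by (metis UNIV_I)
  have seqB: "\<exists>s. (\<forall>n. s n \<in> M) \<and> (\<lambda>n. B.hat (s n)) \<longlonglongrightarrow> v" for v
    using closure_image_sequenceE[of v B.hat M] B.dense by (metis UNIV_I)
  note tW = bounded_linear.tendsto[OF W(1)] and tV = bounded_linear.tendsto[OF V(1)]
  have WV: "W (V v) = v" for v
  proof -
    obtain s where s: "\<forall>n. s n \<in> M" "(\<lambda>n. B.hat (s n)) \<longlonglongrightarrow> v" using seqB by blast
    have "(\<lambda>n. W (V (B.hat (s n)))) \<longlonglongrightarrow> W (V v)" by (intro tW tV s)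
    then have "(\<lambda>n. B.hat (s n)) \<longlonglongrightarrow> W (V v)" using s(1) V(4) W(5) A.MD(4) by simp
    then show ?thesis using s(2) LIMSEQ_unique by blast
  qed
  have VW: "V (W v) = v" for v
  proof -
    obtain s where s: "\<forall>n. s n \<in> M" "(\<lambda>n. A.hat (s n)) \<longlonglongrightarrow> v" using seqA by blast
    have "(\<lambda>n. V (W (A.hat (s n)))) \<longlonglongrightarrow> V (W v)" by (intro tW tV s)
    then have "(\<lambda>n. A.hat (s n)) \<longlonglongrightarrow> V (W v)" using s(1) V(4) W(5) A.MD(4) by simp
    then show ?thesis using s(2) LIMSEQ_unique by blast
  qed
  have "cinner (W u) v = cinner (V v) u" for u v
  proof -
    obtain s where s: "\<forall>n. s n \<in> M" "(\<lambda>n. B.hat (s n)) \<longlonglongrightarrow> v" using seqB by blast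
    have "(\<lambda>n. cinner (V (B.hat (s n))) u) \<longlonglongrightarrow> cinner (V v) u" by (intro cinner.tendsto tendsto_const tV s)
    moreover have "cinner (V (B.hat (s n))) u = cinner (W u) (B.hat (s n))" for n using W(4) V(4) s(1) by simp
    moreover have "(\<lambda>n. cinner (W u) (B.hat (s n))) \<longlonglongrightarrow> cinner (W u) v" by (intro cinner.tendsto tendsto_const s)
    ultimately show ?thesis using LIMSEQ_unique by simp
  qed
  with W V WV VW show ?thesis using that by blast
qed

lemma normal_functional_add_vector:
  assumes "normal_functional P \<phi>"
  shows "normal_functional P (\<lambda>T. cinner \<Omega> (bapp T \<Omega>) + \<phi> T)"
proof -
  obtain f g :: "nat \<Rightarrow> 'a" where fg: "summable (\<lambda>n. (norm (f n))\<^sup>2)" "summable (\<lambda>n. (norm (g n))\<^sup>2)"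
    "\<And>x. x \<in> P \<Longrightarrow> (\<lambda>n. cinner (f n) (bapp x (g n))) sums \<phi> x"
    using assms unfolding normal_functional_def by blast
  define f' where "f' = case_nat \<Omega> f"
  define g' where "g' = case_nat \<Omega> g"
  have "summable (\<lambda>n. (norm (f' (Suc n)))\<^sup>2)" "summable (\<lambda>n. (norm (g' (Suc n)))\<^sup>2)"
    using fg(1,2) by (simp_all add: f'_def g'_def)
  then have "summable (\<lambda>n. (norm (f' n))\<^sup>2)" "summable (\<lambda>n. (norm (g' n))\<^sup>2)"
    using summable_Suc_iff[of "\<lambda>n. (norm (f' n))\<^sup>2"] summable_Suc_iff[of "\<lambda>n. (norm (g' n))\<^sup>2"] by simp_all
  moreover have "(\<lambda>n. cinner (f' n) (bapp x (g' n))) sums (cinner \<Omega> (bapp x \<Omega>) + \<phi> x)" if "x \<in> P" for x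
  proof -
    have "(\<lambda>n. cinner (f' (Suc n)) (bapp x (g' (Suc n)))) sums \<phi> x" using fg(3)[OF that] by (simp add: f'_def g'_def)
    from sums_Suc[OF this] show ?thesis by (simp add: f'_def g'_def add.commute)
  qed
  ultimately show ?thesis unfolding normal_functional_def by blast
qed

context jones_step
begin

lemma star_image_R: "star_algebra (\<pi> ` R)"
proof -
  have "adj ` (\<pi> ` M \<union> {\<pi> e}) \<subseteq> \<pi> ` M \<union> {\<pi> e}" using MD(4) by (auto simp: \<pi>_e_adj simp flip: \<pi>_adj)
  then have "adj ` commutant (\<pi> ` M \<union> {\<pi> e}) \<subseteq> commutant (\<pi> ` M \<union> {\<pi> e})" using commutant_adj by blast
  then show ?thesis unfolding image_R by (rule star_algebra_commutant)
qed

text \<open>Conjugation carries \<open>R\<close> into the commutant \<open>C\<close> of the image of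
  \<open>N\<close> under \<pi>'. The trace on \<open>C\<close> pulls back to a trace on
  \<open>R\<close> that agrees with \<tau> on \<open>N\<close>, hence at \<open>e\<close>. The
  coupling constant is evaluated at \<Omega>': the orbit of \<open>C\<close> is dense, so the first
  projection is 1, and the projection onto the closure of N \<Omega>' is the conjugate of \<pi>
  e.\<close>

lemma trace_e_eq_index:
  assumes F: "factor M" and ind: "finite_jones_index TYPE('k) \<tau> N M d"
  shows "1 = complex_of_real d * \<tau> e"
proof -
  obtain \<pi>' :: "'h bop \<Rightarrow> 'k bop" and \<Omega>' where std': "standard_rep \<tau> M \<pi>' \<Omega>'" and cc: "coupling_constant (\<pi>' ` N) d"
    using ind unfolding finite_jones_index_def by blast
  interpret B: std_rep M \<tau> \<pi>' \<Omega>' by unfold_locales (rule M trace std')+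
  define C where "C = commutant (\<pi>' ` N)"
  obtain tr tr' where tr: "normalized_trace (\<pi>' ` N) tr" and tr': "normalized_trace C tr'"
    and cpl: "\<And>\<xi> p q. \<xi> \<noteq> 0 \<Longrightarrow> projection_onto (orbit_closure C \<xi>) p \<Longrightarrow>
        projection_onto (orbit_closure (\<pi>' ` N) \<xi>) q \<Longrightarrow> tr p = complex_of_real d * tr' q"
    using cc unfolding coupling_constant_def C_def by metis
  have "adj ` \<pi>' ` N \<subseteq> \<pi>' ` N" using ND(4) NM by (auto simp: subset_iff simp flip: B.\<pi>_adj)
  then have sC: "star_algebra C" unfolding C_def by (rule star_algebra_commutant)
  note CD = star_algebraD[OF sC]
  note tr'D = normalized_trace_faithful_normal_trace[OF tr', unfolded faithful_normal_trace_def positive_functional_def]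
  have ftr': "functional_on C tr'" and ntr': "normal_functional C tr'" using tr'D by simp_all
  obtain W V where W: "bounded_linear W" "\<And>c v. W (c *\<^sub>C v) = cnj c *\<^sub>C W v" "\<And>v. norm (W v) \<le> norm v"
    and V: "bounded_linear V" "\<And>c v. V (c *\<^sub>C v) = cnj c *\<^sub>C V v" "\<And>v. norm (V v) \<le> norm v"
    and Wh: "\<And>x. x \<in> M \<Longrightarrow> W (hat x) = B.hat (adj x)" and Vh: "\<And>x. x \<in> M \<Longrightarrow> V (B.hat x) = hat (adj x)"
    and WV: "\<And>v. W (V v) = v" and VW: "\<And>v. V (W v) = v" and pair: "\<And>u v. cinner (W u) v = cinner (V v) u"
    by (rule conjugations_inverse[OF std_rep_axioms B.std_rep_axioms]) (rule that; assumption)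
  note tW = bounded_linear.tendsto[OF W(1)] and tV = bounded_linear.tendsto[OF V(1)]
  have Wadd: "W (u + v) = W u + W v" and Vadd: "V (u + v) = V u + V v" for u v
    using W(1) V(1) by (simp_all add: linear_add bounded_linear.linear)
  \<comment> \<open>With J for the conjugation, \<Theta> T is J \<open>adj T\<close> J. The adjoint
    compensates the antilinearity of J, so \<Theta> is linear and reverses products, which is
    harmless under a trace.\<close>
  have "\<exists>X. \<forall>v. bapp X v = W (bapp (adj T) (V v))" for T :: "'k bop"
  proof -
    obtain K where K: "K > 0" "\<And>x. norm (bapp (adj T) x) \<le> K * norm x" using bapp_bound by blast
    show ?thesis
    proof (rule bop_exists[of "\<lambda>v. W (bapp (adj T) (V v))" K])
      show "norm (W (bapp (adj T) (V v))) \<le> K * norm v" for v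
        using order_trans[OF W(3)[of "bapp (adj T) (V v)"]
            order_trans[OF K(2)[of "V v"] mult_left_mono[OF V(3)[of v] less_imp_le[OF K(1)]]]] .
    qed (auto simp: Wadd Vadd W V bapp_add bapp_scaleC)
  qed
  then obtain \<Theta> where \<Theta>: "\<And>T v. bapp (\<Theta> T) v = W (bapp (adj T) (V v))" by metis
  have \<Theta>_add: "\<Theta> (S + T) = \<Theta> S + \<Theta> T" and \<Theta>_sc: "\<Theta> (c *\<^sub>C T) = c *\<^sub>C \<Theta> T" and \<Theta>_mult: "\<Theta> (T * S) = \<Theta> S * \<Theta> T"
    and \<Theta>_1: "\<Theta> 1 = 1" for S T c
    by (rule bop_eqI; simp add: \<Theta> Wadd W VW WV)+
  have \<Theta>_adj: "\<Theta> (adj T) = adj (\<Theta> T)" for T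
  proof (rule adjI[symmetric])
    fix u v
    have "cinner u (bapp (\<Theta> T) v) = cnj (cinner (bapp (\<Theta> T) v) u)" by (rule cinner_commute)
    also have "\<dots> = cnj (cinner (V u) (bapp (adj T) (V v)))" by (simp add: \<Theta> pair)
    also have "\<dots> = cinner (V v) (bapp T (V u))" by (metis cinner_commute cinner_adj_left)
    also have "\<dots> = cinner (bapp (\<Theta> (adj T)) u) v" by (simp add: \<Theta> pair)
    finally show "cinner (bapp (\<Theta> (adj T)) u) v = cinner u (bapp (\<Theta> T) v)" ..
  qed
  have seqA: "\<exists>s. (\<forall>n. s n \<in> M) \<and> (\<lambda>n. hat (s n)) \<longlonglongrightarrow> v" for v
    using closure_image_sequenceE[of v hat M] dense by (metis UNIV_I)
  have inter: "bapp (\<pi>' n) (W v) = W (bapp (rmult (adj n)) v)" if n: "n \<in> M" for n v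
  proof -
    obtain s where s: "\<forall>k. s k \<in> M" "(\<lambda>k. hat (s k)) \<longlonglongrightarrow> v" using seqA by blast
    have "(\<lambda>k. bapp (\<pi>' n) (W (hat (s k)))) \<longlonglongrightarrow> bapp (\<pi>' n) (W v)" by (intro tW tendsto_bapp s)
    moreover have "bapp (\<pi>' n) (W (hat (s k))) = W (bapp (rmult (adj n)) (hat (s k)))" for k
      using s(1) n MD by (simp add: Wh B.\<pi>_hat rmult_hat)
    moreover have "(\<lambda>k. W (bapp (rmult (adj n)) (hat (s k)))) \<longlonglongrightarrow> W (bapp (rmult (adj n)) v)"
      by (intro tW tendsto_bapp s)
    ultimately show ?thesis using LIMSEQ_unique by simp
  qed
  have interV: "V (bapp (\<pi>' n) v) = bapp (rmult (adj n)) (V v)" if n: "n \<in> M" for n v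
    using inter[OF n, of "V v"] by (metis WV VW)
  have \<Theta>_C: "\<Theta> (\<pi> z) \<in> C" if z: "z \<in> R" for z
  proof -
    have "\<Theta> (\<pi> z) * \<pi>' n = \<pi>' n * \<Theta> (\<pi> z)" if n: "n \<in> N" for n
    proof (rule bop_eqI)
      fix v
      have nM: "n \<in> M" using n NM by blast
      have "rmult (adj n) * \<pi> (adj z) = \<pi> (adj z) * rmult (adj n)" using n z ND RD by (intro rmult_commute_R)
      then show "bapp (\<Theta> (\<pi> z) * \<pi>' n) v = bapp (\<pi>' n * \<Theta> (\<pi> z)) v"
        using z by (simp add: \<Theta> inter interV nM flip: R_adj) (metis bapp_simps(6))
    qed
    then show ?thesis unfolding C_def commutant_def by blast
  qed
  define \<kappa> where "\<kappa> T = cinner \<Omega> (bapp T \<Omega>)" for T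
  define \<phi> where "\<phi> T = tr' (\<Theta> T)" for T
  have \<phi>_lin: "\<phi> (S + T) = \<phi> S + \<phi> T" "\<phi> (c *\<^sub>C S) = c * \<phi> S" if "S \<in> \<pi> ` R" "T \<in> \<pi> ` R" for S T c
  proof -
    have "\<Theta> S \<in> C" "\<Theta> T \<in> C" using that \<Theta>_C by auto
    then show "\<phi> (S + T) = \<phi> S + \<phi> T" "\<phi> (c *\<^sub>C S) = c * \<phi> S"
      using functional_on_add_scale[OF ftr'] by (simp_all add: \<phi>_def \<Theta>_add \<Theta>_sc)
  qed
  have \<phi>_tr: "\<phi> (S * T) = \<phi> (T * S)" if "S \<in> \<pi> ` R" "T \<in> \<pi> ` R" for S T
    using that \<Theta>_C tr'D by (auto simp: \<phi>_def \<Theta>_mult)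
  have \<phi>_pos: "\<phi> (adj T * T) \<in> \<real>\<^sub>\<ge>\<^sub>0" if "T \<in> \<pi> ` R" for T
  proof -
    have m: "\<Theta> T \<in> C" "adj (\<Theta> T) \<in> C" using that \<Theta>_C CD(4) by auto
    have "tr' (\<Theta> T * adj (\<Theta> T)) = tr' (adj (\<Theta> T) * \<Theta> T)" using tr'D m by blast
    then have "\<phi> (adj T * T) = tr' (adj (\<Theta> T) * \<Theta> T)" by (simp add: \<phi>_def \<Theta>_mult \<Theta>_adj)
    moreover have "tr' (adj (\<Theta> T) * \<Theta> T) \<in> \<real>\<^sub>\<ge>\<^sub>0" using tr'D m(1) by blast
    ultimately show ?thesis by simp
  qed
  have \<phi>_1: "\<phi> 1 = 1" using tr' unfolding \<phi>_def \<Theta>_1 normalized_trace_def by blast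
  have \<phi>P: "positive_functional (\<pi> ` R) \<phi>"
    unfolding positive_functional_def functional_on_def using \<phi>_lin \<phi>_pos by blast
  have \<phi>_normal: "normal_functional (\<pi> ` R) \<phi>"
  proof -
    obtain f g :: "nat \<Rightarrow> 'k" where fg: "summable (\<lambda>n. (norm (f n))\<^sup>2)" "summable (\<lambda>n. (norm (g n))\<^sup>2)"
      "\<And>x. x \<in> C \<Longrightarrow> (\<lambda>n. cinner (f n) (bapp x (g n))) sums tr' x"
      using ntr' unfolding normal_functional_def by blast
    have Vs: "summable (\<lambda>n. (norm (V (h n)))\<^sup>2)" if "summable (\<lambda>n. (norm (h n))\<^sup>2)" for h
      by (rule summable_comparison_test'[OF that]) (simp add: V power_mono)
    have eq: "cinner (f n) (bapp (\<Theta> T) (g n)) = cinner (V (g n)) (bapp T (V (f n)))" for n T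
    proof -
      have "cinner (f n) (bapp (\<Theta> T) (g n)) = cinner (bapp (\<Theta> (adj T)) (f n)) (g n)"
        unfolding \<Theta>_adj by (rule cinner_adj_left[symmetric])
      then show ?thesis by (simp add: \<Theta> pair)
    qed
    have "(\<lambda>n. cinner (V (g n)) (bapp T (V (f n)))) sums \<phi> T" if "T \<in> \<pi> ` R" for T
    proof -
      have "\<Theta> T \<in> C" using that \<Theta>_C by auto
      from fg(3)[OF this] show ?thesis unfolding eq \<phi>_def .
    qed
    then show ?thesis unfolding normal_functional_def
      by (intro exI[of _ "\<lambda>n. V (g n)"] exI[of _ "\<lambda>n. V (f n)"] conjI Vs fg(1,2)) simp
  qed
  have MRi: "\<pi> ` M \<subseteq> \<pi> ` R" using MR by blast
  have \<kappa>_lin: "\<kappa> (S + T) = \<kappa> S + \<kappa> T" "\<kappa> (c *\<^sub>C S) = c * \<kappa> S" for S T c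
    by (simp_all add: \<kappa>_def cinner_add_right cinner_scaleC_right)
  have \<kappa>_sq: "\<kappa> (adj T * T) = of_real ((norm (bapp T \<Omega>))\<^sup>2)" for T
    by (simp add: \<kappa>_def cinner_adj_right cinner_self)
  have \<kappa>\<pi>: "\<kappa> (\<pi> x) = \<tau> x" if "x \<in> M" for x
    using cinner_hat[OF that MD(2)] by (simp add: hat_1 \<kappa>_def) (simp add: hat_def)
  have \<kappa>_tr: "\<kappa> (S * T) = \<kappa> (T * S)" if S: "S \<in> \<pi> ` M" and T: "T \<in> \<pi> ` M" for S T
  proof -
    obtain x y where "x \<in> M" "y \<in> M" "S = \<pi> x" "T = \<pi> y" using S T by blast
    then show ?thesis using \<kappa>\<pi>[of "x * y"] \<kappa>\<pi>[of "y * x"] \<tau>_commute MD by (simp add: \<pi>_mult)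
  qed
  have \<kappa>P: "positive_functional (\<pi> ` M) \<kappa>"
    unfolding positive_functional_def functional_on_def by (auto simp: \<kappa>_lin \<kappa>_sq simp del: of_real_power)
  \<comment> \<open>Neither of the traces \<kappa> and \<phi> on the image of \<open>M\<close> is
    known to dominate the other. The sum dominates \<kappa> and is faithful because \<kappa> is.
    Uniqueness on the factor then gives 2 \<kappa> = \<kappa> + \<phi>.\<close>
  define \<sigma> where "\<sigma> T = \<kappa> T + \<phi> T" for T
  have \<sigma>: "faithful_normal_trace (\<pi> ` M) \<sigma>"
    unfolding faithful_normal_trace_def
  proof (intro conjI ballI impI)
    show "positive_functional (\<pi> ` M) \<sigma>"
      unfolding positive_functional_def functional_on_def
    proof (intro conjI ballI allI)
      show "\<sigma> (S + T) = \<sigma> S + \<sigma> T" if "S \<in> \<pi> ` M" "T \<in> \<pi> ` M" for S T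
        using \<phi>_lin(1)[of S T] that MRi by (auto simp: \<sigma>_def \<kappa>_lin)
      show "\<sigma> (c *\<^sub>C S) = c * \<sigma> S" if "S \<in> \<pi> ` M" for S c
        using \<phi>_lin(2)[of S S c] that MRi by (auto simp: \<sigma>_def \<kappa>_lin distrib_left)
      show "\<sigma> (adj T * T) \<in> \<real>\<^sub>\<ge>\<^sub>0" if "T \<in> \<pi> ` M" for T
        unfolding \<sigma>_def \<kappa>_sq using \<phi>_pos[of T] that MRi by (intro nonneg_Reals_add_I) auto
    qed
    show "\<sigma> (S * T) = \<sigma> (T * S)" if "S \<in> \<pi> ` M" "T \<in> \<pi> ` M" for S T
      unfolding \<sigma>_def using \<kappa>_tr[OF that] \<phi>_tr[of S T] that MRi by auto
    show "T = 0" if T: "T \<in> \<pi> ` M" and 0: "\<sigma> (adj T * T) = 0" for T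
    proof -
      have "(norm (bapp T \<Omega>))\<^sup>2 + Re (\<phi> (adj T * T)) = 0"
        using arg_cong[OF 0, of Re] unfolding \<sigma>_def \<kappa>_sq by simp
      moreover have "0 \<le> Re (\<phi> (adj T * T))"
        using \<phi>_pos[of T] T MRi by (auto simp: complex_nonneg_Reals_iff)
      ultimately have "(norm (bapp T \<Omega>))\<^sup>2 = 0" by (smt (verit) zero_le_power2)
      then have T0: "bapp T \<Omega> = 0" by simp
      obtain x where x: "x \<in> M" "T = \<pi> x" using T by blast
      have "\<tau> (adj x * x) = 0" using cinner_hat[OF x(1) x(1)] T0 x(2) by (simp add: hat_def)
      then have "x = 0" using trace x(1) unfolding faithful_normal_trace_def by blast
      then show ?thesis using x(2) \<pi>_0 by simp
    qed
    have "normal_functional (\<pi> ` M) \<phi>"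
      using \<phi>_normal MRi unfolding normal_functional_def by (meson subsetD)
    then show "normal_functional (\<pi> ` M) \<sigma>"
      unfolding \<sigma>_def[abs_def] \<kappa>_def by (rule normal_functional_add_vector)
  qed
  have \<phi>\<kappa>: "\<phi> T = \<kappa> T" if T: "T \<in> \<pi> ` M" for T
  proof -
    have "\<kappa> T * \<sigma> 1 = \<kappa> 1 * \<sigma> T"
    proof (rule factor_trace_unique[OF image_factor[OF F] \<sigma> \<kappa>P \<kappa>_tr, of 1])
      show "Re (\<kappa> (adj T * T)) \<le> 1 * Re (\<sigma> (adj T * T))" if "T \<in> \<pi> ` M" for T
        using \<phi>_pos[of T] that MRi by (auto simp: \<sigma>_def complex_nonneg_Reals_iff)
    qed (use T in auto)
    moreover have "\<kappa> 1 = 1" using \<kappa>\<pi>[OF MD(2)] \<tau>1 \<pi>_1 by simp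
    ultimately show ?thesis by (simp add: \<sigma>_def \<phi>_1)
  qed
  obtain \<zeta> where \<zeta>: "\<And>T. T \<in> \<pi> ` R \<Longrightarrow> \<phi> T = cinner \<zeta> (bapp (amp T) \<zeta>)"
    using normal_positive_functional_vector[OF star_image_R \<phi>P \<phi>_normal] by metis
  define \<phi>' where "\<phi>' z = \<phi> (\<pi> z)" for z
  have \<phi>'P: "positive_functional R \<phi>'"
    unfolding positive_functional_def functional_on_def
  proof (intro conjI ballI allI)
    show "\<phi>' (x + y) = \<phi>' x + \<phi>' y" if "x \<in> R" "y \<in> R" for x y
      using that \<phi>_lin R_linear unfolding linear_map_on_def \<phi>'_def by simp
    show "\<phi>' (c *\<^sub>C x) = c * \<phi>' x" if "x \<in> R" for x c
      using that \<phi>_lin(2)[of "\<pi> x" "\<pi> x"] R_linear unfolding linear_map_on_def \<phi>'_def by simp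
    show "\<phi>' (adj x * x) \<in> \<real>\<^sub>\<ge>\<^sub>0" if "x \<in> R" for x
      using that \<phi>_pos[of "\<pi> x"] RD by (simp add: \<phi>'_def R_mult R_adj)
  qed
  obtain z where z: "\<And>n. z n \<in> ideal" "(\<lambda>n. \<phi>' (z n)) \<longlonglongrightarrow> \<phi>' 1" "(\<lambda>n. \<phi>' (adj (z n) * z n)) \<longlonglongrightarrow> \<phi>' 1"
    using ideal_approximation[OF homR, of \<phi>' \<zeta>] \<zeta> \<pi>_nondegenerate unfolding \<phi>'_def by blast
  have \<phi>'1: "\<phi>' 1 = 1" by (simp add: \<phi>'_def \<pi>_1 \<phi>_1)
  have "\<phi>' e = \<tau> e"
  proof (rule trace_e_unique[OF \<phi>'P _ _ z(1) z(2,3)[unfolded \<phi>'1]])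
    show "\<phi>' (x * y) = \<phi>' (y * x)" if "x \<in> R" "y \<in> R" for x y
      using that \<phi>_tr by (simp add: \<phi>'_def R_mult)
    show "\<phi>' x = \<tau> x" if "x \<in> N" for x
      using that NM \<phi>\<kappa> \<kappa>\<pi> by (auto simp: \<phi>'_def)
  qed
  then have \<phi>e: "tr' (\<Theta> (\<pi> e)) = \<tau> e" by (simp add: \<phi>'_def \<phi>_def)
  have qN: "projection_onto (orbit_closure (\<pi>' ` N) \<Omega>') (\<Theta> (\<pi> e))"
  proof -
    have oc: "orbit_closure (\<pi>' ` N) \<Omega>' = closure (B.hat ` N)"
      unfolding orbit_closure_def by (simp add: image_image B.hat_def)
    have "bapp (\<Theta> (\<pi> e)) v \<in> closure (B.hat ` N)" for v
    proof -
      obtain s where s: "\<And>n. s n \<in> N" "(\<lambda>n. hat (s n)) \<longlonglongrightarrow> bapp (\<pi> e) (V v)"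
        using closure_image_sequenceE[OF projection_onto_closure[OF proj_e_hat]] by blast
      have "(\<lambda>n. W (hat (s n))) \<longlonglongrightarrow> bapp (\<Theta> (\<pi> e)) v" using tW[OF s(2)] by (simp add: \<Theta> \<pi>_e_adj)
      moreover have "W (hat (s n)) \<in> B.hat ` N" for n using Wh[of "s n"] s(1)[of n] ND(4) NM by auto
      ultimately show ?thesis by (intro closure_sequentialI[of "\<lambda>n. W (hat (s n))"])
    qed
    moreover have "cinner u (v - bapp (\<Theta> (\<pi> e)) v) = 0" if u: "u \<in> closure (B.hat ` N)" for u v
    proof -
      have "cinner u (v - bapp (\<Theta> (\<pi> e)) v) = cinner u 0"
      proof (rule cinner_ext_closure[OF _ u])
        fix y assume "y \<in> B.hat ` N"
        then obtain x where x: "x \<in> N" "y = B.hat x" by blast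
        have "bapp (\<Theta> (\<pi> e)) y = y"
          using x NM ND(4)[OF x(1)] Vh[of x] Wh[of "adj x"] by (auto simp: \<Theta> \<pi>_e_adj e_hat subset_iff)
        moreover have "cinner y (bapp (\<Theta> (\<pi> e)) v) = cinner (bapp (\<Theta> (\<pi> e)) y) v"
          using \<Theta>_adj[of "\<pi> e"] \<pi>_e_adj cinner_adj_left[of "\<Theta> (\<pi> e)"] by simp
        ultimately show "cinner y (v - bapp (\<Theta> (\<pi> e)) v) = cinner y 0" by (simp add: cinner_diff_right)
      qed
      then show ?thesis by simp
    qed
    ultimately show ?thesis unfolding oc projection_onto_def by blast
  qed
  \<comment> \<open>Right multiplications by elements of \<open>M\<close> commute with the image of
    \<open>N\<close>, so the orbit of \<Omega>' under \<open>C\<close> contains the dense set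
    \<open>B.hat\<close> of \<open>M\<close>.\<close>
  have p1: "projection_onto (orbit_closure C \<Omega>') 1"
  proof -
    have "B.hat a \<in> (\<lambda>x. bapp x \<Omega>') ` C" if a: "a \<in> M" for a
    proof -
      have "B.rmult a \<in> C" using B.rmult_commute[OF a] NM unfolding C_def commutant_def by auto
      moreover have "bapp (B.rmult a) \<Omega>' = B.hat a" using B.rmult_hat[OF a MD(2)] by (simp add: B.hat_1)
      ultimately show ?thesis by force
    qed
    then have "B.hat ` M \<subseteq> (\<lambda>x. bapp x \<Omega>') ` C" by blast
    then have "orbit_closure C \<Omega>' = UNIV" unfolding orbit_closure_def using closure_mono B.dense by blast
    then show ?thesis unfolding projection_onto_def by simp
  qed
  have "cinner \<Omega>' \<Omega>' = 1" using B.cinner_hat[OF MD(2) MD(2)] \<tau>1 by (simp add: B.hat_1)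
  then have "\<Omega>' \<noteq> 0" by auto
  from cpl[OF this p1 qN] show ?thesis using tr \<phi>e unfolding normalized_trace_def by simp
qed

end

section \<open>Two steps of the tower\<close>

lemma rel_commutant_commute: "b \<in> rel_commutant X Y \<Longrightarrow> x \<in> X \<Longrightarrow> b * x = x * b"
  and rel_commutant_mem: "b \<in> rel_commutant X Y \<Longrightarrow> b \<in> Y"
  unfolding rel_commutant_def commutant_def by auto

lemma rel_commutantI: "(\<And>x. x \<in> X \<Longrightarrow> b * x = x * b) \<Longrightarrow> b \<in> Y \<Longrightarrow> b \<in> rel_commutant X Y"
  unfolding rel_commutant_def commutant_def by auto

locale jones_tower = L1: jones_step M \<tau> \<pi>0 \<Omega>0 N M1 e1 + L2: jones_step M1 \<tau> \<pi>1 \<Omega>1 M M2 e2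
  for N M M1 M2 :: "'h::chilbert_space bop set" and e1 e2 :: "'h bop" and \<tau> :: "'h bop \<Rightarrow> complex"
    and \<pi>0 :: "'h bop \<Rightarrow> 'k::chilbert_space bop" and \<Omega>0 and \<pi>1 :: "'h bop \<Rightarrow> 'l::chilbert_space bop" and \<Omega>1
begin

lemmas \<tau>_linear = functional_on_add_scale[OF L2.\<tau>R_positive[unfolded positive_functional_def, THEN conjunct1]]
  and \<tau>_diff = functional_on_diff[OF L2.RD(1) L2.\<tau>R_positive[unfolded positive_functional_def, THEN conjunct1]]

lemma M_M1: "x \<in> M \<Longrightarrow> x \<in> M1" and M1_M2: "x \<in> M1 \<Longrightarrow> x \<in> M2" and e1_M2: "e1 \<in> M2"
  using L2.NM L2.MR L1.eR by auto

text \<open>Here \<open>n\<close> is the conditional expectation of \<open>c * e1\<close> onto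
  \<open>M\<close>, supplied by compression one step higher in the tower. The factor 1 / \<tau> e1
  comes from the Markov property \<tau> (x * e1) = \<tau> e1 \<tau> x on \<open>M\<close>.\<close>

lemma pull_down_e1:
  assumes c: "c \<in> M1"
  obtains m where "m \<in> M" "c * e1 = m * e1"
proof -
  have z: "c * e1 \<in> M1" using c L1.eR L1.RD by blast
  obtain n where n: "n \<in> M" "\<And>x y. x \<in> M \<Longrightarrow> y \<in> M \<Longrightarrow> cinner (L2.hat y) (bapp (\<pi>1 (c * e1)) (L2.hat x)) = \<tau> (adj y * n * x)"
    using L2.compression[OF M1_M2[OF z]] by metis
  have n1: "\<tau> (adj y * (c * e1)) = \<tau> (adj y * n)" if y: "y \<in> M" for y
    using n(2)[OF L1.MD(2) y] L2.\<pi>_hat[OF z L2.MD(2)] L2.cinner_hat[OF z M_M1[OF y]] by simp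
  define m where "m = (1 / \<tau> e1) *\<^sub>C n"
  have m: "m \<in> M" using n(1) L1.MD by (simp add: m_def)
  have "(c - m) * e1 = 0"
  proof (rule L1.mult_e_eq_0I)
    show "c - m \<in> M1" by (rule L1.RD(6)[OF c M_M1[OF m]])
    fix y assume y: "y \<in> M"
    have my: "adj y \<in> M" "adj y * n \<in> M" "y \<in> M1" "adj y \<in> M1" using y n(1) L1.MD M_M1 by auto
    have "\<tau> (adj y * ((c - m) * e1)) = \<tau> (adj y * (c * e1) - (1 / \<tau> e1) *\<^sub>C ((adj y * n) * e1))"
      by (simp add: m_def algebra_simps scaleC_mult_left scaleC_mult_right)
    also have "\<dots> = \<tau> (adj y * (c * e1)) - (1 / \<tau> e1) * \<tau> ((adj y * n) * e1)"
    proof -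
      have k: "adj y * (c * e1) \<in> M2" "(adj y * n) * e1 \<in> M2"
        using my z M_M1 L1.RD(3) L1.eR M1_M2 by auto
      show ?thesis using \<tau>_diff[OF k(1) L2.RD(7)[OF k(2)]] \<tau>_linear(2)[OF k(2) k(2)] by simp
    qed
    also have "\<dots> = 0" using n1[OF y] L1.\<tau>_mult_e_M[OF my(2)] L1.\<tau>_e_nonzero by simp
    finally show "\<tau> (adj y * ((c - m) * e1)) = 0" .
  qed
  then have "c * e1 = m * e1" by (simp add: left_diff_distrib)
  then show ?thesis using that m by blast
qed

lemma pull_down_e1_left:
  assumes c: "c \<in> M1"
  obtains m where "m \<in> M" "e1 * c = e1 * m"
proof -
  obtain m where m: "m \<in> M" "adj c * e1 = m * e1" using pull_down_e1 c L1.RD(4) by blast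
  have "adj (adj c * e1) = adj (m * e1)" using m(2) by simp
  then have "e1 * c = e1 * adj m" by (simp add: L1.e_adj)
  then show ?thesis using that m(1) L1.MD(4) by blast
qed

text \<open>The ideal \<open>M1 e1 M1\<close> is dense in \<open>M1\<close>, and \<open>e2\<close> has full central support in \<open>M2\<close>.\<close>

lemma annihilator_eq_0:
  assumes y: "\<And>x1 x2. x1 \<in> M1 \<Longrightarrow> x2 \<in> M1 \<Longrightarrow> e2 * x1 * e1 * x2 * y = 0"
  shows "y = 0"
proof (rule bop_eqI)
  fix v
  have "bapp y v = 0"
  proof (rule L2.e_nondegenerate)
    fix x assume x: "x \<in> M1"
    have ann: "e2 * x * z * y = 0" if "z \<in> L1.ideal" for z
      using that
    proof (induction rule: L1.ideal_induct)
      case (add c x1 x2 z)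
      have "e2 * x * (c *\<^sub>C (x1 * e1 * x2) + z) * y = c *\<^sub>C (e2 * (x * x1) * e1 * x2 * y) + e2 * x * z * y"
        by (simp add: distrib_left distrib_right scaleC_mult_left scaleC_mult_right mult.assoc)
      then show ?case using y[of "x * x1" x2] add x L1.RD(3) by simp
    qed simp
    define w where "w = bapp (e2 * x * y) v"
    \<comment> \<open>Chosen so that <u, y v> = ||w||^2. As \<open>u\<close> is a limit of vectors z
      u with \<open>z\<close> in the ideal, and the ideal is annihilated by \<open>ann\<close>, this
      inner product is 0.\<close>
    define u where "u = bapp (adj x * e2) w"
    have "cinner u (bapp y v) = cinner u 0"
    proof (rule cinner_ext_closure[OF _ L1.in_closure_ideal])
      fix s assume "s \<in> (\<lambda>z. bapp z u) ` L1.ideal"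
      then obtain z where z: "z \<in> L1.ideal" "s = bapp z u" by blast
      have "cinner s (bapp y v) = cinner (bapp (adj (adj z)) u) (bapp y v)" using z(2) by simp
      also have "\<dots> = cinner u (bapp (adj z * y) v)" unfolding cinner_adj_left by simp
      also have "\<dots> = cinner (bapp (adj (e2 * x)) w) (bapp (adj z * y) v)" by (simp add: u_def L2.e_adj)
      also have "\<dots> = cinner w (bapp (e2 * x * adj z * y) v)" unfolding cinner_adj_left by simp
      also have "\<dots> = 0" using ann[OF L1.ideal_adj[OF z(1)]] by simp
      finally show "cinner s (bapp y v) = cinner s 0" by simp
    qed
    moreover have "cinner u (bapp y v) = cinner w w"
    proof -
      have "cinner u (bapp y v) = cinner (bapp (adj (e2 * x)) w) (bapp y v)" by (simp add: u_def L2.e_adj)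
      also have "\<dots> = cinner w w" unfolding cinner_adj_left by (simp add: w_def)
      finally show ?thesis .
    qed
    ultimately have "w = 0" by (simp add: cinner_self_eq_0)
    then show "bapp (e2 * x) (bapp y v) = 0" by (simp add: w_def)
  qed
  then show "bapp y v = bapp 0 v" by simp
qed

text \<open>The first Temperley-Lieb relation: compression by \<open>e2\<close> puts the expectation
  of \<open>e1\<close> onto \<open>M\<close> in front of \<open>e2\<close>, and by the Markov
  property that expectation is the scalar \<tau> e1.\<close>

lemma e2_e1_e2: "e2 * e1 * e2 = \<tau> e1 *\<^sub>C e2"
proof -
  obtain n where n: "n \<in> M" "e2 * e1 * e2 = n * e2"
    "\<And>x y. x \<in> M \<Longrightarrow> y \<in> M \<Longrightarrow> cinner (L2.hat y) (bapp (\<pi>1 e1) (L2.hat x)) = \<tau> (adj y * n * x)"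
    using L2.compression[OF e1_M2] by metis
  have "n = \<tau> e1 *\<^sub>C 1"
  proof (rule trace_eqI[OF L1.M L1.trace n(1)])
    show "\<tau> e1 *\<^sub>C 1 \<in> M" by (intro L1.MD)
    fix z assume z: "z \<in> M"
    have "\<tau> (adj z * n) = \<tau> (adj z * e1)"
      using n(3)[OF L1.MD(2) z] L2.\<pi>_hat[OF L1.eR L2.MD(2)] L2.cinner_hat[OF L1.eR M_M1[OF z]] by simp
    also have "\<dots> = \<tau> e1 * \<tau> (adj z)" using L1.\<tau>_mult_e_M L1.MD(4)[OF z] by blast
    also have "\<dots> = \<tau> (adj z * (\<tau> e1 *\<^sub>C 1))"
      using \<tau>_linear(2)[of "adj z" "adj z" "\<tau> e1"] L1.MD(4)[OF z] M_M1 M1_M2 by (simp add: scaleC_mult_right)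
    finally show "\<tau> (adj z * n) = \<tau> (adj z * (\<tau> e1 *\<^sub>C 1))" .
  qed
  then show ?thesis using n(2) by (simp add: scaleC_mult_left)
qed

text \<open>The other Temperley-Lieb relation, e1 e2 e1 = \<tau> e1 e1, is derived from the first.
  Its trace, combined with \<tau> (e1 * e2) = \<tau> e2 \<tau> e1, gives the equality.\<close>

lemma trace_e1_eq_trace_e2: "\<tau> e1 = \<tau> e2"
proof -
  define t where "t = \<tau> e1"
  have t: "t \<noteq> 0" unfolding t_def by (rule L1.\<tau>_e_nonzero)
  \<comment> \<open>The defect of the relation to be proved. By \<open>e2_e1_e2\<close> it is killed
    by \<open>e2\<close> from the left, and \<open>e1\<close> fixes it.\<close>
  define g where "g = e1 - (1 / t) *\<^sub>C (e1 * e2 * e1)"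
  have e2g: "e2 * g = 0"
  proof -
    have "e2 * g = e2 * e1 - (1 / t) *\<^sub>C (e2 * e1 * e2 * e1)"
      by (simp add: g_def right_diff_distrib scaleC_mult_right mult.assoc)
    also have "\<dots> = 0" using t by (simp add: e2_e1_e2 t_def scaleC_mult_left scaleC_scaleC scaleC_one)
    finally show ?thesis .
  qed
  have e1g: "e1 * g = g"
    by (simp add: g_def right_diff_distrib scaleC_mult_right L1.e_idem mult.assoc[symmetric])
  have "g = 0"
  proof (rule annihilator_eq_0)
    fix x1 x2 assume x: "x1 \<in> M1" "x2 \<in> M1"
    obtain n where n: "n \<in> N" "e1 * x2 * e1 = n * e1" using L1.compression[OF x(2)] by metis
    have "x1 * n \<in> M1" by (rule L1.RD(3)[OF x(1) subsetD[OF L1.NR n(1)]])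
    then obtain m where m: "m \<in> M" "x1 * n * e1 = m * e1" by (rule pull_down_e1)
    \<comment> \<open>Inserting \<open>e1\<close> before \<open>g\<close> allows the compression;
      after push-down the remaining factor \<open>m\<close> lies in \<open>M\<close> and commutes
      with \<open>e2\<close>, which thereby reaches \<open>g\<close>.\<close>
    have "e2 * x1 * e1 * x2 * g = e2 * x1 * (e1 * x2 * e1) * g"
      by (simp add: mult.assoc e1g)
    also have "\<dots> = e2 * (x1 * n * e1) * g" unfolding n(2) by (simp add: mult.assoc)
    also have "\<dots> = e2 * m * e1 * g" unfolding m(2) by (simp add: mult.assoc)
    also have "\<dots> = m * e2 * g" unfolding L2.e_commute_N[OF m(1)] by (simp add: mult.assoc e1g)
    also have "\<dots> = 0" using e2g by (simp add: mult.assoc)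
    finally show "e2 * x1 * e1 * x2 * g = 0" .
  qed
  then have "e1 = (1 / t) *\<^sub>C (e1 * e2 * e1)" by (simp add: g_def)
  then have "\<tau> e1 = (1 / t) * \<tau> (e1 * e2 * e1)"
    using \<tau>_linear(2)[of "e1 * e2 * e1" "e1 * e2 * e1" "1 / t"] L2.RD(3) e1_M2 L2.eR by metis
  also have "\<tau> (e1 * e2 * e1) = \<tau> (e1 * (e1 * e2))"
    using L2.\<tau>R_commute[of "e1 * e2" e1] L2.RD(3) e1_M2 L2.eR by simp
  also have "\<dots> = \<tau> (e1 * e2)" by (simp add: L1.e_idem flip: mult.assoc)
  also have "\<dots> = \<tau> e2 * t" unfolding t_def by (rule L2.\<tau>_mult_e_M[OF L1.eR])
  finally show ?thesis using t by simp
qed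

end

locale jones_tower_expectation = jones_tower +
  fixes E :: "'a bop \<Rightarrow> 'a bop" and lam :: real
  assumes E: "conditional_expectation \<tau> M2 M1 E" and \<tau>_e1: "\<tau> e1 = complex_of_real lam"
begin

abbreviation l where "l \<equiv> complex_of_real lam"

lemma lam: "l \<noteq> 0" using L1.\<tau>_e_nonzero \<tau>_e1 by simp

lemma \<tau>_e2: "\<tau> e2 = l" using trace_e1_eq_trace_e2 \<tau>_e1 by simp

lemma E_M1: "x \<in> M2 \<Longrightarrow> E x \<in> M1" and E_fix: "x \<in> M1 \<Longrightarrow> E x = x" and E_\<tau>: "x \<in> M2 \<Longrightarrow> \<tau> (E x) = \<tau> x"
  and E_scale: "x \<in> M2 \<Longrightarrow> E (c *\<^sub>C x) = c *\<^sub>C E x"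
  using E unfolding conditional_expectation_def linear_map_on_def by auto

lemma E_bimodule: "p \<in> M1 \<Longrightarrow> x \<in> M2 \<Longrightarrow> q \<in> M1 \<Longrightarrow> E (p * x * q) = p * E x * q"
  using E unfolding conditional_expectation_def by blast

lemma E_left: "p \<in> M1 \<Longrightarrow> x \<in> M2 \<Longrightarrow> E (p * x) = p * E x"
  using E_bimodule[of p x 1] L2.MD(2) by simp

lemma E_right: "x \<in> M2 \<Longrightarrow> q \<in> M1 \<Longrightarrow> E (x * q) = E x * q"
  using E_bimodule[of 1 x q] L2.MD(2) by simp

lemma E_e2: "E e2 = l *\<^sub>C 1"
proof (rule trace_eqI[OF L2.M L2.trace E_M1[OF L2.eR]])
  show "l *\<^sub>C 1 \<in> M1" by (intro L2.MD)
  fix z assume z: "z \<in> M1"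
  have az: "adj z \<in> M1" "adj z \<in> M2" using z L2.MD(4) M1_M2 by auto
  have "\<tau> (adj z * E e2) = \<tau> (adj z * e2)"
    using E_left[OF az(1) L2.eR] E_\<tau>[OF L2.RD(3)[OF az(2) L2.eR]] by simp
  also have "\<dots> = l * \<tau> (adj z)" using L2.\<tau>_mult_e_M[OF az(1)] \<tau>_e2 by simp
  also have "\<dots> = \<tau> (adj z * (l *\<^sub>C 1))" using \<tau>_linear(2)[OF az(2) az(2)] by (simp add: scaleC_mult_right)
  finally show "\<tau> (adj z * E e2) = \<tau> (adj z * (l *\<^sub>C 1))" .
qed

text \<open>Both sides have the same trace against \<open>adj y\<close> for \<open>y\<close> in
  \<open>M1\<close>, because \<tau> (x * e2) = lam \<tau> x on \<open>M1\<close>; this is the origin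
  of the factor 1 / l.\<close>

lemma pull_down_e2:
  assumes b: "b \<in> M2" shows "b * e2 = (1 / l) *\<^sub>C (E (b * e2)) * e2"
proof -
  have be: "b * e2 \<in> M2" "E (b * e2) \<in> M1" "E (b * e2) \<in> M2" using b L2.eR L2.RD(3) E_M1 M1_M2 by auto
  have "(b - (1 / l) *\<^sub>C (E (b * e2))) * e2 = 0"
  proof (rule L2.mult_e_eq_0I)
    show "b - (1 / l) *\<^sub>C (E (b * e2)) \<in> M2" by (intro L2.RD b be)
    fix y assume y: "y \<in> M1"
    have ay: "adj y \<in> M1" "adj y \<in> M2" using y L2.MD(4) M1_M2 by auto
    have m: "adj y * E (b * e2) \<in> M1" "adj y * (b * e2) \<in> M2" "adj y * E (b * e2) * e2 \<in> M2"
      using ay be L2.MD(3) L2.RD(3) L2.eR by auto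
    have "\<tau> (adj y * ((b - (1 / l) *\<^sub>C (E (b * e2))) * e2))
        = \<tau> (adj y * (b * e2) - (1 / l) *\<^sub>C (adj y * E (b * e2) * e2))"
      by (simp add: algebra_simps scaleC_mult_left scaleC_mult_right)
    also have "\<dots> = \<tau> (adj y * (b * e2)) - (1 / l) * \<tau> (adj y * E (b * e2) * e2)"
      using \<tau>_diff[OF m(2) L2.RD(7)[OF m(3)]] \<tau>_linear(2)[OF m(3) m(3)] by simp
    also have "\<dots> = \<tau> (adj y * (b * e2)) - \<tau> (adj y * E (b * e2))"
      using L2.\<tau>_mult_e_M[OF m(1)] \<tau>_e2 lam by simp
    also have "\<dots> = 0" using E_left[OF ay(1) be(1)] E_\<tau>[OF m(2)] by simp
    finally show "\<tau> (adj y * ((b - (1 / l) *\<^sub>C (E (b * e2))) * e2)) = 0" .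
  qed
  then show ?thesis by (simp add: left_diff_distrib)
qed

section \<open>Relative commutants, the pairing and the counital map\<close>

lemma e2_rel_commutant: "e2 \<in> rel_commutant M M2"
  by (rule rel_commutantI) (use L2.e_commute_N L2.eR in auto)

lemma E_rel_commutant:
  assumes b: "b \<in> rel_commutant M M2"
  shows "(1 / l) *\<^sub>C (E (b * e2)) \<in> rel_commutant M M1"
proof (rule rel_commutantI)
  note bM = rel_commutant_mem[OF b]
  have be: "b * e2 \<in> M2" using bM L2.eR L2.RD(3) by blast
  show "(1 / l) *\<^sub>C (E (b * e2)) \<in> M1" by (intro L2.MD E_M1 be)
  fix x assume x: "x \<in> M"
  have "E (b * e2) * x = E (b * e2 * x)" using E_right[OF be M_M1[OF x]] by simp
  also have "b * e2 * x = x * (b * e2)"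
  proof -
    have "b * e2 * x = (b * x) * e2" using L2.e_commute_N[OF x] by (simp add: mult.assoc)
    then show ?thesis unfolding rel_commutant_commute[OF b x] by (simp add: mult.assoc)
  qed
  also have "E (x * (b * e2)) = x * E (b * e2)" by (rule E_left[OF M_M1[OF x] be])
  finally show "(1 / l) *\<^sub>C (E (b * e2)) * x = x * (1 / l) *\<^sub>C (E (b * e2))"
    by (simp add: scaleC_mult_left scaleC_mult_right)
qed

text \<open>With y = w b, the element \<open>h = E (e2 * e1 * y)\<close> lies in the relative
  commutant of \<open>N\<close>, so its adjoint is an admissible test element and forces h = 0. This
  propagates to e2 e1 y = 0, then to y = 0 by the annihilator criterion, and \<open>w\<close> is
  cancelled by its left inverse.\<close>

lemma pairing_nondegenerate:
  assumes w: "w \<in> rel_commutant M M1" "v * w = 1" and b: "b \<in> rel_commutant M M2"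
    and 0: "\<And>a. a \<in> rel_commutant N M1 \<Longrightarrow> pairing lam \<tau> e1 e2 w a b = 0"
  shows "b = 0"
proof -
  define y where "y = w * b"
  have wM: "w \<in> M1" "w \<in> M2" and bM: "b \<in> M2" using w b rel_commutant_mem M1_M2 by auto
  have y: "y \<in> M2" "adj y \<in> M2" using wM bM L2.RD by (auto simp: y_def)
  have ycomm: "y * x = x * y" if "x \<in> M" for x
    
  proof -
    have "y * x = w * (b * x)" by (simp add: y_def mult.assoc)
    also have "\<dots> = (w * x) * b" unfolding rel_commutant_commute[OF b that] by (simp add: mult.assoc)
    finally show ?thesis unfolding rel_commutant_commute[OF w(1) that] by (simp add: y_def mult.assoc)
  qed
  have z: "e2 * e1 * y \<in> M2" using L2.eR e1_M2 y L2.RD(3) by blast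
  define h where "h = E (e2 * e1 * y)"
  have hM: "h \<in> M1" unfolding h_def by (rule E_M1[OF z])
  have "h \<in> rel_commutant N M1"
  proof (rule rel_commutantI[OF _ hM])
    fix x assume x: "x \<in> N"
    then have xM: "x \<in> M" using L1.NM by blast
    have "h * x = E (e2 * e1 * y * x)" unfolding h_def using E_right[OF z M_M1[OF xM]] by simp
    also have "e2 * e1 * y * x = x * (e2 * e1 * y)"
    proof -
      have "e2 * e1 * y * x = e2 * (e1 * x) * y" using ycomm[OF xM] by (simp add: mult.assoc)
      also have "\<dots> = (e2 * x) * e1 * y" unfolding L1.e_commute_N[OF x] by (simp add: mult.assoc)
      finally show ?thesis unfolding L2.e_commute_N[OF xM] by (simp add: mult.assoc)
    qed
    also have "E (x * (e2 * e1 * y)) = x * h" unfolding h_def by (rule E_left[OF M_M1[OF xM] z])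
    finally show "h * x = x * h" .
  qed
  then have ah: "adj h \<in> rel_commutant N M1"
    unfolding rel_commutant_def using commutant_adj[of N h] L1.ND(4) L1.RD(4) by blast
  have ahM: "adj h \<in> M1" by (rule rel_commutant_mem[OF ah])
  \<comment> \<open>The right-hand side is lam^2 times the pairing of \<open>adj h\<close> with
    \<open>b\<close>.\<close>
  have "\<tau> (adj h * h) = \<tau> (E (adj h * (e2 * e1 * y)))" unfolding h_def using E_left[OF ahM[unfolded h_def] z] by simp
  also have "\<dots> = \<tau> (adj h * (e2 * e1 * y))" by (intro E_\<tau> L2.RD M1_M2 ahM z)
  also have "\<dots> = 0" using 0[OF ah] lam by (simp add: pairing_def y_def mult.assoc)
  finally have "h = 0" using L2.trace hM unfolding faithful_normal_trace_def by blast
  \<comment> \<open>The adjoint of e2 e1 y is used because \<open>mult_e_eq_0I\<close> wants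
    \<open>e2\<close> on the right. Testing with \<open>p\<close> in \<open>M1\<close> gives the
    conjugate of \<tau> (h * p).\<close>
  have "adj y * e1 * e2 = 0"
  proof (rule L2.mult_e_eq_0I)
    show "adj y * e1 \<in> M2" using y e1_M2 L2.RD(3) by blast
    fix p assume p: "p \<in> M1"
    have zp: "e2 * e1 * y * p \<in> M2" using z p M1_M2 L2.RD(3) by blast
    have "\<tau> (e2 * e1 * y * p) = \<tau> (E (e2 * e1 * y * p))" by (rule E_\<tau>[symmetric, OF zp])
    also have "E (e2 * e1 * y * p) = 0" using E_right[OF z p] \<open>h = 0\<close> by (simp add: h_def)
    also have "\<tau> 0 = 0" using \<tau>_diff[OF L2.RD(8) L2.RD(8)] by simp
    finally have "\<tau> (adj (e2 * e1 * y * p)) = 0"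
      using positive_functional_Cauchy_Schwarz(3)[OF L2.starR L2.\<tau>R_positive zp zp] by simp
    then show "\<tau> (adj p * (adj y * e1 * e2)) = 0" by (simp add: L1.e_adj L2.e_adj mult.assoc)
  qed
  then have "adj (adj y * e1 * e2) = 0" by simp
  then have e2e1y: "e2 * e1 * y = 0" by (simp add: L1.e_adj L2.e_adj mult.assoc)
  have "y = 0"
  proof (rule annihilator_eq_0)
    fix x1 x2 assume x: "x1 \<in> M1" "x2 \<in> M1"
    \<comment> \<open>Push-down replaces \<open>x1\<close> and \<open>x2\<close> by elements of
      \<open>M\<close>; one commutes with \<open>e2\<close> and the other with \<open>y\<close>, so
      both move out of the product and leave e2 e1 y.\<close>
    obtain m where m: "m \<in> M" "x1 * e1 = m * e1" using pull_down_e1[OF x(1)] .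
    obtain n where n: "n \<in> M" "e1 * x2 = e1 * n" using pull_down_e1_left[OF x(2)] .
    have "e2 * x1 * e1 * x2 * y = e2 * (x1 * e1) * x2 * y" by (simp add: mult.assoc)
    also have "\<dots> = e2 * m * (e1 * x2) * y" unfolding m(2) by (simp add: mult.assoc)
    also have "\<dots> = m * e2 * e1 * (n * y)" unfolding n(2) L2.e_commute_N[OF m(1)] by (simp add: mult.assoc)
    also have "\<dots> = m * (e2 * e1 * y) * n" unfolding ycomm[OF n(1), symmetric] by (simp add: mult.assoc)
    finally show "e2 * x1 * e1 * x2 * y = 0" using e2e1y by simp
  qed
  then have "v * (w * b) = 0" by (simp add: y_def)
  then show ?thesis using w(2) by (simp flip: mult.assoc)
qed

text \<open>In Sweedler notation, for c = \<lambda>^-1 E(b e2): <a, \<epsilon>_t(b)> =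
  \<epsilon>(1_1 b) <a, 1_2> = <c, 1_1> <a, 1_2> = <c a, 1> = <a, c>, the last equality by
  traciality.\<close>

lemma eps_t_eq:
  assumes w: "w \<in> rel_commutant M M1" "v * w = 1"
    and \<Delta>: "set (\<Delta> 1) \<subseteq> rel_commutant M M2 \<times> rel_commutant M M2"
    and \<Delta>1: "\<And>a1 a2. a1 \<in> rel_commutant N M1 \<Longrightarrow> a2 \<in> rel_commutant N M1 \<Longrightarrow>
      (\<Sum>(x, y)\<leftarrow>\<Delta> 1. pairing lam \<tau> e1 e2 w a1 x * pairing lam \<tau> e1 e2 w a2 y) = pairing lam \<tau> e1 e2 w (a1 * a2) 1"
    and \<epsilon>: "\<And>b. b \<in> rel_commutant M M2 \<Longrightarrow> \<epsilon> b = pairing lam \<tau> e1 e2 w 1 b"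
    and b: "b \<in> rel_commutant M M2"
  shows "eps_t \<Delta> \<epsilon> b = (1 / l) *\<^sub>C (E (b * e2))"
proof -
  define c where "c = (1 / l) *\<^sub>C (E (b * e2))"
  let ?p = "pairing lam \<tau> e1 e2 w"
  let ?B = "rel_commutant M M2"
  have cM: "c \<in> rel_commutant M M1" unfolding c_def by (rule E_rel_commutant[OF b])
  \<comment> \<open>Membership in N' \<inter> M1 lets \<open>c\<close> be multiplied with
    \<open>a\<close> in the duality with \<Delta>, and membership in M' \<inter> M2 lets it be
    compared with \<open>eps_t\<close>.\<close>
  have cA: "c \<in> rel_commutant N M1" and cB: "c \<in> ?B"
    using cM L1.NM M1_M2 unfolding rel_commutant_def commutant_def by auto
  have sB: "complex_vector.subspace ?B"
    unfolding rel_commutant_def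
    using unital_subalgebra_commutant[of M] L2.RD(1)
    by (auto simp: unital_subalgebra_def intro: complex_vector.subspace_inter)
  have BM: "x \<in> M2" if "x \<in> ?B" for x using rel_commutant_mem[OF that] .
  have wM: "w \<in> M2" using w(1) rel_commutant_mem M1_M2 by blast
  have e21: "e2 * e1 * w \<in> M2" using L2.eR e1_M2 wM L2.RD(3) by blast
  have mulB: "x * y \<in> ?B" if "x \<in> ?B" "y \<in> ?B" for x y
    using that unital_subalgebra_commutant[of M] L2.RD(3) unfolding rel_commutant_def unital_subalgebra_def by blast
  have \<epsilon>p: "\<epsilon> (x * b) = ?p c x" if x: "x \<in> ?B" for x
  proof -
    have xM: "x \<in> M2" "b \<in> M2" using BM x b by auto
    have "\<tau> (1 * e2 * e1 * w * (x * b)) = \<tau> ((e2 * e1 * w * x) * b)" by (simp add: mult.assoc)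
    also have "\<dots> = \<tau> (b * (e2 * e1 * w * x))" by (rule L2.\<tau>R_commute) (use xM e21 L2.RD in auto)
    also have "b * (e2 * e1 * w * x) = c * e2 * e1 * w * x"
    proof -
      have c: "b * e2 = c * e2" unfolding c_def by (rule pull_down_e2[OF xM(2)])
      have "b * (e2 * e1 * w * x) = (b * e2) * e1 * w * x" by (simp add: mult.assoc)
      then show ?thesis unfolding c .
    qed
    finally show ?thesis using \<epsilon>[OF mulB[OF x b]] by (simp add: pairing_def)
  qed
  have p_add: "?p a (x + y) = ?p a x + ?p a y" and p_sc: "?p a (k *\<^sub>C x) = k * ?p a x"
    and p_diff: "?p a (x - y) = ?p a x - ?p a y"
    if a: "a \<in> rel_commutant N M1" and x: "x \<in> ?B" and y: "y \<in> ?B" for a x y k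
  proof -
    have z: "a * e2 * e1 * w \<in> M2" using e21 M1_M2[OF rel_commutant_mem[OF a]] L2.RD(3) by (simp add: mult.assoc)
    note m = L2.RD(3)[OF z BM[OF x]] L2.RD(3)[OF z BM[OF y]]
    show "?p a (x + y) = ?p a x + ?p a y" "?p a (k *\<^sub>C x) = k * ?p a x" "?p a (x - y) = ?p a x - ?p a y"
      using \<tau>_linear[OF m] \<tau>_diff[OF m]
      by (simp_all add: pairing_def distrib_left right_diff_distrib scaleC_mult_right)
  qed
  \<comment> \<open>Induction over the list that represents the tensor \<Delta>(1). Membership in
    \<open>?B\<close> is carried along because additivity of the pairing has been established only
    there.\<close>
  have "(\<Sum>(x, y)\<leftarrow>xs. \<epsilon> (x * b) *\<^sub>C y) \<in> ?B \<and> (\<forall>a\<in>rel_commutant N M1.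
      ?p a (\<Sum>(x, y)\<leftarrow>xs. \<epsilon> (x * b) *\<^sub>C y) = (\<Sum>(x, y)\<leftarrow>xs. ?p c x * ?p a y))" if "set xs \<subseteq> ?B \<times> ?B" for xs
    using that
  proof (induction xs)
    case Nil
    have "?p a 0 = 0" for a using \<tau>_diff[OF L2.RD(8) L2.RD(8)] by (simp add: pairing_def)
    then show ?case using complex_vector.subspace_0[OF sB] by simp
  next
    case (Cons q xs)
    obtain x y where q: "q = (x, y)" by (cases q)
    have xy: "x \<in> ?B" "y \<in> ?B" "set xs \<subseteq> ?B \<times> ?B" using Cons.prems q by auto
    have ky: "\<epsilon> (x * b) *\<^sub>C y \<in> ?B" by (rule complex_vector.subspace_scale[OF sB xy(2)])
    show ?case
      using Cons.IH[OF xy(3)] ky complex_vector.subspace_add[OF sB ky] p_add[OF _ ky] p_sc[OF _ xy(2) xy(2)]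
      by (simp add: q \<epsilon>p[OF xy(1)])
  qed
  from this[OF \<Delta>] have eps_B: "eps_t \<Delta> \<epsilon> b \<in> ?B"
    "\<And>a. a \<in> rel_commutant N M1 \<Longrightarrow> ?p a (eps_t \<Delta> \<epsilon> b) = (\<Sum>(x, y)\<leftarrow>\<Delta> 1. ?p c x * ?p a y)"
    unfolding eps_t_def by auto
  have "eps_t \<Delta> \<epsilon> b - c = 0"
  proof (rule pairing_nondegenerate[OF w])
    show "eps_t \<Delta> \<epsilon> b - c \<in> ?B" using eps_B(1) cB complex_vector.subspace_diff[OF sB] by blast
    fix a assume a: "a \<in> rel_commutant N M1"
    have aM: "a \<in> M2" "c \<in> M2" using rel_commutant_mem[OF a] rel_commutant_mem[OF cA] M1_M2 by auto
    have "?p a (eps_t \<Delta> \<epsilon> b) = ?p (c * a) 1" using eps_B(2)[OF a] \<Delta>1[OF cA a] by simp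
    also have "\<dots> = ?p a c"
    proof -
      have "\<tau> (c * (a * e2 * e1 * w)) = \<tau> (a * e2 * e1 * w * c)"
        by (rule L2.\<tau>R_commute) (use aM e21 L2.RD(3) in \<open>auto simp: mult.assoc\<close>)
      then show ?thesis by (simp add: pairing_def mult.assoc)
    qed
    finally show "?p a (eps_t \<Delta> \<epsilon> b - c) = 0" using p_diff[OF a eps_B(1) cB] by simp
  qed
  then show ?thesis by (simp add: c_def)
qed

lemma fixed_points_eq:
  assumes w: "w \<in> rel_commutant M M1" "v * w = 1"
    and \<Delta>: "set (\<Delta> 1) \<subseteq> rel_commutant M M2 \<times> rel_commutant M M2"
    and \<Delta>1: "\<And>a1 a2. a1 \<in> rel_commutant N M1 \<Longrightarrow> a2 \<in> rel_commutant N M1 \<Longrightarrow>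
      (\<Sum>(x, y)\<leftarrow>\<Delta> 1. pairing lam \<tau> e1 e2 w a1 x * pairing lam \<tau> e1 e2 w a2 y) = pairing lam \<tau> e1 e2 w (a1 * a2) 1"
    and \<epsilon>: "\<And>b. b \<in> rel_commutant M M2 \<Longrightarrow> \<epsilon> b = pairing lam \<tau> e1 e2 w 1 b"
  shows "fixed_point_subalgebra (rel_commutant M M2) \<Delta> \<epsilon> (tower_action lam E e2) M1 = M"
proof -
  have eps: "eps_t \<Delta> \<epsilon> b = (1 / l) *\<^sub>C (E (b * e2))" if b: "b \<in> rel_commutant M M2" for b
    by (rule eps_t_eq[where \<Delta> = \<Delta> and \<epsilon> = \<epsilon>, OF w \<Delta>]) (rule \<Delta>1, assumption+, rule \<epsilon>, assumption, rule b)
  have act: "tower_action lam E e2 b x = (1 / l) *\<^sub>C E (b * x * e2)" for b x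
    by (simp add: tower_action_def)
  \<comment> \<open>Because E e2 = lam, the elements of \<open>M1\<close> act by left
    multiplication. This is applied to \<open>c\<close>, the counital image of \<open>b\<close>, and
    to 1, the counital image of \<open>e2\<close>.\<close>
  have act_M1: "tower_action lam E e2 c x = c * x" if "c \<in> M1" "x \<in> M1" for c x
    using E_left[OF L2.MD(3)[OF that] L2.eR] E_e2 lam
    by (simp add: act scaleC_mult_right scaleC_scaleC scaleC_one)
  show ?thesis
  proof (intro equalityI subsetI)
    fix x assume x: "x \<in> M"
    have "tower_action lam E e2 b x = tower_action lam E e2 (eps_t \<Delta> \<epsilon> b) x" if b: "b \<in> rel_commutant M M2" for b
    proof -
      define c where "c = (1 / l) *\<^sub>C (E (b * e2))"
      have c: "c \<in> rel_commutant M M1" unfolding c_def by (rule E_rel_commutant[OF b])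
      have be: "b * e2 \<in> M2" using rel_commutant_mem[OF b] L2.eR L2.RD(3) by blast
      have "tower_action lam E e2 b x = (1 / l) *\<^sub>C E (x * (b * e2))"
        unfolding act rel_commutant_commute[OF b x] by (simp add: mult.assoc)
      also have "\<dots> = x * c" using E_left[OF M_M1[OF x] be] by (simp add: c_def scaleC_mult_right)
      also have "\<dots> = c * x" using rel_commutant_commute[OF c x] by simp
      also have "\<dots> = tower_action lam E e2 c x" using act_M1 rel_commutant_mem[OF c] M_M1[OF x] by simp
      finally show ?thesis unfolding eps[OF b] c_def .
    qed
    then show "x \<in> fixed_point_subalgebra (rel_commutant M M2) \<Delta> \<epsilon> (tower_action lam E e2) M1"
      unfolding fixed_point_subalgebra_def using M_M1[OF x] by blast
  next
    fix x assume "x \<in> fixed_point_subalgebra (rel_commutant M M2) \<Delta> \<epsilon> (tower_action lam E e2) M1"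
    then have x: "x \<in> M1" and fx: "tower_action lam E e2 e2 x = tower_action lam E e2 (eps_t \<Delta> \<epsilon> e2) x"
      unfolding fixed_point_subalgebra_def using e2_rel_commutant by auto
    have "eps_t \<Delta> \<epsilon> e2 = 1"
      using eps[OF e2_rel_commutant] lam by (simp add: L2.e_idem E_e2 scaleC_scaleC scaleC_one)
    then have fx': "(1 / l) *\<^sub>C E (e2 * x * e2) = x"
      using fx act_M1[OF L2.MD(2) x] by (simp only: act mult_1_left)
    have exM: "e2 * x \<in> M2" using L2.eR M1_M2[OF x] L2.RD(3) by blast
    have ex: "e2 * x * e2 = x * e2" using pull_down_e2[OF exM] fx' by simp
    obtain n where n: "n \<in> M" "e2 * x * e2 = n * e2" using L2.compression[OF M1_M2[OF x]] by metis
    have "E (x * e2) = E (n * e2)" using ex n(2) by simp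
    then have "l *\<^sub>C x = l *\<^sub>C n"
      using E_left[OF x L2.eR] E_left[OF M_M1[OF n(1)] L2.eR] by (simp add: E_e2 scaleC_mult_right)
    then have "x = n" by (rule complex_vector.scale_left_imp_eq[OF lam])
    then show "x \<in> M" using n(1) by simp
  qed
qed

end

section \<open>Assembling the tower from the hypotheses\<close>

lemma basic_construction_jones_step:
  fixes \<tau> :: "'h::chilbert_space bop \<Rightarrow> complex"
  assumes "factor N" "von_neumann_algebra M" "von_neumann_algebra R"
    and \<tau>: "faithful_normal_trace R \<tau>" "\<tau> 1 = 1"
    and bc: "basic_construction TYPE('k::chilbert_space) \<tau> N M R e"
  obtains \<pi> :: "'h bop \<Rightarrow> 'k::chilbert_space bop" and \<Omega> where "jones_step M \<tau> \<pi> \<Omega> N R e"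
proof -
  have sub: "N \<subseteq> M" "M \<subseteq> R" "e \<in> R" using bc unfolding basic_construction_def by auto
  obtain \<pi> :: "'h bop \<Rightarrow> 'k bop" and \<Omega> where \<pi>: "star_hom_on R \<pi>" "inj_on \<pi> R" "standard_rep \<tau> M \<pi> \<Omega>"
    "projection_onto (orbit_closure (\<pi> ` N) \<Omega>) (\<pi> e)" "\<pi> ` R = commutant (commutant (\<pi> ` M \<union> {\<pi> e}))"
    using bc unfolding basic_construction_def by blast
  have "jones_step M \<tau> \<pi> \<Omega> N R e"
    by unfold_locales
      (use assms sub \<pi> von_neumann_algebra_star_algebra faithful_normal_trace_mono[OF \<tau>(1) sub(2)] in auto)
  then show ?thesis using that by blast
qed

theorem proposition8p3p2:
  fixes N M M1 M2 A B Bt :: "'h::chilbert_space bop set"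
    and e1 e2 w :: "'h bop"
    and lam :: real
    and \<tau> :: "'h bop \<Rightarrow> complex"
    and E :: "'h bop \<Rightarrow> 'h bop"
    and \<Delta> :: "'h bop \<Rightarrow> ('h bop \<times> 'h bop) list"
    and \<epsilon> :: "'h bop \<Rightarrow> complex"
    and SB S dag :: "'h bop \<Rightarrow> 'h bop"
  defines "A \<equiv> rel_commutant N M1"
    and "B \<equiv> rel_commutant M M2"
    and "Bt \<equiv> rel_commutant M M1"
  assumes "II1_factor N" and "II1_factor M"
    and "von_neumann_algebra M1" and "von_neumann_algebra M2"
    and "normalized_trace M2 \<tau>"
    and "basic_construction TYPE('k0::chilbert_space) \<tau> N M M1 e1"
    and "basic_construction TYPE('k1::chilbert_space) \<tau> M M1 M2 e2"
    and "finite_jones_index TYPE('k0) \<tau> N M (1 / lam)"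
    and depth2: "basic_construction TYPE('k2::chilbert_space) \<tau>
          (rel_commutant N M) (rel_commutant N M1) (rel_commutant N M2) e2"
    and "conditional_expectation \<tau> M2 M1 E"
    and "canonical_weight \<tau> Bt w"
    and "\<forall>b\<in>B. set (\<Delta> b) \<subseteq> B \<times> B"
    and "\<forall>a1\<in>A. \<forall>a2\<in>A. \<forall>b\<in>B.
          (\<Sum>(x, y)\<leftarrow>\<Delta> b. pairing lam \<tau> e1 e2 w a1 x * pairing lam \<tau> e1 e2 w a2 y)
            = pairing lam \<tau> e1 e2 w (a1 * a2) b"
    and "\<forall>b\<in>B. \<epsilon> b = pairing lam \<tau> e1 e2 w 1 b"
    and "\<forall>b\<in>B. SB b \<in> B \<and> E (b * e1 * e2) = E (e2 * e1 * SB b)"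
    and "\<forall>b\<in>B. S b = SB (w * b * two_sided_inverse w)"
    and "\<forall>b\<in>B. dag b = two_sided_inverse (S w) * adj b * S w"
    and "cstar_quantum_groupoid B \<Delta> \<epsilon> S dag"
  shows "fixed_point_subalgebra B \<Delta> \<epsilon> (tower_action lam E e2) M1 = M"
proof -
  note assms' = assms(4-)
  have F: "factor N" "factor M" using assms' unfolding II1_factor_def by auto
  have vM: "von_neumann_algebra M" using F(2) unfolding factor_def by blast
  have \<tau>: "faithful_normal_trace M2 \<tau>" "\<tau> 1 = 1"
    using normalized_trace_faithful_normal_trace \<open>normalized_trace M2 \<tau>\<close>
    by (blast, simp add: normalized_trace_def)
  have M12: "M1 \<subseteq> M2"
    using \<open>basic_construction TYPE('k1) \<tau> M M1 M2 e2\<close> unfolding basic_construction_def by blast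
  obtain \<pi>0 :: "'h bop \<Rightarrow> 'k0 bop" and \<Omega>0 where L1: "jones_step M \<tau> \<pi>0 \<Omega>0 N M1 e1"
    using basic_construction_jones_step[OF F(1) vM \<open>von_neumann_algebra M1\<close>
        faithful_normal_trace_mono[OF \<tau>(1) M12] \<tau>(2) \<open>basic_construction TYPE('k0) \<tau> N M M1 e1\<close>] .
  obtain \<pi>1 :: "'h bop \<Rightarrow> 'k1 bop" and \<Omega>1 where L2: "jones_step M1 \<tau> \<pi>1 \<Omega>1 M M2 e2"
    using basic_construction_jones_step[OF F(2) \<open>von_neumann_algebra M1\<close> \<open>von_neumann_algebra M2\<close>
        \<tau> \<open>basic_construction TYPE('k1) \<tau> M M1 M2 e2\<close>] .
  have "1 = complex_of_real (1 / lam) * \<tau> e1"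
    by (rule jones_step.trace_e_eq_index[OF L1 F(2) \<open>finite_jones_index TYPE('k0) \<tau> N M (1 / lam)\<close>])
  \<comment> \<open>By the convention 1 / 0 = 0, the case lam = 0 would turn the preceding equation
    into 1 = 0.\<close>
  then have "\<tau> e1 = complex_of_real lam"
    by (cases "lam = 0") (auto simp: field_simps)
  then interpret jones_tower_expectation N M M1 M2 e1 e2 \<tau> \<pi>0 \<Omega>0 \<pi>1 \<Omega>1 E lam
    using L1 L2 \<open>conditional_expectation \<tau> M2 M1 E\<close>
    unfolding jones_tower_expectation_def jones_tower_def jones_tower_expectation_axioms_def by blast
  obtain v where w: "w \<in> rel_commutant M M1" "v * w = 1"
    using \<open>canonical_weight \<tau> Bt w\<close> unfolding canonical_weight_def Bt_def rel_commutant_def by blast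
  have B1: "1 \<in> B" unfolding B_def using L2.RD(2) by (intro rel_commutantI) auto
  show ?thesis
    unfolding B_def
  proof (rule fixed_points_eq[OF w])
    show "set (\<Delta> 1) \<subseteq> rel_commutant M M2 \<times> rel_commutant M M2"
      using \<open>\<forall>b\<in>B. set (\<Delta> b) \<subseteq> B \<times> B\<close> B1 unfolding B_def by blast
    show "(\<Sum>(x, y)\<leftarrow>\<Delta> 1. pairing lam \<tau> e1 e2 w a1 x * pairing lam \<tau> e1 e2 w a2 y) = pairing lam \<tau> e1 e2 w (a1 * a2) 1"
      if "a1 \<in> rel_commutant N M1" "a2 \<in> rel_commutant N M1" for a1 a2
      using assms'(13) that B1 unfolding A_def by blast
    show "\<epsilon> b = pairing lam \<tau> e1 e2 w 1 b" if "b \<in> rel_commutant M M2" for b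
      using \<open>\<forall>b\<in>B. \<epsilon> b = pairing lam \<tau> e1 e2 w 1 b\<close> that unfolding B_def by blast
  qed
qed

end
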